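(* Let $\mathcal{F}$ be an adequate MSO-class of forests, and let $\mathcal{T}$ be the class of trees in $\mathcal{F}$ (so $\mathcal{F} = (\ge 1)\mathcal{T}$). Then the following are equivalent: (i) $\mathcal{F}$ has a monadic second-order 0--1 law; (ii) the radius of $\mathcal{F}$ is $1$; (iii) the radius of $\mathcal{T}$ is $\ge 1$.
   Context: A (finite rooted) forest is a finite nonempty poset $(F,<)$ such that for every $x\in F$ the set $\{y\in F: y\ge x\}$ is a chain; a tree is a forest with a greatest element (its root). Forests are considered up to isomorphism (unlabelled). The sum $F_1+F_2$ of forests is their disjoint union; every forest is uniquely a sum of trees (its components). For a class $\mathcal{T}$ of trees, $(\ge 1)\mathcal{T}$ is the class of all forests that are sums of one or more trees from $\mathcal{T}$ (repetitions allowed). A class $\mathcal{F}$ of forests is adequate if it is closed under sums and under extraction of component trees; equivalently $\mathcal{F}=(\ge1)\mathcal{T}$ for $\mathcal{T}$ the class of trees in $\mathcal{F}$. For a class $\mathcal{C}$, $c(n)$ is the number of isomorphism types of members of $\mathcal{C}$ of size $n$, its (ordinary) generating function is $\mathbf{C}(x)=\sum_n c(n)x^n$, and the radius of $\mathcal{C}$ is the radius of convergence of $\mathbf{C}(x)$. Monadic second-order (MSO) logic here is over the single binary relation symbol $<$ (with equality), with first-order variables and monadic (set) second-order variables, quantifiers over both. An MSO-class is the class of finite models (forests, resp. trees) of an MSO sentence. Let $d$ be the gcd of the sizes of the members of $\mathcal{F}$. $\mathcal{F}$ has an MSO 0--1 law if for every MSO sentence $\varphi$, letting $\mathcal{F}_\varphi$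 be the members of $\mathcal{F}$ satisfying $\varphi$ with counting function $f_\varphi(n)$, the limit $\lim_{n\to\infty} f_\varphi(nd)/f(nd)$ exists and equals $0$ or $1$. *)

theory Defs
  imports "HOL-Analysis.Analysis"
begin

section \<open>Forests and trees as finite relational structures\<close>

text \<open>A structure \<open>(A, r)\<close> consists of a universe \<open>A\<close> and the interpretation \<open>r\<close> of the
  single binary symbol \<open><\<close>, so that \<open>(x, y) \<in> r\<close> means \<open>x < y\<close>.\<close>

type_synonym 'a struct = "'a set \<times> 'a rel"

abbreviation universe :: "'a struct \<Rightarrow> 'a set" where "universe \<equiv> fst"
abbreviation less_rel :: "'a struct \<Rightarrow> 'a rel" where "less_rel \<equiv> snd"

definition finite_poset :: "'a struct \<Rightarrow> bool" where
  "finite_poset S \<longleftrightarrow> finite (universe S) \<and> universe S \<noteq> {} \<and>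
     less_rel S \<subseteq> universe S \<times> universe S \<and> irrefl (less_rel S) \<and> trans (less_rel S)"

definition upset :: "'a struct \<Rightarrow> 'a \<Rightarrow> 'a set" where
  "upset S x = {y \<in> universe S. y = x \<or> (x, y) \<in> less_rel S}"

definition is_forest :: "'a struct \<Rightarrow> bool" where
  "is_forest S \<longleftrightarrow> finite_poset S \<and> (\<forall>x\<in>universe S. total_on (upset S x) (less_rel S))"

definition is_tree :: "'a struct \<Rightarrow> bool" where
  "is_tree S \<longleftrightarrow> is_forest S \<and>
     (\<exists>g\<in>universe S. \<forall>x\<in>universe S. x = g \<or> (x, g) \<in> less_rel S)"

definition struct_iso :: "'a struct \<Rightarrow> 'b struct \<Rightarrow> bool"  (infix "\<simeq>\<^sub>s" 50) where
  "S \<simeq>\<^sub>s S' \<longleftrightarrow> (\<exists>h. bij_betw h (universe S) (universe S') \<and>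
     (\<forall>x\<in>universe S. \<forall>y\<in>universe S. (x, y) \<in> less_rel S \<longleftrightarrow> (h x, h y) \<in> less_rel S'))"

definition struct_sum :: "'a struct list \<Rightarrow> (nat \<times> 'a) struct" where
  "struct_sum Ss =
     ({(i, x). i < length Ss \<and> x \<in> universe (Ss ! i)},
      {((i, x), (j, y)). i < length Ss \<and> j = i \<and> (x, y) \<in> less_rel (Ss ! i)})"


section \<open>Classes of forests\<close>

text \<open>Every finite structure is isomorphic to one whose universe is a set of natural numbers.
  A class of (unlabelled) forests is therefore represented by an isomorphism-closed set of
  forests over \<^typ>\<open>nat\<close>; sums live on another type and are compared up to isomorphism.\<close>

definition forest_class :: "nat struct set \<Rightarrow> bool" where
  "forest_class \<F> \<longleftrightarrow> (\<forall>S\<in>\<F>. is_forest S) \<and>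
     (\<forall>S\<in>\<F>. \<forall>S'::nat struct. less_rel S' \<subseteq> universe S' \<times> universe S' \<longrightarrow>
        S \<simeq>\<^sub>s S' \<longrightarrow> S' \<in> \<F>)"

definition trees_of :: "nat struct set \<Rightarrow> nat struct set" where
  "trees_of \<F> = {S \<in> \<F>. is_tree S}"

definition closed_under_sums :: "nat struct set \<Rightarrow> bool" where
  "closed_under_sums \<F> \<longleftrightarrow>
     (\<forall>S1\<in>\<F>. \<forall>S2\<in>\<F>. \<forall>S::nat struct. is_forest S \<longrightarrow> S \<simeq>\<^sub>s struct_sum [S1, S2] \<longrightarrow> S \<in> \<F>)"

text \<open>The components of a forest are the trees of its (up to isomorphism and order unique)
  decomposition as a sum of trees.\<close>

definition is_component :: "nat struct \<Rightarrow> nat struct \<Rightarrow> bool" where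
  "is_component T S \<longleftrightarrow>
     (\<exists>Ts. (\<forall>T'\<in>set Ts. is_tree T') \<and> S \<simeq>\<^sub>s struct_sum Ts \<and> T \<in> set Ts)"

definition closed_under_components :: "nat struct set \<Rightarrow> bool" where
  "closed_under_components \<F> \<longleftrightarrow> (\<forall>S\<in>\<F>. \<forall>T. is_component T S \<longrightarrow> T \<in> \<F>)"

definition adequate :: "nat struct set \<Rightarrow> bool" where
  "adequate \<F> \<longleftrightarrow> forest_class \<F> \<and> closed_under_sums \<F> \<and> closed_under_components \<F>"

definition sums_of :: "nat struct set \<Rightarrow> nat struct set"  ("'(\<ge>1')_" [1000] 1000) where
  "(\<ge>1)\<T> = {S. is_forest S \<and> (\<exists>Ts. Ts \<noteq> [] \<and> set Ts \<subseteq> \<T> \<and> S \<simeq>\<^sub>s struct_sum Ts)}"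

definition substruct :: "'a struct \<Rightarrow> 'a set \<Rightarrow> 'a struct" where
  "substruct S B = (B, less_rel S \<inter> B \<times> B)"

lemma is_forest_substruct:
  assumes "is_forest S" "B \<subseteq> universe S" "B \<noteq> {}"
  shows "is_forest (substruct S B)"
proof -
  have "finite_poset (substruct S B)"
    using assms unfolding is_forest_def finite_poset_def substruct_def
    by (auto simp: irrefl_def intro: finite_subset transI dest: transD)
  moreover have "total_on (upset (substruct S B) x) (less_rel (substruct S B))"
    if "x \<in> universe (substruct S B)" for x
  proof -
    have "total_on (upset S x) (less_rel S)"
      using assms that unfolding is_forest_def by (auto simp: substruct_def)
    then show ?thesis
      using assms(2) by (auto simp: total_on_def upset_def substruct_def)
  qed
  ultimately show ?thesis unfolding is_forest_def by blast
qed

lemma forest_below_maximal: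
  assumes "is_forest S" "x \<in> universe S"
  shows "\<exists>m\<in>universe S. (\<forall>y. (m, y) \<notin> less_rel S) \<and> (x = m \<or> (x, m) \<in> less_rel S)"
proof -
  let ?U = "upset S x"
  have fin: "finite (universe S)" and sub: "less_rel S \<subseteq> universe S \<times> universe S"
    and irr: "irrefl (less_rel S)" and tr: "trans (less_rel S)"
    using assms(1) by (auto simp: is_forest_def finite_poset_def)
  have "wf ((less_rel S)\<inverse>)"
  proof (rule finite_acyclic_wf_converse)
    show "finite (less_rel S)" using fin sub by (meson finite_SigmaI finite_subset)
    show "acyclic (less_rel S)"
      using irr tr by (simp add: acyclic_irrefl trancl_id)
  qed
  moreover have "x \<in> ?U" using assms(2) by (auto simp: upset_def)
  ultimately obtain m where m: "m \<in> ?U" "\<And>y. (y, m) \<in> (less_rel S)\<inverse> \<Longrightarrow> y \<notin> ?U"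
    by (rule wfE_min) blast
  have "(m, y) \<notin> less_rel S" for y
  proof
    assume my: "(m, y) \<in> less_rel S"
    then have "y \<in> ?U" using m(1) sub tr by (auto simp: upset_def dest: transD)
    then show False using m(2) my by blast
  qed
  then show ?thesis using m(1) by (auto simp: upset_def)
qed

lemma forest_tree_decomposition:
  fixes S :: "'a struct"
  assumes S: "is_forest S"
  shows "\<exists>Ts :: 'a struct list. Ts \<noteq> [] \<and> (\<forall>T\<in>set Ts. is_tree T) \<and> S \<simeq>\<^sub>s struct_sum Ts"
proof -
  have fin: "finite (universe S)" and sub: "less_rel S \<subseteq> universe S \<times> universe S"
    and ne: "universe S \<noteq> {}" and irr: "irrefl (less_rel S)" and tr: "trans (less_rel S)"
    using S by (auto simp: is_forest_def finite_poset_def)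
  define R where "R = {m \<in> universe S. \<forall>y. (m, y) \<notin> less_rel S}"
  define D where "D m = {x \<in> universe S. x = m \<or> (x, m) \<in> less_rel S}" for m
  have "finite R" using fin by (simp add: R_def)
  then obtain rs where rs: "set rs = R" "distinct rs" using finite_distinct_list by blast
  have cover: "\<exists>m\<in>R. x \<in> D m" if "x \<in> universe S" for x
    using forest_below_maximal[OF S that] that by (auto simp: R_def D_def)
  have disj: "m = m'" if "m \<in> R" "m' \<in> R" "x \<in> D m" "x \<in> D m'" for m m' x
  proof (rule ccontr)
    assume "m \<noteq> m'"
    have "x \<in> universe S" using that(3) by (auto simp: D_def)
    then have "total_on (upset S x) (less_rel S)" using S by (simp add: is_forest_def)
    moreover have "m \<in> upset S x" "m' \<in> upset S x"
      using that by (auto simp: D_def R_def upset_def)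
    ultimately have "(m, m') \<in> less_rel S \<or> (m', m) \<in> less_rel S"
      using \<open>m \<noteq> m'\<close> by (auto simp: total_on_def)
    then show False using that by (auto simp: R_def)
  qed
  define Ts where "Ts = map (\<lambda>m. substruct S (D m)) rs"
  have tree: "is_tree (substruct S (D m))" if "m \<in> R" for m
  proof -
    have mD: "m \<in> D m" using that by (auto simp: D_def R_def)
    have "is_forest (substruct S (D m))"
      by (rule is_forest_substruct[OF S]) (use mD in \<open>auto simp: D_def\<close>)
    then show ?thesis
      unfolding is_tree_def using mD by (auto simp: substruct_def D_def)
  qed
  define ix where "ix x = (THE i. i < length rs \<and> x \<in> D (rs ! i))" for x
  have ix: "i = ix x" if "i < length rs" "x \<in> D (rs ! i)" for i x
    unfolding ix_def
  proof (rule the_equality[symmetric])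
    show "i < length rs \<and> x \<in> D (rs ! i)" using that by simp
    fix j assume "j < length rs \<and> x \<in> D (rs ! j)"
    then have "rs ! j = rs ! i" using disj that rs(1) nth_mem by metis
    then show "j = i"
      using \<open>j < length rs \<and> _\<close> that rs(2) by (simp add: nth_eq_iff_index_eq)
  qed
  have ix_ex: "ix x < length rs \<and> x \<in> D (rs ! ix x)" if x: "x \<in> universe S" for x
  proof -
    obtain m where "m \<in> R" "x \<in> D m" using cover[OF x] by blast
    then obtain i where "i < length rs" "x \<in> D (rs ! i)"
      using rs(1) by (metis in_set_conv_nth)
    then show ?thesis using ix by metis
  qed
  have down: "x \<in> D m" if "(x, y) \<in> less_rel S" "y \<in> D m" for x y m
    using that sub tr by (auto simp: D_def dest: transD)
  have ix_less: "ix x = ix y" if "(x, y) \<in> less_rel S" for x y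
  proof -
    have "y \<in> universe S" using that sub by blast
    then show ?thesis using ix_ex[of y] down[OF that] ix by metis
  qed
  have "S \<simeq>\<^sub>s struct_sum Ts"
    unfolding struct_iso_def
  proof (intro exI conjI ballI)
    show "bij_betw (\<lambda>x. (ix x, x)) (universe S) (universe (struct_sum Ts))"
      unfolding bij_betw_def
    proof
      show "inj_on (\<lambda>x. (ix x, x)) (universe S)" by (simp add: inj_on_def)
      show "(\<lambda>x. (ix x, x)) ` universe S = universe (struct_sum Ts)"
      proof
        show "(\<lambda>x. (ix x, x)) ` universe S \<subseteq> universe (struct_sum Ts)"
          using ix_ex by (auto simp: struct_sum_def Ts_def substruct_def)
        show "universe (struct_sum Ts) \<subseteq> (\<lambda>x. (ix x, x)) ` universe S"
        proof
          fix p assume "p \<in> universe (struct_sum Ts)"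
          then obtain i x where p: "p = (i, x)" "i < length rs" "x \<in> D (rs ! i)"
            by (auto simp: struct_sum_def Ts_def substruct_def)
          moreover have "x \<in> universe S" using p(3) by (simp add: D_def)
          ultimately show "p \<in> (\<lambda>x. (ix x, x)) ` universe S"
            using ix[OF p(2,3)] by blast
        qed
      qed
    qed
    fix x y assume "x \<in> universe S" "y \<in> universe S"
    then show "(x, y) \<in> less_rel S \<longleftrightarrow> ((ix x, x), (ix y, y)) \<in> less_rel (struct_sum Ts)"
      using ix_ex[of x] ix_ex[of y] ix_less[of x y]
      by (auto simp: struct_sum_def Ts_def substruct_def)
  qed
  moreover have "Ts \<noteq> []" using ne cover rs(1) by (auto simp: Ts_def)
  moreover have "\<forall>T\<in>set Ts. is_tree T" using tree rs(1) by (auto simp: Ts_def)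
  ultimately show ?thesis by blast
qed

lemma struct_iso_sym: "S \<simeq>\<^sub>s S' \<Longrightarrow> S' \<simeq>\<^sub>s S"
proof -
  assume "S \<simeq>\<^sub>s S'"
  then obtain h where h: "bij_betw h (universe S) (universe S')"
    and r: "\<And>x y. x \<in> universe S \<Longrightarrow> y \<in> universe S \<Longrightarrow>
      (x, y) \<in> less_rel S \<longleftrightarrow> (h x, h y) \<in> less_rel S'"
    unfolding struct_iso_def by blast
  let ?g = "inv_into (universe S) h"
  have "bij_betw ?g (universe S') (universe S)" using h by (rule bij_betw_inv_into)
  moreover have "(x, y) \<in> less_rel S' \<longleftrightarrow> (?g x, ?g y) \<in> less_rel S"
    if "x \<in> universe S'" "y \<in> universe S'" for x y
  proof -
    have "x \<in> h ` universe S" "y \<in> h ` universe S" using that h by (auto simp: bij_betw_def)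
    then show ?thesis
      using r[of "?g x" "?g y"] by (simp add: f_inv_into_f inv_into_into)
  qed
  ultimately show ?thesis unfolding struct_iso_def by blast
qed

lemma closed_under_sums_list:
  fixes S :: "nat struct"
  assumes F: "forest_class \<F>" "closed_under_sums \<F>"
    and "Ts \<noteq> []" "set Ts \<subseteq> \<F>" "is_forest S" "S \<simeq>\<^sub>s struct_sum Ts"
  shows "S \<in> \<F>"
  using assms(3-6)
proof (induction Ts arbitrary: S rule: list_nonempty_induct)
  case (single T)
  obtain h where h: "bij_betw h (universe S) (universe (struct_sum [T]))"
    and r: "\<And>x y. x \<in> universe S \<Longrightarrow> y \<in> universe S \<Longrightarrow>
      (x, y) \<in> less_rel S \<longleftrightarrow> (h x, h y) \<in> less_rel (struct_sum [T])"
    using single.prems(3) unfolding struct_iso_def by blast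
  have "bij_betw snd (universe (struct_sum [T])) (universe T)"
    by (auto simp: bij_betw_def inj_on_def struct_sum_def image_iff)
  with h have b: "bij_betw (snd \<circ> h) (universe S) (universe T)"
    by (rule bij_betw_trans)
  have "S \<simeq>\<^sub>s T"
    unfolding struct_iso_def
  proof (intro exI conjI ballI)
    show "bij_betw (snd \<circ> h) (universe S) (universe T)" by (fact b)
    fix x y assume xy: "x \<in> universe S" "y \<in> universe S"
    then have "h x \<in> universe (struct_sum [T])" "h y \<in> universe (struct_sum [T])"
      using h by (auto simp: bij_betw_def)
    then have "fst (h x) = 0" "fst (h y) = 0" by (auto simp: struct_sum_def)
    then show "(x, y) \<in> less_rel S \<longleftrightarrow> ((snd \<circ> h) x, (snd \<circ> h) y) \<in> less_rel T"
      using r[OF xy] by (cases "h x"; cases "h y") (auto simp: struct_sum_def)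
  qed
  then have "T \<simeq>\<^sub>s S" by (rule struct_iso_sym)
  moreover have "less_rel S \<subseteq> universe S \<times> universe S"
    using single.prems(2) by (auto simp: is_forest_def finite_poset_def)
  moreover have "T \<in> \<F>" using single.prems(1) by simp
  ultimately show ?case using F(1) unfolding forest_class_def by blast
next
  case (cons T Ts)
  have sub: "less_rel S \<subseteq> universe S \<times> universe S"
    using cons.prems(2) by (auto simp: is_forest_def finite_poset_def)
  obtain h where h: "bij_betw h (universe S) (universe (struct_sum (T # Ts)))"
    and r: "\<And>x y. x \<in> universe S \<Longrightarrow> y \<in> universe S \<Longrightarrow>
      (x, y) \<in> less_rel S \<longleftrightarrow> (h x, h y) \<in> less_rel (struct_sum (T # Ts))"
    using cons.prems(3) unfolding struct_iso_def by blast
  have inj: "inj_on h (universe S)" and im: "h ` universe S = universe (struct_sum (T # Ts))"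
    using h by (auto simp: bij_betw_def)
  have hx: "fst (h x) < length (T # Ts) \<and> snd (h x) \<in> universe ((T # Ts) ! fst (h x))"
    if "x \<in> universe S" for x
  proof -
    have "h x \<in> universe (struct_sum (T # Ts))" using im that by blast
    then show ?thesis by (auto simp: struct_sum_def)
  qed
  have surj: "\<exists>x\<in>universe S. h x = (i, y)"
    if "i < length (T # Ts)" "y \<in> universe ((T # Ts) ! i)" for i y
  proof -
    have "(i, y) \<in> universe (struct_sum (T # Ts))"
      unfolding struct_sum_def using that by simp
    then show ?thesis using im by (metis imageE)
  qed
  have r': "(x, y) \<in> less_rel S \<longleftrightarrow> fst (h y) = fst (h x) \<and>
      (snd (h x), snd (h y)) \<in> less_rel ((T # Ts) ! fst (h x))"
    if "x \<in> universe S" "y \<in> universe S" for x y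
    using r[OF that] hx[OF that(1)] by (cases "h x"; cases "h y") (auto simp: struct_sum_def)
  define B where "B = {x \<in> universe S. fst (h x) \<noteq> 0}"
  define S' where "S' = substruct S B"
  have "B \<noteq> {}"
  proof -
    obtain T' Ts' where Ts: "Ts = T' # Ts'" using cons.hyps by (cases Ts) auto
    then have "is_forest T'" using cons.prems(1) F(1) by (auto simp: forest_class_def)
    then obtain a where "a \<in> universe T'" by (auto simp: is_forest_def finite_poset_def)
    then show ?thesis using surj[of 1 a] Ts by (auto simp: B_def)
  qed
  then have "is_forest S'"
    unfolding S'_def using cons.prems(2) by (intro is_forest_substruct) (auto simp: B_def)
  moreover have "S' \<simeq>\<^sub>s struct_sum Ts"
    unfolding struct_iso_def
  proof (intro exI conjI ballI)
    let ?g = "\<lambda>x. (fst (h x) - 1, snd (h x))"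
    show "bij_betw ?g (universe S') (universe (struct_sum Ts))"
      unfolding bij_betw_def
    proof
      show "inj_on ?g (universe S')"
      proof (rule inj_onI)
        fix x y assume "x \<in> universe S'" "y \<in> universe S'" "?g x = ?g y"
        then have xy: "x \<in> universe S" "y \<in> universe S" "fst (h x) \<noteq> 0" "fst (h y) \<noteq> 0"
          "fst (h x) - 1 = fst (h y) - 1" "snd (h x) = snd (h y)"
          by (simp_all add: S'_def substruct_def B_def)
        then have "h x = h y" by (intro prod_eqI) linarith+
        then show "x = y" using inj_onD[OF inj] xy by blast
      qed
      show "?g ` universe S' = universe (struct_sum Ts)"
      proof
        show "?g ` universe S' \<subseteq> universe (struct_sum Ts)"
        proof
          fix p assume "p \<in> ?g ` universe S'"
          then obtain x where x: "x \<in> universe S" "fst (h x) \<noteq> 0" "p = ?g x"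
            by (auto simp: S'_def substruct_def B_def)
          then show "p \<in> universe (struct_sum Ts)"
            using hx[OF x(1)] by (cases "fst (h x)") (simp_all add: struct_sum_def)
        qed
        show "universe (struct_sum Ts) \<subseteq> ?g ` universe S'"
        proof
          fix p assume "p \<in> universe (struct_sum Ts)"
          then obtain i y where p: "p = (i, y)" "i < length Ts" "y \<in> universe (Ts ! i)"
            by (auto simp: struct_sum_def)
          then obtain x where "x \<in> universe S" "h x = (Suc i, y)"
            using surj[of "Suc i" y] by auto
          then show "p \<in> ?g ` universe S'"
            using p by (intro image_eqI[of _ _ x]) (auto simp: S'_def substruct_def B_def)
        qed
      qed
    qed
    fix x y assume "x \<in> universe S'" "y \<in> universe S'"
    then have xy: "x \<in> B" "y \<in> B" "x \<in> universe S" "y \<in> universe S"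
      by (simp_all add: S'_def substruct_def B_def)
    then obtain i j where ij: "fst (h x) = Suc i" "fst (h y) = Suc j"
      by (auto simp: B_def gr0_conv_Suc)
    then show "(x, y) \<in> less_rel S' \<longleftrightarrow> (?g x, ?g y) \<in> less_rel (struct_sum Ts)"
      using r'[OF xy(3,4)] hx[OF xy(3)] xy(1,2)
      by (auto simp: S'_def substruct_def struct_sum_def)
  qed
  ultimately have "S' \<in> \<F>" using cons.IH cons.prems(1) by auto
  have "S \<simeq>\<^sub>s struct_sum [T, S']"
    unfolding struct_iso_def
  proof (intro exI conjI ballI)
    let ?g = "\<lambda>x. if fst (h x) = 0 then (0::nat, snd (h x)) else (1, x)"
    have U: "universe (struct_sum [T, S']) = {0} \<times> universe T \<union> {1} \<times> B"
      by (auto simp: struct_sum_def S'_def substruct_def less_Suc_eq)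
    show "bij_betw ?g (universe S) (universe (struct_sum [T, S']))"
      unfolding bij_betw_def
    proof
      show "inj_on ?g (universe S)"
      proof (rule inj_onI)
        fix x y assume xy: "x \<in> universe S" "y \<in> universe S" and "?g x = ?g y"
        then have "x = y \<or> fst (h x) = fst (h y) \<and> snd (h x) = snd (h y)"
          by (simp split: if_splits)
        then show "x = y" using inj_onD[OF inj _ xy] by (metis prod_eqI)
      qed
      show "?g ` universe S = universe (struct_sum [T, S'])"
      proof
        show "?g ` universe S \<subseteq> universe (struct_sum [T, S'])"
        proof
          fix p assume "p \<in> ?g ` universe S"
          then obtain x where x: "x \<in> universe S" "p = ?g x" by blast
          then show "p \<in> universe (struct_sum [T, S'])"
            using hx[OF x(1)] unfolding U by (auto simp: B_def)
        qed
        show "universe (struct_sum [T, S']) \<subseteq> ?g ` universe S"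
        proof
          fix p assume "p \<in> universe (struct_sum [T, S'])"
          then consider (1) y where "p = (0, y)" "y \<in> universe T" | (2) x where "p = (1, x)" "x \<in> B"
            unfolding U by auto
          then show "p \<in> ?g ` universe S"
          proof cases
            case 1
            then obtain x where "x \<in> universe S" "h x = (0, y)" using surj[of 0 y] by auto
            then show ?thesis using 1 by (intro image_eqI[of _ _ x]) auto
          next
            case 2
            then show ?thesis by (intro image_eqI[of _ _ x]) (auto simp: B_def)
          qed
        qed
      qed
    qed
    fix x y assume xy: "x \<in> universe S" "y \<in> universe S"
    show "(x, y) \<in> less_rel S \<longleftrightarrow> (?g x, ?g y) \<in> less_rel (struct_sum [T, S'])"
      using r'[OF xy] xy by (auto simp: struct_sum_def S'_def substruct_def B_def)
  qed
  then show ?case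
    using F(2) cons.prems(1,2) \<open>S' \<in> \<F>\<close> unfolding closed_under_sums_def
    by (meson list.set_intros(1) subsetD)
qed

lemma adequate_eq_sums_of_trees:
  assumes "adequate \<F>"
  shows "\<F> = (\<ge>1)(trees_of \<F>)"
proof
  have F: "forest_class \<F>" "closed_under_sums \<F>" "closed_under_components \<F>"
    using assms by (auto simp: adequate_def)
  show "\<F> \<subseteq> (\<ge>1)(trees_of \<F>)"
  proof
    fix S assume S: "S \<in> \<F>"
    then have "is_forest S" using F(1) by (auto simp: forest_class_def)
    then obtain Ts :: "nat struct list"
      where Ts: "Ts \<noteq> []" "\<forall>T\<in>set Ts. is_tree T" "S \<simeq>\<^sub>s struct_sum Ts"
      using forest_tree_decomposition by blast
    then have "set Ts \<subseteq> trees_of \<F>"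
      using F(3) S unfolding closed_under_components_def is_component_def trees_of_def by blast
    then show "S \<in> (\<ge>1)(trees_of \<F>)"
      using Ts \<open>is_forest S\<close> unfolding sums_of_def by blast
  qed
  show "(\<ge>1)(trees_of \<F>) \<subseteq> \<F>"
  proof
    fix S assume "S \<in> (\<ge>1)(trees_of \<F>)"
    then obtain Ts where Ts: "is_forest S" "Ts \<noteq> []" "set Ts \<subseteq> trees_of \<F>" "S \<simeq>\<^sub>s struct_sum Ts"
      unfolding sums_of_def by blast
    then have "set Ts \<subseteq> \<F>" by (auto simp: trees_of_def)
    then show "S \<in> \<F>" using closed_under_sums_list[OF F(1,2)] Ts(1,2,4) by blast
  qed
qed


section \<open>Monadic second-order logic over \<open><\<close>\<close>

text \<open>First-order and set variables are named by natural numbers in two separate name spaces.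
  The remaining connectives and the universal quantifiers are definable.\<close>

datatype mso =
    Less nat nat
  | Equal nat nat
  | Member nat nat
  | Neg mso
  | Conj mso mso
  | Ex_elem nat mso
  | Ex_set nat mso

primrec fv_elem :: "mso \<Rightarrow> nat set" where
  "fv_elem (Less x y) = {x, y}"
| "fv_elem (Equal x y) = {x, y}"
| "fv_elem (Member x X) = {x}"
| "fv_elem (Neg \<phi>) = fv_elem \<phi>"
| "fv_elem (Conj \<phi> \<psi>) = fv_elem \<phi> \<union> fv_elem \<psi>"
| "fv_elem (Ex_elem x \<phi>) = fv_elem \<phi> - {x}"
| "fv_elem (Ex_set X \<phi>) = fv_elem \<phi>"

primrec fv_set :: "mso \<Rightarrow> nat set" where
  "fv_set (Less x y) = {}"
| "fv_set (Equal x y) = {}"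
| "fv_set (Member x X) = {X}"
| "fv_set (Neg \<phi>) = fv_set \<phi>"
| "fv_set (Conj \<phi> \<psi>) = fv_set \<phi> \<union> fv_set \<psi>"
| "fv_set (Ex_elem x \<phi>) = fv_set \<phi>"
| "fv_set (Ex_set X \<phi>) = fv_set \<phi> - {X}"

definition sentence :: "mso \<Rightarrow> bool" where
  "sentence \<phi> \<longleftrightarrow> fv_elem \<phi> = {} \<and> fv_set \<phi> = {}"

primrec sat :: "'a struct \<Rightarrow> (nat \<Rightarrow> 'a) \<Rightarrow> (nat \<Rightarrow> 'a set) \<Rightarrow> mso \<Rightarrow> bool" where
  "sat S v V (Less x y) \<longleftrightarrow> (v x, v y) \<in> less_rel S"
| "sat S v V (Equal x y) \<longleftrightarrow> v x = v y"
| "sat S v V (Member x X) \<longleftrightarrow> v x \<in> V X"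
| "sat S v V (Neg \<phi>) \<longleftrightarrow> \<not> sat S v V \<phi>"
| "sat S v V (Conj \<phi> \<psi>) \<longleftrightarrow> sat S v V \<phi> \<and> sat S v V \<psi>"
| "sat S v V (Ex_elem x \<phi>) \<longleftrightarrow> (\<exists>a\<in>universe S. sat S (v(x := a)) V \<phi>)"
| "sat S v V (Ex_set X \<phi>) \<longleftrightarrow> (\<exists>B. B \<subseteq> universe S \<and> sat S v (V(X := B)) \<phi>)"

text \<open>For a sentence the choice of the assignment is irrelevant.\<close>

definition models :: "'a struct \<Rightarrow> mso \<Rightarrow> bool"  (infix "\<Turnstile>" 50) where
  "S \<Turnstile> \<phi> \<longleftrightarrow> (\<forall>v V. range v \<subseteq> universe S \<longrightarrow> (\<forall>X. V X \<subseteq> universe S) \<longrightarrow> sat S v V \<phi>)"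

definition mso_class :: "nat struct set \<Rightarrow> bool" where
  "mso_class \<F> \<longleftrightarrow> (\<exists>\<phi>. sentence \<phi> \<and> \<F> = {S. is_forest S \<and> S \<Turnstile> \<phi>})"


section \<open>Counting, radius and the 0--1 law\<close>

definition size_of :: "'a struct \<Rightarrow> nat" where
  "size_of S = card (universe S)"

definition count_types :: "nat struct set \<Rightarrow> nat \<Rightarrow> nat" where
  "count_types \<C> n = card ({S \<in> \<C>. size_of S = n} // {(S, S'). S \<simeq>\<^sub>s S'})"

definition gen_fun :: "nat struct set \<Rightarrow> real fps" where
  "gen_fun \<C> = Abs_fps (\<lambda>n. real (count_types \<C> n))"

definition radius :: "nat struct set \<Rightarrow> ereal" where
  "radius \<C> = fps_conv_radius (gen_fun \<C>)"

definition period :: "nat struct set \<Rightarrow> nat" where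
  "period \<F> = Gcd (size_of ` \<F>)"

text \<open>In the quotients below the denominator is nonzero for all large \<open>n\<close> when \<open>\<F>\<close> is
  adequate and nonempty, so the convention \<open>x / 0 = 0\<close> does not affect the limit.\<close>

definition mso_01_law :: "nat struct set \<Rightarrow> bool" where
  "mso_01_law \<F> \<longleftrightarrow> (\<forall>\<phi>. sentence \<phi> \<longrightarrow>
     (\<exists>L\<in>{0, 1}. (\<lambda>n. real (count_types {S \<in> \<F>. S \<Turnstile> \<phi>} (n * period \<F>)) /
                      real (count_types \<F> (n * period \<F>))) \<longlonglongrightarrow> L))"

end

theory Submission
  imports Defs "HOL-Library.Multiset"
begin

text \<open>
  Up to isomorphism a forest is a multiset of unordered trees, and a tree is a root above a forest.
  The monadic second-order theory of bounded quantifier depth of a forest depends only on the numbers,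
  up to a threshold, of its components of each of finitely many types; the type of a tree is computed
  in the same way from the subtrees at the children of its root.

  Let \<open>t\<close> count the trees and \<open>f\<close> the forests of the class. If the radius of \<open>t\<close> is at least \<open>1\<close>,
  there is no exponential branching in the dependency graph of the types: within a strongly connected
  component every tree is a spine that runs deterministically around one cycle. So \<open>t\<close> arises from
  simpler sequences by sums, products, geometric series and multiset constructions. All of these preserve
  slow variation, which means that \<open>a (n + b) / a n\<close> tends to \<open>1\<close> for some period \<open>b\<close>, up to residue
  classes on which \<open>a\<close> is eventually zero. For multisets this follows from the Euler identity
  \<open>n f(n) = \<Sum> i t(i) f(n - i j)\<close> over \<open>i, j \<ge> 1\<close>. Hence \<open>f (n + m) / f n\<close> tends to \<open>1\<close> along the
  period for every tree size \<open>m\<close>, almost all forests contain many components of every type, and they all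
  satisfy the same sentences.

  Conversely, forests having a given tree of size \<open>m\<close> as a component make up the proportion
  \<open>f (n - m) / f n\<close>. Under a 0--1 law this tends to \<open>0\<close> or \<open>1\<close>; the former is impossible because
  \<open>f n \<le> 4 ^ n\<close>, and the latter forces radius \<open>1\<close>.
\<close>

section \<open>Slowly varying coefficient sequences\<close>

text \<open>Ratio limits alone do not survive the operations below; the lower bound along residue
  classes pays for the error terms. In a convolution, moving the argument by \<open>b\<close>
  creates \<open>b\<close> new terms at the seam of its two halves; each is comparable to
  arbitrarily many old terms, so the seam is negligible. In the Euler identity a shift of
  \<open>n\<close> can be absorbed by layer \<open>j\<close> only if \<open>j\<close> divides it.
  Hence the layers beyond some \<open>J\<close> must be shown to carry a share of order
  \<open>1 / J\<close> in \<open>n f(n)\<close>, uniformly in \<open>n\<close>, and a factorial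
  shift then serves the remaining ones. The resulting bound for a long shift passes to a short one
  because adding components never lowers \<open>f\<close>.

  On the logical side finiteness of the set of types is not enough: the sum of types must be
  aperiodic. Parities of component counts, were they expressible, could split a class into parts of
  positive density, whereas counts up to a threshold are saturated in almost all forests.\<close>

text \<open>In every residue class modulo \<open>b\<close> such a sequence is eventually zero, or eventually positive with
  ratios tending to \<open>1\<close>. The last clause is what makes the class closed under the multiset construction.\<close>

definition smooth_at :: "nat \<Rightarrow> (nat \<Rightarrow> real) \<Rightarrow> bool" where
  "smooth_at b a \<longleftrightarrow> (\<forall>n. 0 \<le> a n) \<and>
     (\<forall>e>0. \<exists>N. \<forall>n\<ge>N. \<bar>a (n + b) - a n\<bar> \<le> e * a n) \<and>
     (\<exists>c>0. \<exists>N. \<forall>n\<ge>N. \<forall>j. c * a n \<le> a (n + j * b))"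

definition smooth :: "(nat \<Rightarrow> real) \<Rightarrow> bool" where
  "smooth a \<longleftrightarrow> (\<exists>b>0. smooth_at b a)"

lemma smooth_atD:
  assumes "smooth_at b a"
  shows "0 \<le> a n" "e > 0 \<Longrightarrow> \<exists>N. \<forall>n\<ge>N. \<bar>a (n + b) - a n\<bar> \<le> e * a n"
    "\<exists>c>0. \<exists>N. \<forall>n\<ge>N. \<forall>j. c * a n \<le> a (n + j * b)"
  using assms unfolding smooth_at_def by auto

lemma smooth_at_ratio_mult:
  assumes "smooth_at b a" "e > 0"
  shows "\<exists>N. \<forall>n\<ge>N. \<bar>a (n + m * b) - a n\<bar> \<le> e * a n"
  using assms(2)
proof (induction m arbitrary: e)
  case 0
  then show ?case using smooth_atD(1)[OF assms(1)] by (auto intro!: exI[of _ 0])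
next
  case (Suc m)
  \<comment> \<open>\<open>d \<le> 1\<close> gives \<open>a (n + m * b) \<le> 2 * a n\<close>; the
    last step then costs \<open>2 * d\<close> and the earlier ones \<open>d\<close>, in all
    \<open>3 * d \<le> e\<close>.\<close>
  define d where "d = min 1 (e / 3)"
  have d: "d > 0" "d \<le> 1" "d \<le> e / 3" using Suc.prems by (auto simp: d_def)
  obtain N1 where N1: "\<forall>n\<ge>N1. \<bar>a (n + m * b) - a n\<bar> \<le> d * a n" using Suc.IH[OF d(1)] by auto
  obtain N2 where N2: "\<forall>n\<ge>N2. \<bar>a (n + b) - a n\<bar> \<le> d * a n"
    using smooth_atD(2)[OF assms(1) d(1)] by auto
  show ?case
  proof (intro exI allI impI)
    fix n assume n: "max N1 N2 \<le> n"
    have "\<bar>a (n + m * b + b) - a (n + m * b)\<bar> \<le> d * a (n + m * b)" using N2 n by auto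
    moreover have 1: "\<bar>a (n + m * b) - a n\<bar> \<le> d * a n" using N1 n by auto
    ultimately have "\<bar>a (n + Suc m * b) - a n\<bar> \<le> d * a (n + m * b) + d * a n"
      by (simp add: algebra_simps)
    also have "a (n + m * b) \<le> a n + d * a n" using 1 by auto
    also have "\<dots> \<le> 2 * a n" using d(2) smooth_atD(1)[OF assms(1), of n]
      by (metis mult.commute mult_left_le one_add_one distrib_left mult.right_neutral add_left_mono mult.commute)
    finally have "\<bar>a (n + Suc m * b) - a n\<bar> \<le> d * (2 * a n) + d * a n"
      using d by (simp add: mult_left_mono)
    also have "\<dots> = (3 * d) * a n" by simp
    also have "\<dots> \<le> e * a n" using d smooth_atD(1)[OF assms(1), of n] by (intro mult_right_mono) auto
    finally show "\<bar>a (n + Suc m * b) - a n\<bar> \<le> e * a n" .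
  qed
qed

lemma smooth_at_mult:
  assumes "smooth_at b a" shows "smooth_at (m * b) a"
  unfolding smooth_at_def
proof (intro conjI allI impI)
  show "0 \<le> a n" for n using smooth_atD(1)[OF assms] .
  show "\<exists>N. \<forall>n\<ge>N. \<bar>a (n + m * b) - a n\<bar> \<le> e * a n" if "e > 0" for e
    using smooth_at_ratio_mult[OF assms that] .
  obtain c N where "c > 0" and "\<forall>n\<ge>N. \<forall>j. c * a n \<le> a (n + j * b)" using smooth_atD(3)[OF assms] by auto
  then show "\<exists>c>0. \<exists>N. \<forall>n\<ge>N. \<forall>j. c * a n \<le> a (n + j * (m * b))"
    by (metis mult.assoc)
qed

lemma smooth_common_period:
  assumes "smooth a" "smooth a'"
  obtains b where "b > 0" "smooth_at b a" "smooth_at b a'"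
proof -
  obtain b b' where "b > 0" "smooth_at b a" "b' > 0" "smooth_at b' a'" using assms unfolding smooth_def by auto
  then show thesis using smooth_at_mult[of b a b'] smooth_at_mult[of b' a' b] that[of "b * b'"]
    by (simp add: mult.commute)
qed

text \<open>The source of indicators of the multiples of a number (geometric series) and, with
  period \<open>1\<close>, of finitely supported sequences.\<close>

lemma smooth_periodic:
  assumes "\<And>n. 0 \<le> a n" "b > 0" "\<And>n. n \<ge> N \<Longrightarrow> a (n + b) = a n"
  shows "smooth a"
proof -
  have p: "a (n + j * b) = a n" if "n \<ge> N" for n j
  proof (induction j)
    case (Suc j)
    then show ?case using assms(3)[of "n + j * b"] that by (simp add: algebra_simps)
  qed simp
  have "smooth_at b a" unfolding smooth_at_def
  proof (intro conjI allI impI)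
    show "\<exists>N. \<forall>n\<ge>N. \<bar>a (n + b) - a n\<bar> \<le> e * a n" if "e > 0" for e
      using assms(1,3) that by (intro exI[of _ N]) auto
    show "\<exists>c>0. \<exists>N. \<forall>n\<ge>N. \<forall>j. c * a n \<le> a (n + j * b)"
      using p by (intro exI[of _ 1] conjI exI[of _ N]) auto
  qed (use assms in auto)
  then show ?thesis using assms(2) unfolding smooth_def by auto
qed

lemma smooth_eventually_zero:
  assumes "\<And>n. 0 \<le> a n" "\<And>n. n \<ge> N \<Longrightarrow> a n = 0"
  shows "smooth a"
  using assms by (intro smooth_periodic[of a 1 N]) auto

lemma smooth_add:
  assumes "smooth a" "smooth a'"
  shows "smooth (\<lambda>n. a n + a' n)"
proof -
  obtain b where b: "b > 0" and A: "smooth_at b a" and A': "smooth_at b a'"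
    using smooth_common_period[OF assms] by blast
  have "smooth_at b (\<lambda>n. a n + a' n)" unfolding smooth_at_def
  proof (intro conjI allI impI)
    show "0 \<le> a n + a' n" for n using smooth_atD(1)[OF A] smooth_atD(1)[OF A'] by (simp add: add_nonneg_nonneg)
    fix e :: real assume e: "e > 0"
    obtain N1 where N1: "\<forall>n\<ge>N1. \<bar>a (n + b) - a n\<bar> \<le> e * a n" using smooth_atD(2)[OF A e] by auto
    obtain N2 where N2: "\<forall>n\<ge>N2. \<bar>a' (n + b) - a' n\<bar> \<le> e * a' n" using smooth_atD(2)[OF A' e] by auto
    show "\<exists>N. \<forall>n\<ge>N. \<bar>a (n + b) + a' (n + b) - (a n + a' n)\<bar> \<le> e * (a n + a' n)"
    proof (intro exI allI impI)
      fix n assume "max N1 N2 \<le> n"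
      then have "\<bar>a (n + b) - a n\<bar> \<le> e * a n" "\<bar>a' (n + b) - a' n\<bar> \<le> e * a' n" using N1 N2 by auto
      then show "\<bar>a (n + b) + a' (n + b) - (a n + a' n)\<bar> \<le> e * (a n + a' n)" by (simp add: distrib_left)
    qed
  next
    obtain c N where c: "c > 0" and N: "\<forall>n\<ge>N. \<forall>j. c * a n \<le> a (n + j * b)" using smooth_atD(3)[OF A] by auto
    obtain c' N' where c': "c' > 0" and N': "\<forall>n\<ge>N'. \<forall>j. c' * a' n \<le> a' (n + j * b)" using smooth_atD(3)[OF A'] by auto
    show "\<exists>c>0. \<exists>N. \<forall>n\<ge>N. \<forall>j. c * (a n + a' n) \<le> a (n + j * b) + a' (n + j * b)"
    proof (intro exI[of _ "min c c'"] conjI exI[of _ "max N N'"] allI impI)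
      fix n j assume n: "max N N' \<le> n"
      have "min c c' * (a n + a' n) \<le> c * a n + c' * a' n"
        using smooth_atD(1)[OF A] smooth_atD(1)[OF A'] by (simp add: distrib_left add_mono mult_right_mono)
      also have "\<dots> \<le> a (n + j * b) + a' (n + j * b)" using N N' n by (intro add_mono) auto
      finally show "min c c' * (a n + a' n) \<le> a (n + j * b) + a' (n + j * b)" .
    qed (use c c' in auto)
  qed
  then show ?thesis using b unfolding smooth_def by auto
qed

lemma smooth_zero: "smooth (\<lambda>n. 0)"
  by (rule smooth_eventually_zero[of _ 0]) auto

lemma smooth_sum:
  assumes "finite I" "\<And>i. i \<in> I \<Longrightarrow> smooth (a i)"
  shows "smooth (\<lambda>n. \<Sum>i\<in>I. a i n)"
  using assms
proof (induction I rule: finite_induct)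
  case empty
  then show ?case by (simp add: smooth_zero)
next
  case (insert i I)
  then show ?case using smooth_add[of "a i" "\<lambda>n. \<Sum>i\<in>I. a i n"] by simp
qed

lemma smooth_scale:
  assumes "smooth a" "s \<ge> 0"
  shows "smooth (\<lambda>n. s * a n)"
proof -
  obtain b where b: "b > 0" and A: "smooth_at b a" using assms unfolding smooth_def by auto
  have "smooth_at b (\<lambda>n. s * a n)" unfolding smooth_at_def
  proof (intro conjI allI impI)
    show "0 \<le> s * a n" for n using smooth_atD(1)[OF A] assms(2) by simp
    fix e :: real assume e: "e > 0"
    obtain N1 where N1: "\<forall>n\<ge>N1. \<bar>a (n + b) - a n\<bar> \<le> e * a n" using smooth_atD(2)[OF A e] by auto
    have "\<bar>s * a (n + b) - s * a n\<bar> \<le> e * (s * a n)" if "n \<ge> N1" for n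
    proof -
      have "\<bar>s * a (n + b) - s * a n\<bar> = s * \<bar>a (n + b) - a n\<bar>"
        using assms(2) by (simp add: abs_mult flip: right_diff_distrib)
      also have "\<dots> \<le> s * (e * a n)" using N1 that assms(2) by (intro mult_left_mono) auto
      finally show ?thesis by (simp add: mult_ac)
    qed
    then show "\<exists>N. \<forall>n\<ge>N. \<bar>s * a (n + b) - s * a n\<bar> \<le> e * (s * a n)" by blast
  next
    obtain c N where c: "c > 0" and N: "\<forall>n\<ge>N. \<forall>j. c * a n \<le> a (n + j * b)" using smooth_atD(3)[OF A] by auto
    have "c * (s * a n) \<le> s * a (n + j * b)" if "n \<ge> N" for n j
      using mult_left_mono[OF N[rule_format, OF that, of j] assms(2)] by (simp add: mult_ac)
    then show "\<exists>c>0. \<exists>N. \<forall>n\<ge>N. \<forall>j. c * (s * a n) \<le> s * a (n + j * b)" using c by blast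
  qed
  then show ?thesis using b unfolding smooth_def by auto
qed

text \<open>Coefficients of the generating function at \<open>x ^ i\<close>: \<open>i\<close> copies
  of one element, counted by total weight.\<close>

definition dilate :: "nat \<Rightarrow> (nat \<Rightarrow> real) \<Rightarrow> nat \<Rightarrow> real" where
  "dilate i a n = (if i dvd n then a (n div i) else 0)"

lemma smooth_dilate:
  assumes "smooth a" "i > 0"
  shows "smooth (dilate i a)"
proof -
  obtain b where b: "b > 0" and A: "smooth_at b a" using assms unfolding smooth_def by auto
  have shift: "dilate i a (n + j * (i * b)) = (if i dvd n then a (n div i + j * b) else 0)" for n j
  proof -
    have "i dvd (n + j * (i * b)) \<longleftrightarrow> i dvd n"
      by (metis dvd_add_left_iff dvd_mult dvd_triv_left)
    moreover have "(n + j * (i * b)) div i = n div i + j * b"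
      using assms(2) by (metis div_mult_self1 mult.assoc mult.commute add.commute neq0_conv)
    ultimately show ?thesis by (simp add: dilate_def)
  qed
  have "smooth_at (i * b) (dilate i a)" unfolding smooth_at_def
  proof (intro conjI allI impI)
    show "0 \<le> dilate i a n" for n using smooth_atD(1)[OF A] by (simp add: dilate_def)
    fix e :: real assume e: "e > 0"
    obtain N1 where N1: "\<forall>n\<ge>N1. \<bar>a (n + b) - a n\<bar> \<le> e * a n" using smooth_atD(2)[OF A e] by auto
    show "\<exists>N. \<forall>n\<ge>N. \<bar>dilate i a (n + i * b) - dilate i a n\<bar> \<le> e * dilate i a n"
    proof (intro exI allI impI)
      fix n assume "i * N1 \<le> n"
      then have "n div i \<ge> N1" using assms(2) by (metis div_le_mono nonzero_mult_div_cancel_left neq0_conv)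
      then show "\<bar>dilate i a (n + i * b) - dilate i a n\<bar> \<le> e * dilate i a n"
        using N1 shift[of n 1] by (auto simp: dilate_def)
    qed
  next
    obtain c N where c: "c > 0" and N: "\<forall>n\<ge>N. \<forall>j. c * a n \<le> a (n + j * b)" using smooth_atD(3)[OF A] by auto
    show "\<exists>c>0. \<exists>N. \<forall>n\<ge>N. \<forall>j. c * dilate i a n \<le> dilate i a (n + j * (i * b))"
    proof (intro exI[of _ c] conjI exI[of _ "i * N"] allI impI)
      fix n j assume "i * N \<le> n"
      then have "n div i \<ge> N" using assms(2) by (metis div_le_mono nonzero_mult_div_cancel_left neq0_conv)
      then show "c * dilate i a n \<le> dilate i a (n + j * (i * b))"
        using N shift[of n j] by (auto simp: dilate_def)
    qed (use c in auto)
  qed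
  then show ?thesis using b assms(2) unfolding smooth_def by (intro exI[of _ "i * b"]) auto
qed

section \<open>Convolutions of slowly varying sequences\<close>

definition conv :: "(nat \<Rightarrow> real) \<Rightarrow> (nat \<Rightarrow> real) \<Rightarrow> nat \<Rightarrow> real" where
  "conv a a' n = (\<Sum>k\<le>n. a k * a' (n - k))"

text \<open>Cutting at \<open>p\<close> keeps the argument of \<open>a'\<close> large in the first
  sum and that of \<open>a\<close> large in the second, so asymptotic bounds apply to one factor of
  every product.\<close>

lemma conv_split:
  assumes "p < n"
  shows "conv a a' n = (\<Sum>k\<le>p. a k * a' (n - k)) + (\<Sum>j<n - p. a (n - j) * a' j)"
proof -
  have "{..n} = {..p} \<union> {p<..n}" using assms by auto
  then have "conv a a' n = (\<Sum>k\<le>p. a k * a' (n - k)) + (\<Sum>k\<in>{p<..n}. a k * a' (n - k))"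
    unfolding conv_def by (simp only:) (intro sum.union_disjoint; auto)
  also have "(\<Sum>k\<in>{p<..n}. a k * a' (n - k)) = (\<Sum>j<n - p. a (n - j) * a' j)"
    by (rule sum.reindex_bij_witness[of _ "\<lambda>j. n - j" "\<lambda>k. n - k"]) auto
  finally show ?thesis .
qed

lemma smooth_conv:
  assumes "smooth a" "smooth a'"
  shows "smooth (conv a a')"
proof -
  obtain b where b: "b > 0" and A: "smooth_at b a" and A': "smooth_at b a'"
    using smooth_common_period[OF assms] by blast
  note nn = smooth_atD(1)[OF A] smooth_atD(1)[OF A']
  obtain c N where c: "c > 0" and N: "\<And>n j. n \<ge> N \<Longrightarrow> c * a n \<le> a (n + j * b)" using smooth_atD(3)[OF A] by auto
  obtain c' N' where c': "c' > 0" and N': "\<And>n j. n\<ge>N' \<Longrightarrow> c' * a' n \<le> a' (n + j * b)" using smooth_atD(3)[OF A'] by auto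
  have "smooth_at b (conv a a')" unfolding smooth_at_def
  proof (intro conjI allI impI)
    show "0 \<le> conv a a' n" for n using nn by (simp add: conv_def sum_nonneg)
  next
    \<comment> \<open>Each half of the convolution is dominated separately by the whole value at
      \<open>n + j * b\<close>; adding the two bounds costs a factor \<open>2\<close>.\<close>
    show "\<exists>c>0. \<exists>N. \<forall>n\<ge>N. \<forall>j. c * conv a a' n \<le> conv a a' (n + j * b)"
    proof (intro exI[of _ "min c c' / 2"] conjI exI[of _ "2 * (N + N') + 2"] allI impI)
      fix n j assume n: "2 * (N + N') + 2 \<le> n"
      define p where "p = n div 2"
      have p: "p < n" "p < n + j * b" "p \<ge> N" "n - p \<ge> N'" using n by (auto simp: p_def)
      have le: "k \<le> n + j * b" if "k \<le> p" for k using that p by simp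
      have "min c c' * (\<Sum>k\<le>p. a k * a' (n - k)) \<le> (\<Sum>k\<le>p. a k * a' (n + j * b - k))"
        unfolding sum_distrib_left
      proof (rule sum_mono)
        fix k assume k: "k \<in> {..p}"
        have "n + j * b - k = n - k + j * b" using k p by simp
        then have le': "c' * a' (n - k) \<le> a' (n + j * b - k)" using N'[of "n - k" j] k p by simp
        have "min c c' * (a k * a' (n - k)) \<le> a k * (c' * a' (n - k))"
          using nn mult_right_mono[of "min c c'" c' "a k * a' (n - k)"] by (simp add: mult_ac)
        also have "a k * (c' * a' (n - k)) \<le> a k * a' (n + j * b - k)" using nn le' by (intro mult_left_mono) auto
        finally show "min c c' * (a k * a' (n - k)) \<le> a k * a' (n + j * b - k)" .
      qed
      also have "\<dots> \<le> conv a a' (n + j * b)"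
        unfolding conv_split[OF p(2)] using nn by (simp add: sum_nonneg)
      finally have 1: "min c c' * (\<Sum>k\<le>p. a k * a' (n - k)) \<le> conv a a' (n + j * b)" .
      have "min c c' * (\<Sum>i<n - p. a (n - i) * a' i) \<le> (\<Sum>i<n - p. a (n + j * b - i) * a' i)"
        unfolding sum_distrib_left
      proof (rule sum_mono)
        fix k assume k: "k \<in> {..<n - p}"
        have "n + j * b - k = n - k + j * b" using k p by simp
        then have le': "c * a (n - k) \<le> a (n + j * b - k)" using N[of "n - k" j] k p by simp
        have "min c c' * (a (n - k) * a' k) \<le> (c * a (n - k)) * a' k"
          using nn mult_right_mono[of "min c c'" c "a (n - k) * a' k"] by (simp add: mult_ac)
        also have "c * a (n - k) * a' k \<le> a (n + j * b - k) * a' k" using nn le' by (intro mult_right_mono) auto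
        finally show "min c c' * (a (n - k) * a' k) \<le> a (n + j * b - k) * a' k" .
      qed
      also have "\<dots> \<le> (\<Sum>i<n + j * b - p. a (n + j * b - i) * a' i)"
        using nn p by (intro sum_mono2) auto
      also have "\<dots> \<le> conv a a' (n + j * b)"
        unfolding conv_split[OF p(2)] using nn by (simp add: sum_nonneg)
      finally have 2: "min c c' * (\<Sum>i<n - p. a (n - i) * a' i) \<le> conv a a' (n + j * b)" .
      show "min c c' / 2 * conv a a' n \<le> conv a a' (n + j * b)"
        unfolding conv_split[OF p(1)] using 1 2 by (simp add: distrib_left)
    qed (use c c' in auto)
  next
    fix e :: real assume e: "e > 0"
    have e2: "e / 2 > 0" using e by simp
    obtain N1 where N1: "\<And>n. n\<ge>N1 \<Longrightarrow> \<bar>a (n + b) - a n\<bar> \<le> e / 2 * a n" using smooth_atD(2)[OF A e2] by auto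
    obtain N2 where N2: "\<And>n. n\<ge>N2 \<Longrightarrow> \<bar>a' (n + b) - a' n\<bar> \<le> e / 2 * a' n" using smooth_atD(2)[OF A' e2] by auto
    \<comment> \<open>The number of old terms that each seam term is compared with. A comparison
      loses the factor \<open>c / 2\<close>, and \<open>b\<close> seam terms share the error
      \<open>e / 2\<close>.\<close>
    define S where "S = nat \<lceil>4 * real b / (c * e)\<rceil> + 1"
    have S: "real S \<ge> 4 * real b / (c * e)" "S > 0" by (simp_all add: S_def) linarith
    have "\<exists>M. \<forall>s\<le>S. \<forall>n\<ge>M. a' (n + s * b) \<le> 2 * a' n"
    proof -
      have "\<exists>M. \<forall>n\<ge>M. a' (n + s * b) \<le> 2 * a' n" for s
      proof -
        obtain M where M: "\<And>n. n \<ge> M \<Longrightarrow> \<bar>a' (n + s * b) - a' n\<bar> \<le> 1 * a' n"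
          using smooth_at_ratio_mult[OF A', of 1 s] by auto
        show ?thesis using M by (intro exI[of _ M]) fastforce
      qed
      then obtain M where M: "\<And>s n. n \<ge> M s \<Longrightarrow> a' (n + s * b) \<le> 2 * a' n" by metis
      show ?thesis
      proof (intro exI[of _ "Max (M ` {..S})"] allI impI)
        fix s n assume "s \<le> S" "Max (M ` {..S}) \<le> n"
        then show "a' (n + s * b) \<le> 2 * a' n" by (intro M) auto
      qed
    qed
    then obtain M where M: "\<And>s n. s \<le> S \<Longrightarrow> n \<ge> M \<Longrightarrow> a' (n + s * b) \<le> 2 * a' n" by auto
    \<comment> \<open>Both arguments at the cut are about \<open>n / 2\<close>, whence the factor
      \<open>2\<close>; \<open>S * b\<close> leaves room for \<open>S\<close> steps downwards from
      the index of a seam term.\<close>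
    define Z where "Z = 2 * (N + N1 + N2 + M + S * b) + 2"
    show "\<exists>N. \<forall>n\<ge>N. \<bar>conv a a' (n + b) - conv a a' n\<bar> \<le> e * conv a a' n"
    proof (intro exI[of _ Z] allI impI)
      fix n assume n: "Z \<le> n"
      define p where "p = n div 2"
      have p: "p < n" "p < n + b" "p \<ge> N" "p \<ge> N1" "n - p \<ge> N2" "n - p \<ge> S * b + M"
        using n by (auto simp: p_def Z_def)
      define X where "X = (\<Sum>k\<le>p. a k * a' (n - k))"
      define Y where "Y = (\<Sum>j<n - p. a (n - j) * a' j)"
      define X' where "X' = (\<Sum>k\<le>p. a k * a' (n + b - k))"
      define Y' where "Y' = (\<Sum>j<n - p. a (n + b - j) * a' j)"
      \<comment> \<open>The seam: with the cut kept at \<open>p\<close>, the \<open>b\<close>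
        additional terms of the longer second sum.\<close>
      define B where "B = (\<Sum>j\<in>{n - p..<n + b - p}. a (n + b - j) * a' j)"
      have c0: "conv a a' n = X + Y" unfolding X_def Y_def by (rule conv_split[OF p(1)])
      have "{..<n + b - p} = {..<n - p} \<union> {n - p..<n + b - p}" using p by auto
      moreover have "{..<n - p} \<inter> {n - p..<n + b - p} = {}" by auto
      ultimately have "(\<Sum>j<n + b - p. a (n + b - j) * a' j) = Y' + B"
        unfolding Y'_def B_def by (metis (no_types, lifting) finite_atLeastLessThan finite_lessThan sum.union_disjoint)
      then have c1: "conv a a' (n + b) = X' + Y' + B" unfolding conv_split[OF p(2)] X'_def by simp
      have dX: "\<bar>X' - X\<bar> \<le> e / 2 * X"
      proof -
        have "\<bar>X' - X\<bar> \<le> (\<Sum>k\<le>p. \<bar>a k * a' (n + b - k) - a k * a' (n - k)\<bar>)"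
          unfolding X'_def X_def by (simp flip: sum_subtractf)
        also have "\<dots> \<le> (\<Sum>k\<le>p. e / 2 * (a k * a' (n - k)))"
        proof (rule sum_mono)
          fix k assume k: "k \<in> {..p}"
          have "n + b - k = n - k + b" using k p by simp
          moreover have "\<bar>a' (n - k + b) - a' (n - k)\<bar> \<le> e / 2 * a' (n - k)"
            by (rule N2) (use k p in simp)
          ultimately have "a k * \<bar>a' (n + b - k) - a' (n - k)\<bar> \<le> a k * (e / 2 * a' (n - k))"
            using nn by (intro mult_left_mono) auto
          then show "\<bar>a k * a' (n + b - k) - a k * a' (n - k)\<bar> \<le> e / 2 * (a k * a' (n - k))"
            using nn by (simp add: abs_mult mult_ac flip: right_diff_distrib)
        qed
        finally show ?thesis by (simp add: X_def sum_distrib_left)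
      qed
      have dY: "\<bar>Y' - Y\<bar> \<le> e / 2 * Y"
      proof -
        have "\<bar>Y' - Y\<bar> \<le> (\<Sum>k<n - p. \<bar>a (n + b - k) * a' k - a (n - k) * a' k\<bar>)"
          unfolding Y'_def Y_def by (simp flip: sum_subtractf)
        also have "\<dots> \<le> (\<Sum>k<n - p. e / 2 * (a (n - k) * a' k))"
        proof (rule sum_mono)
          fix k assume k: "k \<in> {..<n - p}"
          have "n + b - k = n - k + b" using k p by simp
          moreover have "\<bar>a (n - k + b) - a (n - k)\<bar> \<le> e / 2 * a (n - k)"
            by (rule N1) (use k p in simp)
          ultimately have "\<bar>a (n + b - k) - a (n - k)\<bar> * a' k \<le> (e / 2 * a (n - k)) * a' k"
            using nn by (intro mult_right_mono) auto
          moreover have "\<bar>a (n + b - k) * a' k - a (n - k) * a' k\<bar> = \<bar>a (n + b - k) - a (n - k)\<bar> * a' k"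
            using nn by (simp add: abs_mult flip: left_diff_distrib)
          ultimately show "\<bar>a (n + b - k) * a' k - a (n - k) * a' k\<bar> \<le> e / 2 * (a (n - k) * a' k)"
            by (simp only: mult.assoc)
        qed
        finally show ?thesis by (simp add: Y_def sum_distrib_left)
      qed
      \<comment> \<open>Move \<open>s\<close> periods from \<open>j\<close> to the partner index
        \<open>i\<close>, and one more off \<open>j\<close> because the total is \<open>n\<close>
        rather than \<open>n + b\<close>. The first factor keeps a share \<open>c\<close>, the
        second a share \<open>1 / 2\<close>.\<close>
      have tm: "a (n + b - j) * a' j \<le> e / (2 * real b) * conv a a' n"
        if j: "j \<in> {n - p..<n + b - p}" for j
      proof -
        define i where "i = n + b - j"
        have i: "i \<ge> N" "i + j = n + b" "i > p" using j p by (auto simp: i_def)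
        have jS: "j \<ge> S * b + M" using j p by auto
        have "real S * (c / 2 * (a i * a' j)) = (\<Sum>s<S. c / 2 * (a i * a' j))" by simp
        also have "\<dots> \<le> (\<Sum>s<S. a (i + s * b) * a' (n - (i + s * b)))"
        proof (rule sum_mono)
          fix s assume s: "s \<in> {..<S}"
          have sb: "Suc s * b \<le> S * b" using s by (intro mult_right_mono) auto
          define l where "l = j - Suc s * b"
          have l: "l + Suc s * b = j" "l \<ge> M" using sb jS by (auto simp: l_def)
          have "n - (i + s * b) = l" using i l by simp
          moreover have "a' j \<le> 2 * a' l" using M[of "Suc s" l] s l by simp
          moreover have "c * a i \<le> a (i + s * b)" using N i by simp
          ultimately have "(c * a i) * (a' j / 2) \<le> a (i + s * b) * a' (n - (i + s * b))"
            using nn c by (intro mult_mono) auto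
          then show "c / 2 * (a i * a' j) \<le> a (i + s * b) * a' (n - (i + s * b))" by (simp add: mult_ac)
        qed
        also have "\<dots> = (\<Sum>k\<in>(\<lambda>s. i + s * b) ` {..<S}. a k * a' (n - k))"
          using b by (subst sum.reindex) (auto simp: inj_on_def)
        also have "\<dots> \<le> conv a a' n" unfolding conv_def
        proof (rule sum_mono2)
          show "(\<lambda>s. i + s * b) ` {..<S} \<subseteq> {..n}"
          proof clarsimp
            fix s assume "s < S"
            then have "Suc s * b \<le> S * b" by (intro mult_right_mono) auto
            then show "i + s * b \<le> n" using i jS by simp
          qed
        qed (use nn in auto)
        finally have "real S * (c / 2 * (a i * a' j)) \<le> conv a a' n" .
        moreover have "(4 * real b / (c * e)) * (c / 2 * (a i * a' j)) \<le> real S * (c / 2 * (a i * a' j))"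
          using S nn c by (intro mult_right_mono) auto
        ultimately have "(4 * real b / (c * e)) * (c / 2 * (a i * a' j)) \<le> conv a a' n" by linarith
        then have "2 * real b / e * (a i * a' j) \<le> conv a a' n" using c by (simp add: field_simps)
        then show ?thesis using b e by (simp add: i_def field_simps)
      qed
      have "B \<le> (\<Sum>j\<in>{n - p..<n + b - p}. e / (2 * real b) * conv a a' n)"
        unfolding B_def by (intro sum_mono tm)
      also have "\<dots> = e / 2 * conv a a' n" using b p by simp
      finally have B: "B \<le> e / 2 * conv a a' n" .
      have "0 \<le> B" unfolding B_def using nn by (simp add: sum_nonneg)
      then have "\<bar>conv a a' (n + b) - conv a a' n\<bar> \<le> \<bar>X' - X\<bar> + \<bar>Y' - Y\<bar> + B"
        unfolding c0 c1 by linarith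
      also have "\<dots> \<le> e / 2 * X + e / 2 * Y + e / 2 * conv a a' n" using dX dY B by linarith
      also have "\<dots> = e * conv a a' n" unfolding c0 by (simp add: field_simps)
      finally show "\<bar>conv a a' (n + b) - conv a a' n\<bar> \<le> e * conv a a' n" .
    qed
  qed
  then show ?thesis using b unfolding smooth_def by auto
qed

section \<open>Slow variation of Euler transforms\<close>

text \<open>The \<open>j\<close>-th layer of the Euler identity: it counts the elements that occur at least \<open>j\<close> times.\<close>

definition recip_tail :: "nat \<Rightarrow> (nat \<Rightarrow> real) \<Rightarrow> (nat \<Rightarrow> real) \<Rightarrow> nat \<Rightarrow> real" where
  "recip_tail j t f n = (\<Sum>i = 1..n div j. real i * t i * f (n - i * j))"

text \<open>\<open>f_step\<close> is the adding of one element of weight \<open>i\<close>;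
  \<open>f_period\<close> is met by taking \<open>b\<close> a multiple of the weight of an element.
  \<open>t_mono\<close> is demanded from the start because small arguments of \<open>t\<close> occur
  in every layer of the Euler identity.\<close>

locale euler_pair =
  fixes t f :: "nat \<Rightarrow> real" and b :: nat and c :: real
  assumes t_smooth: "smooth_at b t" and b: "b > 0" and c: "c > 0"
    and t_mono: "\<And>n j. c * t n \<le> t (n + j * b)"
    and f_nonneg: "\<And>n. 0 \<le> f n"
    and f_step: "\<And>i n. t i > 0 \<Longrightarrow> f n \<le> f (n + i)"
    and f_period: "\<And>n. f n \<le> f (n + b)"
    and euler: "\<And>n. real n * f n = (\<Sum>j = 1..n. recip_tail j t f n)"
begin

lemma t_nonneg: "0 \<le> t n" using smooth_atD(1)[OF t_smooth] .

lemma f_steps: "t i > 0 \<Longrightarrow> f n \<le> f (n + r * i)"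
proof (induction r)
  case (Suc r)
  then show ?case using f_step[of i "n + r * i"] by (simp add: algebra_simps)
qed simp

lemma f_periods: "f n \<le> f (n + r * b)"
proof (induction r)
  case (Suc r)
  then show ?case using f_period[of "n + r * b"] by (simp add: algebra_simps)
qed simp

lemma recip_tail_nonneg: "0 \<le> recip_tail j t f n"
  unfolding recip_tail_def using t_nonneg f_nonneg by (intro sum_nonneg) simp

lemma recip_tail_le: "1 \<le> j \<Longrightarrow> j \<le> n \<Longrightarrow> recip_tail j t f n \<le> real n * f n"
  unfolding euler by (intro member_le_sum) (auto simp: recip_tail_nonneg)

text \<open>Compare \<open>f (n - i * j)\<close> with the average of \<open>f (n - k)\<close> over about \<open>j / (4 b)\<close> indices \<open>k\<close> just below
  \<open>i * j\<close> that are congruent to \<open>i\<close>; no \<open>k\<close> is used for two different \<open>i\<close>.\<close>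

lemma recip_tail_bound:
  assumes j: "j \<ge> 4 * b" "j \<le> n"
  shows "recip_tail j t f n \<le> 16 * real b / c / (real j)\<^sup>2 * (real n * f n)"
proof -
  define D where "D = (j - 1) div b"
  define \<rho> where "\<rho> = (j - 1) mod b"
  \<comment> \<open>A quarter of \<open>j\<close> in units of \<open>b\<close>, so that
    \<open>s * b\<close> stays within \<open>j / 4\<close> for \<open>s < q\<close>.\<close>
  define q where "q = j div (4 * b)"
  have jpos: "j > 0" using j b by simp
  have jD: "j = 1 + D * b + \<rho>" using jpos by (simp add: D_def \<rho>_def)
  have \<rho>: "\<rho> < b" using b by (simp add: \<rho>_def)
  have q1: "4 * (q * b) \<le> j" unfolding q_def
    using div_times_less_eq_dividend[of j "4 * b"] by (simp add: mult_ac)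
  have q2: "j < 4 * (q * b) + 4 * b"
  proof -
    have "j mod (4 * b) < 4 * b" using b by simp
    moreover have "q * (4 * b) + j mod (4 * b) = j" unfolding q_def by (rule div_mult_mod_eq)
    moreover have "q * (4 * b) = 4 * (q * b)" by simp
    ultimately show ?thesis by linarith
  qed
  have q0: "q > 0" using q2 j(1) by (cases q) auto
  have qD: "q \<le> D"
  proof (rule ccontr)
    assume "\<not> q \<le> D"
    then have "Suc D * b \<le> q * b" by (intro mult_right_mono) auto
    then have "D * b + b \<le> q * b" by simp
    then show False using jD q1 \<rho> b j by linarith
  qed
  \<comment> \<open>\<open>k i s\<close> is congruent to \<open>i\<close> modulo \<open>b\<close>,
    so \<open>t_mono\<close> compares \<open>t i\<close> with \<open>t (k i s)\<close>. And
    \<open>i * j - k i s = \<rho> * i + s * b\<close> consists of \<open>\<rho>\<close> steps of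
    weight \<open>i\<close> and \<open>s\<close> periods, along which \<open>f\<close> does not
    decrease when \<open>t i > 0\<close>.\<close>
  define k where "k = (\<lambda>i s. i + (i * D - s) * b)"
  have ij: "i * j = k i s + \<rho> * i + s * b" if "i \<ge> 1" "s < q" for i s
  proof -
    have "s \<le> i * D" using that qD by (metis le_trans less_imp_le mult_le_mono1 nat_mult_1)
    then have "(i * D - s) * b + s * b = i * D * b" by (simp flip: add_mult_distrib)
    then show ?thesis unfolding k_def jD by (simp add: algebra_simps)
  qed
  \<comment> \<open>Since \<open>\<rho> < b \<le> j / 4\<close>, each of the two corrections is at
    most a quarter of \<open>i * j\<close>.\<close>
  have kge: "i * j \<le> 2 * k i s" if "i \<ge> 1" "s < q" for i s
  proof -
    have "s * b \<le> q * b" using that by simp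
    then have "4 * (s * b) \<le> j" using q1 by linarith
    moreover have "4 * (\<rho> * i) \<le> j * i" using \<rho> j(1) by (metis le_trans less_imp_le mult.assoc mult_le_mono1 mult_le_mono2)
    moreover have "j \<le> i * j" using that by simp
    ultimately show ?thesis using ij[OF that] by (simp add: mult.commute)
  qed
  have inj: "inj_on (\<lambda>(i, s). k i s) ({1..n div j} \<times> {..<q})"
  proof -
    \<comment> \<open>The block of one \<open>i\<close> reaches down less than \<open>D\<close>
      periods from its upper end, and passing to the next \<open>i\<close> moves the upper end by
      \<open>1 + D * b\<close>: blocks do not overlap.\<close>
    have less: "k i s < k i' s'" if "i < i'" "i \<ge> 1" "s < q" "s' < q" for i i' s s'
    proof -
      have "k i s \<le> i + i * D * b" by (simp add: k_def)
      moreover have "i' + i' * D * b = k i' s' + s' * b"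
      proof -
        have "s' \<le> i' * D" using that qD by (metis le_trans less_imp_le mult_le_mono1 nat_mult_1)
        then have "(i' * D - s') * b + s' * b = i' * D * b" by (simp flip: add_mult_distrib)
        then show ?thesis by (simp add: k_def)
      qed
      moreover have "i + i * D * b + (1 + D * b) \<le> i' + i' * D * b"
      proof -
        have "Suc i * (1 + D * b) \<le> i' * (1 + D * b)" using that by (intro mult_right_mono) auto
        then show ?thesis by (simp add: algebra_simps)
      qed
      moreover have "s' * b \<le> D * b" using that qD by simp
      ultimately show ?thesis by linarith
    qed
    show ?thesis
    proof (intro inj_onI, clarsimp)
      fix i s i' s' assume a: "Suc 0 \<le> i" "Suc 0 \<le> i'" "s < q" "s' < q" "k i s = k i' s'"
      then have "i = i'" using less[of i i' s s'] less[of i' i s' s] by (metis One_nat_def less_irrefl nat_neq_iff)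
      moreover have "s * b = s' * b"
      proof -
        have "i * j = k i s + \<rho> * i + s * b" by (rule ij) (use a in auto)
        moreover have "i' * j = k i' s' + \<rho> * i' + s' * b" by (rule ij) (use a in auto)
        moreover note a(5)
        ultimately show ?thesis unfolding \<open>i = i'\<close> by linarith
      qed
      ultimately show "i = i' \<and> s = s'" using b by simp
    qed
  qed
  have step: "real i * t i * f (n - i * j) \<le> 2 / (real j * c) * (real (k i s) * t (k i s) * f (n - k i s))"
    if i: "i \<in> {1..n div j}" and s: "s < q" for i s
  proof (cases "t i > 0")
    case True
    have in1: "i \<ge> 1" "i * j \<le> n" using i jpos by (auto simp: less_eq_div_iff_mult_less_eq)
    define x where "x = n - i * j"
    have "f x \<le> f (x + \<rho> * i)" using f_steps True by simp
    also have "\<dots> \<le> f (x + \<rho> * i + s * b)" using f_periods by simp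
    also have "x + \<rho> * i + s * b = n - k i s" using ij[OF in1(1) s] in1 by (simp add: x_def)
    finally have f1: "f (n - i * j) \<le> f (n - k i s)" by (simp add: x_def)
    have "c * t i \<le> t (k i s)" unfolding k_def by (rule t_mono)
    then have t1: "t i \<le> t (k i s) / c" using c by (simp add: field_simps)
    \<comment> \<open>One factor \<open>1 / j\<close> arises here, the other from averaging over the
      \<open>q\<close> values of \<open>s\<close>.\<close>
    have "real (i * j) \<le> real (2 * k i s)" using kge[OF in1(1) s] by (simp only: of_nat_le_iff)
    then have i1: "real i \<le> 2 * real (k i s) / real j" using jpos by (simp add: field_simps)
    have "real i * t i * f (n - i * j) \<le> (2 * real (k i s) / real j) * (t (k i s) / c) * f (n - k i s)"
      using f1 t1 i1 t_nonneg f_nonneg c by (intro mult_mono) auto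
    then show ?thesis by (simp add: field_simps)
  next
    case False
    then have "t i = 0" using t_nonneg[of i] by simp
    then show ?thesis using t_nonneg f_nonneg c by simp
  qed
  have "real q * recip_tail j t f n = (\<Sum>i = 1..n div j. \<Sum>s<q. real i * t i * f (n - i * j))"
    by (simp add: recip_tail_def sum_distrib_left mult_ac)
  also have "\<dots> \<le> (\<Sum>i = 1..n div j. \<Sum>s<q. 2 / (real j * c) * (real (k i s) * t (k i s) * f (n - k i s)))"
    using step by (intro sum_mono) auto
  also have "\<dots> = 2 / (real j * c) * (\<Sum>(i, s)\<in>{1..n div j} \<times> {..<q}. real (k i s) * t (k i s) * f (n - k i s))"
    by (simp add: sum_distrib_left sum.cartesian_product case_prod_unfold)
  finally have main0: "real q * recip_tail j t f n \<le>
      2 / (real j * c) * (\<Sum>(i, s)\<in>{1..n div j} \<times> {..<q}. real (k i s) * t (k i s) * f (n - k i s))" .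
  have "(\<Sum>(i, s)\<in>{1..n div j} \<times> {..<q}. real (k i s) * t (k i s) * f (n - k i s))
      = (\<Sum>l\<in>(\<lambda>(i, s). k i s) ` ({1..n div j} \<times> {..<q}). real l * t l * f (n - l))"
    by (subst sum.reindex[OF inj]) (simp add: case_prod_unfold)
  also have "\<dots> \<le> (\<Sum>l = 1..n. real l * t l * f (n - l))"
  proof (rule sum_mono2)
    show "(\<lambda>(i, s). k i s) ` ({1..n div j} \<times> {..<q}) \<subseteq> {1..n}"
    proof (clarsimp)
      fix i s assume "Suc 0 \<le> i" "i \<le> n div j" "s < q"
      moreover from this have "i * j \<le> n" using jpos by (auto simp: less_eq_div_iff_mult_less_eq)
      ultimately show "Suc 0 \<le> k i s \<and> k i s \<le> n" using ij[of i s] by (simp add: k_def)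
    qed
  qed (use t_nonneg f_nonneg in auto)
  also have "\<dots> = recip_tail 1 t f n" by (simp add: recip_tail_def)
  also have "\<dots> \<le> real n * f n" using jpos j by (intro recip_tail_le) auto
  finally have "2 / (real j * c) * (\<Sum>(i, s)\<in>{1..n div j} \<times> {..<q}. real (k i s) * t (k i s) * f (n - k i s))
      \<le> 2 / (real j * c) * (real n * f n)"
    using c by (intro mult_left_mono) auto
  with main0 have main: "real q * recip_tail j t f n \<le> 2 / (real j * c) * (real n * f n)" by linarith
  have "real j \<le> 8 * real b * real q"
  proof -
    have "1 * b \<le> q * b" using q0 by (intro mult_right_mono) auto
    then have "j \<le> 8 * (q * b)" using q2 by linarith
    then have "real j \<le> real (8 * (q * b))" by (simp only: of_nat_le_iff)
    then show ?thesis by (simp add: mult_ac)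
  qed
  then have "real j / (8 * real b) \<le> real q" using b by (simp add: field_simps)
  then have "real j / (8 * real b) * recip_tail j t f n \<le> 2 / (real j * c) * (real n * f n)"
    using main recip_tail_nonneg by (meson mult_right_mono order_trans)
  then show ?thesis using b c jpos by (simp add: field_simps power2_eq_square)
qed

text \<open>The layer bounds decay like \<open>1 / j^2\<close>, and their sum beyond
  \<open>J\<close> telescopes to order \<open>1 / J\<close>.\<close>

lemma recip_tail_sum_bound:
  assumes J: "J \<ge> 4 * b"
  shows "(\<Sum>j = Suc J..n. recip_tail j t f n) \<le> 16 * real b / c / real J * (real n * f n)"
proof -
  have J0: "J > 0" using J b by simp
  \<comment> \<open>\<open>max J n\<close> lets the induction start at \<open>n = 0\<close>, below
    \<open>J\<close>, where the sum is empty.\<close>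
  have tel: "(\<Sum>j = Suc J..n. 1 / (real j)\<^sup>2) \<le> 1 / real J - 1 / real (max J n)" for n
  proof (induction n)
    case (Suc n)
    show ?case
    proof (cases "J \<le> n")
      case True
      have "1 / (real (Suc n))\<^sup>2 \<le> 1 / real n - 1 / real (Suc n)"

      proof -
        have "1 / real n - 1 / real (Suc n) = 1 / (real n * real (Suc n))"
          using True J0 by (simp add: field_simps)
        moreover have "1 / (real (Suc n))\<^sup>2 \<le> 1 / (real n * real (Suc n))"
          using True J0 unfolding power2_eq_square by (intro divide_left_mono mult_right_mono) auto
        ultimately show ?thesis by simp
      qed
      then show ?thesis using Suc True by (simp add: max_def)
    next
      case False
      then have "max J (Suc n) = J" "{Suc J..Suc n} = {}" by auto
      then show ?thesis by simp
    qed
  qed (simp add: max_def)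
  have "(\<Sum>j = Suc J..n. recip_tail j t f n) \<le> (\<Sum>j = Suc J..n. 16 * real b / c / (real j)\<^sup>2 * (real n * f n))"
    using J by (intro sum_mono recip_tail_bound) auto
  also have "\<dots> = 16 * real b / c * (real n * f n) * (\<Sum>j = Suc J..n. 1 / (real j)\<^sup>2)"
    by (subst sum_distrib_left) (intro sum.cong; simp)
  also have "\<dots> \<le> 16 * real b / c * (real n * f n) * (1 / real J)"
    using tel[of n] c f_nonneg by (intro mult_left_mono) (auto intro: order_trans)
  finally show ?thesis by (simp add: mult_ac)
qed

text \<open>Shift by \<open>d = fact J * b\<close>: in the layers \<open>j \<le> J\<close> the shift is absorbed by \<open>t\<close>, whose argument moves by
  \<open>d / j\<close>, a multiple of \<open>b\<close>; the layers \<open>j > J\<close> are negligible.\<close>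

lemma f_ratio:
  assumes e: "e > 0"
  shows "\<exists>N. \<forall>n\<ge>N. f (n + b) \<le> (1 + e) * f n"
proof -
  define e' where "e' = min e 1"
  \<comment> \<open>Chosen so that \<open>(1 + \<delta>)^2 \<le> (1 + 8 * \<delta>) * (1 - 2 *
    \<delta>)\<close>, which \<open>\<delta> \<le> 1 / 8\<close> ensures; the two units on the right
    are lost to the late layers and to the initial terms.\<close>
  define \<delta> where "\<delta> = e' / 8"
  have \<delta>: "\<delta> > 0" "\<delta> \<le> 1 / 8" "e' = 8 * \<delta>" "e' \<le> e" using e by (auto simp: \<delta>_def e'_def)
  define J where "J = 4 * b + nat \<lceil>16 * real b / c / \<delta>\<rceil>"
  have J: "J \<ge> 4 * b" "real J \<ge> 16 * real b / c / \<delta>" by (simp_all add: J_def) linarith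
  have J0: "J > 0" using J b by simp
  have Jd: "16 * real b / c / real J \<le> \<delta>"
  proof -
    have "16 * real b / c \<le> real J * \<delta>" using J(2) \<delta>(1) by (simp only: pos_divide_le_eq)
    then show ?thesis using J0 by (subst pos_divide_le_eq) (auto simp: mult.commute)
  qed
  define d where "d = fact J * b"
  define L where "L = (\<lambda>j. fact J div j :: nat)"
  have L: "L j * j = fact J" if "1 \<le> j" "j \<le> J" for j
    using dvd_fact[of j J] that by (simp add: L_def)
  have d0: "d > 0" using b by (simp add: d_def)
  have "\<exists>N. \<forall>n\<ge>N. t (n + L j * b) \<le> (1 + \<delta>) * t n" for j
  proof -
    obtain N where "\<forall>n\<ge>N. \<bar>t (n + L j * b) - t n\<bar> \<le> \<delta> * t n"
      using smooth_at_ratio_mult[OF t_smooth \<delta>(1)] by blast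
    then show ?thesis by (intro exI[of _ N]) (fastforce simp: algebra_simps)
  qed
  then obtain N0 where N0: "\<And>j n. n \<ge> N0 j \<Longrightarrow> t (n + L j * b) \<le> (1 + \<delta>) * t n" by metis
  \<comment> \<open>The summand \<open>d / \<delta>\<close> makes the factor \<open>i\<close> of
    \<open>i * t i\<close> grow by at most \<open>1 + \<delta>\<close> too.\<close>
  define N where "N = Max (N0 ` {1..J}) + nat \<lceil>real d / \<delta>\<rceil> + 1"
  have N: "N0 j \<le> N" if "1 \<le> j" "j \<le> J" for j
  proof -
    have "N0 j \<le> Max (N0 ` {1..J})" using that by (intro Max_ge) auto
    then show ?thesis by (simp add: N_def)
  qed
  have N': "real N \<ge> real d / \<delta>" "N > 0" by (simp_all add: N_def) linarith
  define h where "h = (\<lambda>i. real i * t i)"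
  have h0: "h i \<ge> 0" for i using t_nonneg by (simp add: h_def)
  have hstep: "h (i + L j * b) \<le> (1 + \<delta>)\<^sup>2 * h i" if "i \<ge> N" "1 \<le> j" "j \<le> J" for i j
  proof -
    have "real d \<le> \<delta> * real i"
    proof -
      have "real d \<le> \<delta> * real N" using N'(1) \<delta>(1) by (simp add: field_simps)
      also have "\<dots> \<le> \<delta> * real i" using that \<delta> by simp
      finally show ?thesis .
    qed
    moreover have "L j * b \<le> d" using L[OF that(2,3)] that by (simp add: L_def d_def div_le_dividend)
    then have "real (L j * b) \<le> real d" by (simp only: of_nat_le_iff)
    ultimately have "real (i + L j * b) \<le> (1 + \<delta>) * real i" by (simp add: algebra_simps)
    moreover have "t (i + L j * b) \<le> (1 + \<delta>) * t i" using N0 N[OF that(2,3)] that by simp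
    ultimately have "h (i + L j * b) \<le> ((1 + \<delta>) * real i) * ((1 + \<delta>) * t i)"
      unfolding h_def using \<delta> t_nonneg by (intro mult_mono) auto
    then show ?thesis by (simp add: h_def power2_eq_square mult_ac)
  qed
  \<comment> \<open>Total coefficient of the initial terms, where the ratio bound for
    \<open>t\<close> is not yet valid. Together they amount to at most a constant times
    \<open>f (n + d)\<close>, which is small against \<open>n * f (n + d)\<close>.\<close>
  define C where "C = (\<lambda>j. \<Sum>i = 1..N + L j * b. h i)"
  have Wj: "recip_tail j t f (n + d) \<le> C j * f (n + d) + (1 + \<delta>)\<^sup>2 * recip_tail j t f n"
    if j: "1 \<le> j" "j \<le> J" for j n
  proof -
    let ?l = "L j * b"
    have dj: "d = ?l * j" using L[OF j] by (simp add: d_def mult_ac)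
    have div: "(n + d) div j = n div j + ?l" using j by (simp add: dj)
    have sub: "{1..(n + d) div j} \<subseteq> {1..N + ?l} \<union> (\<lambda>i. i + ?l) ` {i\<in>{1..n div j}. i > N}"
    proof
      fix i assume i: "i \<in> {1..(n + d) div j}"
      show "i \<in> {1..N + ?l} \<union> (\<lambda>i. i + ?l) ` {i\<in>{1..n div j}. i > N}"
      proof (cases "i \<le> N + ?l")
        case False
        then have "i = (i - ?l) + ?l" "i - ?l \<in> {i\<in>{1..n div j}. i > N}" using i div by auto
        then show ?thesis by blast
      qed (use i in auto)
    qed
    let ?g = "\<lambda>i. h i * f (n + d - i * j)"
    have g0: "?g i \<ge> 0" for i using h0 f_nonneg by simp
    have "recip_tail j t f (n + d) = (\<Sum>i\<in>{1..(n + d) div j}. ?g i)"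
      by (simp add: recip_tail_def h_def)
    also have "\<dots> \<le> (\<Sum>i\<in>({1..N + ?l} \<inter> {1..(n + d) div j}) \<union> (\<lambda>i. i + ?l) ` {i\<in>{1..n div j}. i > N}. ?g i)"
      using sub g0 by (intro sum_mono2) auto
    also have "\<dots> \<le> (\<Sum>i\<in>{1..N + ?l} \<inter> {1..(n + d) div j}. ?g i) + (\<Sum>i\<in>(\<lambda>i. i + ?l) ` {i\<in>{1..n div j}. i > N}. ?g i)"
      using g0 by (subst sum.union_inter[symmetric]) (auto intro: sum_nonneg)
    also have "(\<Sum>i\<in>{1..N + ?l} \<inter> {1..(n + d) div j}. ?g i) \<le> (\<Sum>i\<in>{1..N + ?l} \<inter> {1..(n + d) div j}. h i * f (n + d))"
    proof (rule sum_mono)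
      fix i assume i: "i \<in> {1..N + ?l} \<inter> {1..(n + d) div j}"
      show "?g i \<le> h i * f (n + d)"
      proof (cases "t i > 0")
        case True
        have "i * j \<le> n + d" using i j by (auto simp: less_eq_div_iff_mult_less_eq)
        then have "n + d = (n + d - i * j) + j * i" by simp
        then have "f (n + d - i * j) \<le> f (n + d)" using f_steps[OF True, of "n + d - i * j" j] by simp
        then show ?thesis using h0 by (rule mult_left_mono)
      next
        case False
        then have "t i = 0" using t_nonneg[of i] by simp
        then show ?thesis by (simp add: h_def)
      qed
    qed
    also have "\<dots> \<le> (\<Sum>i\<in>{1..N + ?l}. h i * f (n + d))"
      using h0 f_nonneg by (intro sum_mono2) auto
    also have "\<dots> = C j * f (n + d)" by (simp add: C_def sum_distrib_right)
    also have "(\<Sum>i\<in>(\<lambda>i. i + ?l) ` {i\<in>{1..n div j}. i > N}. ?g i) = (\<Sum>i\<in>{i\<in>{1..n div j}. i > N}. ?g (i + ?l))"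
      by (subst sum.reindex) auto
    also have "\<dots> \<le> (\<Sum>i\<in>{i\<in>{1..n div j}. i > N}. (1 + \<delta>)\<^sup>2 * (h i * f (n - i * j)))"
    proof (rule sum_mono)
      fix i assume i: "i \<in> {i\<in>{1..n div j}. i > N}"
      have "n + d - (i + ?l) * j = n - i * j" by (simp add: dj algebra_simps)
      then show "?g (i + ?l) \<le> (1 + \<delta>)\<^sup>2 * (h i * f (n - i * j))"
        using hstep[of i j] i j f_nonneg mult_right_mono[of "h (i + ?l)" "(1 + \<delta>)\<^sup>2 * h i" "f (n - i * j)"]
        by (simp add: mult.assoc)
    qed
    also have "\<dots> \<le> (\<Sum>i\<in>{1..n div j}. (1 + \<delta>)\<^sup>2 * (h i * f (n - i * j)))"
      using h0 f_nonneg by (intro sum_mono2) auto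
    also have "\<dots> = (1 + \<delta>)\<^sup>2 * recip_tail j t f n"
      by (simp add: recip_tail_def h_def sum_distrib_left)
    finally show ?thesis by simp
  qed
  define CC where "CC = (\<Sum>j = 1..J. C j)"
  have CC0: "CC \<ge> 0" unfolding CC_def C_def using h0 by (intro sum_nonneg)
  show ?thesis
  proof (intro exI[of _ "J + nat \<lceil>CC / \<delta>\<rceil> + 1"] allI impI)
    fix n assume n: "J + nat \<lceil>CC / \<delta>\<rceil> + 1 \<le> n"
    have nJ: "n \<ge> J" "n > 0" using n by auto
    have "CC / \<delta> \<le> real n" using n by linarith
    then have nC: "CC \<le> \<delta> * real n" using \<delta> by (simp add: field_simps)
    let ?F = "f (n + d)"
    have "{1..n + d} = {1..J} \<union> {Suc J..n + d}" using nJ by auto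
    then have "real (n + d) * ?F = (\<Sum>j = 1..J. recip_tail j t f (n + d)) + (\<Sum>j = Suc J..n + d. recip_tail j t f (n + d))"
      unfolding euler by (simp only:) (intro sum.union_disjoint; auto)
    also have "\<dots> \<le> (\<Sum>j = 1..J. C j * ?F + (1 + \<delta>)\<^sup>2 * recip_tail j t f n) + 16 * real b / c / real J * (real (n + d) * ?F)"
      using Wj J by (intro add_mono sum_mono recip_tail_sum_bound) auto
    also have "\<dots> \<le> (\<Sum>j = 1..J. C j * ?F + (1 + \<delta>)\<^sup>2 * recip_tail j t f n) + \<delta> * (real (n + d) * ?F)"
      using Jd f_nonneg by (intro add_left_mono mult_right_mono) auto
    also have "(\<Sum>j = 1..J. C j * ?F + (1 + \<delta>)\<^sup>2 * recip_tail j t f n)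
        = CC * ?F + (1 + \<delta>)\<^sup>2 * (\<Sum>j = 1..J. recip_tail j t f n)"
      by (simp add: sum.distrib CC_def sum_distrib_left sum_distrib_right)
    also have "(\<Sum>j = 1..J. recip_tail j t f n) \<le> real n * f n"
      unfolding euler using nJ recip_tail_nonneg by (intro sum_mono2) auto
    finally have "real (n + d) * ?F \<le> CC * ?F + (1 + \<delta>)\<^sup>2 * (real n * f n) + \<delta> * (real (n + d) * ?F)"
      by (simp add: mult_left_mono)
    moreover have "CC * ?F \<le> \<delta> * real n * ?F" using nC f_nonneg by (intro mult_right_mono) auto
    moreover have "\<delta> * (real n * ?F) + (1 - \<delta>) * (real d * ?F) \<ge> \<delta> * (real n * ?F)" using \<delta> f_nonneg by simp
    ultimately have "(1 - 2 * \<delta>) * (real n * ?F) \<le> (1 + \<delta>)\<^sup>2 * (real n * f n)"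
      by (simp add: algebra_simps)
    then have "real n * ((1 - 2 * \<delta>) * ?F) \<le> real n * ((1 + \<delta>)\<^sup>2 * f n)" by (simp add: mult_ac)
    then have 1: "(1 - 2 * \<delta>) * ?F \<le> (1 + \<delta>)\<^sup>2 * f n" using nJ by simp
    have "(1 + \<delta>)\<^sup>2 \<le> (1 + e') * (1 - 2 * \<delta>)"
    proof -
      have "\<delta> * \<delta> \<le> 1 / 8 * \<delta>" using \<delta> by (intro mult_right_mono) auto
      moreover have "(1 + \<delta>)\<^sup>2 = 1 + 2 * \<delta> + \<delta> * \<delta>" by (simp add: power2_eq_square algebra_simps)
      moreover have "(1 + e') * (1 - 2 * \<delta>) = 1 + 6 * \<delta> - 16 * (\<delta> * \<delta>)"
        unfolding \<delta>(3) by (simp add: algebra_simps)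
      ultimately show ?thesis using \<delta>(1) by linarith
    qed
    then have "(1 + \<delta>)\<^sup>2 * f n \<le> (1 + e') * (1 - 2 * \<delta>) * f n" using f_nonneg by (intro mult_right_mono) auto
    with 1 have "(1 - 2 * \<delta>) * ?F \<le> (1 - 2 * \<delta>) * ((1 + e') * f n)" by (simp add: mult_ac)
    then have "?F \<le> (1 + e') * f n" using \<delta> by simp
    also have "\<dots> \<le> (1 + e) * f n" using \<delta> f_nonneg by (intro mult_right_mono) auto
    finally have "?F \<le> (1 + e) * f n" .
    \<comment> \<open>The bound for the long shift \<open>d\<close> passes to \<open>b\<close>
      because \<open>f\<close> does not decrease along periods.\<close>
    moreover have "f (n + b) \<le> ?F"
    proof -
      have "fact J = Suc (fact J - 1)" by simp
      then have "d = b + (fact J - 1) * b" unfolding d_def by (metis mult_Suc)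
      then show ?thesis using f_periods[of "n + b" "fact J - 1"] by (simp add: add.assoc)
    qed
    ultimately show "f (n + b) \<le> (1 + e) * f n" by linarith
  qed
qed

lemma f_smooth_at: "smooth_at b f"
  unfolding smooth_at_def
proof (intro conjI allI impI)
  fix e :: real assume "e > 0"
  then obtain N where "\<forall>n\<ge>N. f (n + b) \<le> (1 + e) * f n" using f_ratio by blast
  then show "\<exists>N. \<forall>n\<ge>N. \<bar>f (n + b) - f n\<bar> \<le> e * f n"
    using f_period by (intro exI[of _ N]) (simp add: algebra_simps)
next
  show "\<exists>c>0. \<exists>N. \<forall>n\<ge>N. \<forall>j. c * f n \<le> f (n + j * b)"
    using f_periods by (intro exI[of _ 1]) auto
qed (use f_nonneg in auto)

end

section \<open>Counting multisets by weight\<close>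

definition cnt :: "('a \<Rightarrow> nat) \<Rightarrow> 'a set \<Rightarrow> nat \<Rightarrow> real" where
  "cnt w X n = real (card {x \<in> X. w x = n})"

definition wt :: "('a \<Rightarrow> nat) \<Rightarrow> 'a multiset \<Rightarrow> nat" where
  "wt w M = (\<Sum>x\<in>#M. w x)"

definition msets :: "'a set \<Rightarrow> 'a multiset set" where
  "msets X = {M. set_mset M \<subseteq> X}"

text \<open>Positivity bounds the size of a multiset by its weight, so the two clauses together make
  all counts of multisets finite.\<close>

definition graded :: "('a \<Rightarrow> nat) \<Rightarrow> 'a set \<Rightarrow> bool" where
  "graded w X \<longleftrightarrow> (\<forall>x\<in>X. 0 < w x) \<and> (\<forall>n. finite {x \<in> X. w x = n})"

lemma wt_simps [simp]: "wt w {#} = 0" "wt w (add_mset x M) = w x + wt w M" "wt w (M + N) = wt w M + wt w N"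
  "wt w (replicate_mset k x) = k * w x"
  by (simp_all add: wt_def)

lemma real_wt: "real (wt w M) = (\<Sum>x\<in>#M. real (w x))"
  by (induction M) auto

lemma wt_diff: "N \<subseteq># M \<Longrightarrow> wt w (M - N) = wt w M - wt w N"
  by (metis add_diff_cancel_left' subset_mset.add_diff_inverse wt_simps(3))

lemma msets_simps [simp]: "{#} \<in> msets X" "add_mset x M \<in> msets X \<longleftrightarrow> x \<in> X \<and> M \<in> msets X"
  "M + N \<in> msets X \<longleftrightarrow> M \<in> msets X \<and> N \<in> msets X"
  by (auto simp: msets_def)

lemma cnt_nonneg [simp]: "0 \<le> cnt w X n" by (simp add: cnt_def)

lemma gradedD: "graded w X \<Longrightarrow> x \<in> X \<Longrightarrow> 0 < w x" "graded w X \<Longrightarrow> finite {x \<in> X. w x = n}"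
  by (auto simp: graded_def)

lemma graded_subset: "graded w X \<Longrightarrow> Y \<subseteq> X \<Longrightarrow> graded w Y"
proof -
  assume a: "graded w X" "Y \<subseteq> X"
  have "finite {x \<in> Y. w x = n}" for n
    using gradedD(2)[OF a(1), of n] by (rule rev_finite_subset) (use a in auto)
  then show ?thesis using a by (auto simp: graded_def)
qed

lemma graded_finite_le:
  assumes "graded w X" shows "finite {x \<in> X. w x \<le> n}"
proof -
  have "{x \<in> X. w x \<le> n} = (\<Union>k\<le>n. {x \<in> X. w x = k})" by auto
  then show ?thesis using gradedD(2)[OF assms] by simp
qed

lemma wt_ge_elem: "x \<in># M \<Longrightarrow> w x \<le> wt w M"
  by (auto dest!: multi_member_split)

lemma wt_ge_size:
  assumes "graded w X" "M \<in> msets X" shows "size M \<le> wt w M"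
  using assms(2)
proof (induction M)
  case (add x M)
  then show ?case using gradedD(1)[OF assms(1), of x] by auto
qed simp

lemma finite_msets_size_le:
  assumes "finite A" shows "finite {M \<in> msets A. size M \<le> n}"
proof -
  have "{M \<in> msets A. size M \<le> n} \<subseteq> mset ` {xs. set xs \<subseteq> A \<and> length xs \<le> n}"
  proof
    fix M assume M: "M \<in> {M \<in> msets A. size M \<le> n}"
    obtain xs where "mset xs = M" using ex_mset by blast
    then show "M \<in> mset ` {xs. set xs \<subseteq> A \<and> length xs \<le> n}" using M by (auto simp: msets_def)
  qed
  then show ?thesis using finite_lists_length_le[OF assms] finite_subset by blast
qed

lemma finite_msets_wt_le:
  assumes "graded w X" shows "finite {M \<in> msets X. wt w M \<le> n}"
proof -
  have "{M \<in> msets X. wt w M \<le> n} \<subseteq> {M \<in> msets {x \<in> X. w x \<le> n}. size M \<le> n}"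
  proof
    fix M assume M: "M \<in> {M \<in> msets X. wt w M \<le> n}"
    have "w x \<le> n" if "x \<in># M" for x using M wt_ge_elem[OF that, of w] by simp
    then show "M \<in> {M \<in> msets {x \<in> X. w x \<le> n}. size M \<le> n}"
      using M wt_ge_size[OF assms, of M] by (auto simp: msets_def)
  qed
  then show ?thesis using finite_msets_size_le[OF graded_finite_le[OF assms]] finite_subset by blast
qed

lemma finite_msets_wt:
  assumes "graded w X" shows "finite {M \<in> msets X. wt w M = n}"
  using finite_msets_wt_le[OF assms, of n] by (rule rev_finite_subset) auto

section \<open>Double counting: the Euler and Newton identities\<close>

lemma sum_by_weight:
  assumes "graded w X"
  shows "(\<Sum>x\<in>{x \<in> X. w x \<le> n}. g (w x)) = (\<Sum>i = 1..n. cnt w X i * (g i :: real))"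
proof -
  have "(\<Sum>x\<in>{x \<in> X. w x \<le> n}. g (w x)) = (\<Sum>i = 1..n. \<Sum>x\<in>{x \<in> {x \<in> X. w x \<le> n}. w x = i}. g (w x))"
    using gradedD(1)[OF assms] graded_finite_le[OF assms] by (intro sum.group[symmetric]) (auto simp: Suc_le_eq)
  also have "\<dots> = (\<Sum>i = 1..n. cnt w X i * g i)"
  proof (rule sum.cong)
    fix i assume "i \<in> {1..n}"
    then have "{x \<in> {x \<in> X. w x \<le> n}. w x = i} = {x \<in> X. w x = i}" by auto
    then show "(\<Sum>x\<in>{x \<in> {x \<in> X. w x \<le> n}. w x = i}. g (w x)) = cnt w X i * g i"
      by (simp add: cnt_def)
  qed simp
  finally show ?thesis .
qed

text \<open>A multiplicity is the number of thresholds \<open>j \<ge> 1\<close> that it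
  reaches.\<close>

lemma sum_count_eq:
  assumes "finite A" "\<And>M. M \<in> A \<Longrightarrow> count M a \<le> n"
  shows "(\<Sum>M\<in>A. real (count M a)) = (\<Sum>j = 1..n. real (card {M \<in> A. j \<le> count M a}))"
proof -
  have "real (count M a) = (\<Sum>j = 1..n. if j \<le> count M a then 1 else 0)" if "M \<in> A" for M
  proof -
    have "{1..n} \<inter> {j. j \<le> count M a} = {1..count M a}" using assms(2)[OF that] by auto
    then show ?thesis by (simp add: sum.If_cases)
  qed
  then have "(\<Sum>M\<in>A. real (count M a)) = (\<Sum>M\<in>A. \<Sum>j = 1..n. if j \<le> count M a then 1 else 0)"
    by (intro sum.cong) auto
  also have "\<dots> = (\<Sum>j = 1..n. \<Sum>M\<in>A. if j \<le> count M a then 1 else 0)" by (rule sum.swap)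
  also have "\<dots> = (\<Sum>j = 1..n. real (card {M \<in> A. j \<le> count M a}))"
    using assms(1) by (intro sum.cong refl) (simp add: sum.If_cases Int_def)
  finally show ?thesis .
qed

text \<open>Strip \<open>j\<close> copies of \<open>a\<close>. The predicate \<open>P\<close> on
  sizes lets one bijection serve both all multisets and those of a fixed size.\<close>

lemma card_count_ge:
  assumes "a \<in> X" "j * w a \<le> n"
  shows "card {M \<in> {M \<in> msets X. P (size M) \<and> wt w M = n}. j \<le> count M a}
    = card {M \<in> msets X. P (size M + j) \<and> wt w M = n - j * w a}"
proof (rule bij_betw_same_card[symmetric])
  show "bij_betw (\<lambda>M. M + replicate_mset j a) {M \<in> msets X. P (size M + j) \<and> wt w M = n - j * w a}
     {M \<in> {M \<in> msets X. P (size M) \<and> wt w M = n}. j \<le> count M a}"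
    unfolding bij_betw_def
  proof
    show "(\<lambda>M. M + replicate_mset j a) ` {M \<in> msets X. P (size M + j) \<and> wt w M = n - j * w a}
       = {M \<in> {M \<in> msets X. P (size M) \<and> wt w M = n}. j \<le> count M a}"
    proof
      show "(\<lambda>M. M + replicate_mset j a) ` {M \<in> msets X. P (size M + j) \<and> wt w M = n - j * w a}
       \<subseteq> {M \<in> {M \<in> msets X. P (size M) \<and> wt w M = n}. j \<le> count M a}"
        using assms by (auto simp: msets_def split: if_splits)
      show "{M \<in> {M \<in> msets X. P (size M) \<and> wt w M = n}. j \<le> count M a}
        \<subseteq> (\<lambda>M. M + replicate_mset j a) ` {M \<in> msets X. P (size M + j) \<and> wt w M = n - j * w a}"
      proof
        fix M assume M: "M \<in> {M \<in> {M \<in> msets X. P (size M) \<and> wt w M = n}. j \<le> count M a}"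
        then have sub: "replicate_mset j a \<subseteq># M" by (simp add: count_le_replicate_mset_subset_eq)
        then have "M = (M - replicate_mset j a) + replicate_mset j a" by simp
        moreover have "size (M - replicate_mset j a) + j = size M"
          using sub by (metis \<open>M = _\<close> size_replicate_mset size_union)
        moreover have "set_mset (M - replicate_mset j a) \<subseteq> set_mset M" by (meson diff_subset_eq_self set_mset_mono)
        ultimately show "M \<in> (\<lambda>M. M + replicate_mset j a) ` {M \<in> msets X. P (size M + j) \<and> wt w M = n - j * w a}"
          using M wt_diff[OF sub, of w] by (intro image_eqI[of _ _ "M - replicate_mset j a"]) (auto simp: msets_def)
      qed
    qed
  qed (simp add: inj_on_def)
qed

lemma card_count_ge_empty:
  assumes "n < j * w a"
  shows "{M \<in> {M \<in> msets X. P (size M) \<and> wt w M = n}. j \<le> count M a} = {}"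
proof -
  have "wt w M \<noteq> n" if "j \<le> count M a" for M
  proof -
    have "replicate_mset j a \<subseteq># M" using that by (simp add: count_le_replicate_mset_subset_eq)
    then have "M = replicate_mset j a + (M - replicate_mset j a)" by simp
    then have "j * w a \<le> wt w M" by (metis wt_simps(3,4) le_add1)
    then show ?thesis using assms by simp
  qed
  then show ?thesis by auto
qed

lemma sum_sizes_eq_sum_counts:
  assumes "finite A" "set_mset M \<subseteq> A"
  shows "(\<Sum>x\<in>A. real (count M x) * g x) = (\<Sum>x\<in>#M. g x)"
  using assms(2)
proof (induction M)
  case (add y M)
  have "(\<Sum>x\<in>A. real (count (add_mset y M) x) * g x) = (\<Sum>x\<in>A. real (count M x) * g x + (if x = y then g y else 0))"
    by (intro sum.cong) (auto simp: algebra_simps)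
  then show ?case using add assms(1) by (simp add: sum.distrib)
qed simp

lemma sum_swap_triangle:
  fixes n :: nat
  assumes "n > 0"
  shows "(\<Sum>i = 1..n. \<Sum>j = 1..n. if j * i \<le> n then G i j else 0) = (\<Sum>j = 1..n. \<Sum>i = 1..n div j. (G i j :: real))"
proof -
  have "(\<Sum>i = 1..n. if j * i \<le> n then G i j else 0) = (\<Sum>i = 1..n div j. G i j)" if "j \<in> {1..n}" for j
  proof -
    have le: "i \<le> n div j \<longleftrightarrow> j * i \<le> n" for i
    proof -
      have "j > 0" using that by simp
      then show ?thesis by (simp add: less_eq_div_iff_mult_less_eq mult.commute)
    qed
    have "{1..n} \<inter> {i. j * i \<le> n} = {1..n div j}"
    proof -
      have "x \<le> n" if "x \<le> n div j" for x using that div_le_dividend[of n j] by linarith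
      then show ?thesis using le by auto
    qed
    then show ?thesis by (simp add: sum.If_cases)
  qed
  then show ?thesis by (subst sum.swap) simp
qed

text \<open>Both sides total the weight of all multisets of weight \<open>n\<close>: sum over
  elements, split each multiplicity into thresholds, strip \<open>j\<close> copies. In terms of
  generating functions it is the logarithmic derivative of the Euler product.\<close>

lemma euler_identity:
  assumes "graded w X"
  defines "f \<equiv> cnt (wt w) (msets X)"
  shows "real n * f n = (\<Sum>j = 1..n. recip_tail j (cnt w X) f n)"
proof (cases "n = 0")
  case False
  let ?A = "{M \<in> msets X. True \<and> wt w M = n}" and ?X = "{x \<in> X. w x \<le> n}"
  have finA: "finite ?A" using finite_msets_wt[OF assms(1), of n] by simp
  have finX: "finite ?X" by (rule graded_finite_le[OF assms(1)])
  have sub: "set_mset M \<subseteq> ?X" if "M \<in> ?A" for M using that wt_ge_elem[of _ M w] by (auto simp: msets_def)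
  have cn: "count M a \<le> n" if "M \<in> ?A" for M a
    using that wt_ge_size[OF assms(1), of M] count_le_size[of M a] by simp
  have "real n * f n = (\<Sum>M\<in>?A. real (wt w M))" by (simp add: f_def cnt_def)
  also have "\<dots> = (\<Sum>M\<in>?A. \<Sum>x\<in>?X. real (count M x) * real (w x))"
    using sum_sizes_eq_sum_counts[OF finX sub, of _ "\<lambda>x. real (w x)"]
    by (intro sum.cong refl) (simp flip: real_wt)
  also have "\<dots> = (\<Sum>x\<in>?X. real (w x) * (\<Sum>M\<in>?A. real (count M x)))"
    by (subst sum.swap) (simp add: sum_distrib_left mult_ac)
  also have "\<dots> = (\<Sum>x\<in>?X. real (w x) * (\<Sum>j = 1..n. if j * w x \<le> n then f (n - j * w x) else 0))"
  proof (intro sum.cong refl arg_cong2[where f = "(*)"])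
    fix x assume x: "x \<in> ?X"
    have "real (card {M \<in> ?A. j \<le> count M x}) = (if j * w x \<le> n then f (n - j * w x) else 0)" for j
    proof (cases "j * w x \<le> n")
      case True
      then show ?thesis using x card_count_ge[of x X j w n "\<lambda>_. True"] by (simp add: f_def cnt_def)
    next
      case False
      then have "{M \<in> ?A. j \<le> count M x} = {}"
        by (intro card_count_ge_empty[where P = "\<lambda>_. True"]) simp
      then show ?thesis using False by (simp only: card.empty) simp
    qed
    then show "(\<Sum>M\<in>?A. real (count M x)) = (\<Sum>j = 1..n. if j * w x \<le> n then f (n - j * w x) else 0)"
      using sum_count_eq[OF finA cn] by simp
  qed
  also have "\<dots> = (\<Sum>i = 1..n. cnt w X i * (real i * (\<Sum>j = 1..n. if j * i \<le> n then f (n - j * i) else 0)))"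
    by (rule sum_by_weight[OF assms(1)])
  also have "\<dots> = (\<Sum>i = 1..n. \<Sum>j = 1..n. if j * i \<le> n then real i * cnt w X i * f (n - i * j) else 0)"
    by (intro sum.cong refl) (simp add: sum_distrib_left mult_ac if_distrib cong: if_cong)
  also have "\<dots> = (\<Sum>j = 1..n. recip_tail j (cnt w X) f n)"
    using False unfolding recip_tail_def by (intro sum_swap_triangle) simp
  finally show ?thesis .
qed simp

text \<open>The same double count with size in place of weight: Newton's identity for complete
  homogeneous symmetric functions, with the dilations as power sums.\<close>

lemma size_identity:
  assumes "graded w X"
  defines "e \<equiv> \<lambda>k. cnt (wt w) {M \<in> msets X. size M = k}"
  shows "real k * e k n = (\<Sum>j = 1..k. conv (dilate j (cnt w X)) (e (k - j)) n)"
proof -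
  let ?A = "{M \<in> msets X. size M = k \<and> wt w M = n}" and ?X = "{x \<in> X. w x \<le> n}"
  have finA: "finite ?A" using finite_msets_wt[OF assms(1), of n] by (rule rev_finite_subset) auto
  have finX: "finite ?X" by (rule graded_finite_le[OF assms(1)])
  have sub: "set_mset M \<subseteq> ?X" if "M \<in> ?A" for M using that wt_ge_elem[of _ M w] by (auto simp: msets_def)
  have cn: "count M a \<le> k" if "M \<in> ?A" for M a
    using that count_le_size[of M a] by simp
  have "real k * e k n = (\<Sum>M\<in>?A. real (size M))" by (simp add: e_def cnt_def conj_ac)
  also have "\<dots> = (\<Sum>M\<in>?A. \<Sum>x\<in>?X. real (count M x))"
    using sum_sizes_eq_sum_counts[OF finX sub, of _ "\<lambda>x. 1"]
    by (intro sum.cong refl) simp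
  also have "\<dots> = (\<Sum>x\<in>?X. (\<Sum>M\<in>?A. real (count M x)))"
    by (subst sum.swap) simp
  also have "\<dots> = (\<Sum>x\<in>?X. (\<Sum>j = 1..k. if j * w x \<le> n then e (k - j) (n - j * w x) else 0))"
  proof (intro sum.cong refl)
    fix x assume x: "x \<in> ?X"
    have "real (card {M \<in> ?A. j \<le> count M x}) = (if j * w x \<le> n then e (k - j) (n - j * w x) else 0)" if "j \<le> k" for j
    proof -
      have "{M \<in> msets X. size M + j = k \<and> wt w M = n - j * w x} = {M \<in> {M \<in> msets X. size M = k - j}. wt w M = n - j * w x}"
        using that by auto
      then have eq: "card {M \<in> msets X. size M + j = k \<and> wt w M = n - j * w x} = e (k - j) (n - j * w x)"
        by (simp only: e_def cnt_def)
      show ?thesis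
      proof (cases "j * w x \<le> n")
        case True
        then show ?thesis using x card_count_ge[of x X j w n "\<lambda>s. s = k"] eq by simp
      next
        case False
        then have "{M \<in> ?A. j \<le> count M x} = {}"
          by (intro card_count_ge_empty[where P = "\<lambda>s. s = k"]) simp
        then show ?thesis using False by (simp only: card.empty) simp
      qed
    qed
    then show "(\<Sum>M\<in>?A. real (count M x)) = (\<Sum>j = 1..k. if j * w x \<le> n then e (k - j) (n - j * w x) else 0)"
      using sum_count_eq[OF finA cn] by simp
  qed
  also have "\<dots> = (\<Sum>i = 1..n. cnt w X i * (\<Sum>j = 1..k. if j * i \<le> n then e (k - j) (n - j * i) else 0))"
    by (rule sum_by_weight[OF assms(1)])
  also have "\<dots> = (\<Sum>i = 1..n. \<Sum>j = 1..k. if j * i \<le> n then cnt w X i * e (k - j) (n - j * i) else 0)"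
    by (intro sum.cong refl) (simp add: sum_distrib_left if_distrib cong: if_cong)
  also have "\<dots> = (\<Sum>j = 1..k. \<Sum>i = 1..n. if j * i \<le> n then cnt w X i * e (k - j) (n - j * i) else 0)"
    by (rule sum.swap)
  also have "\<dots> = (\<Sum>j = 1..k. conv (dilate j (cnt w X)) (e (k - j)) n)"
  proof (rule sum.cong[OF refl])
    fix j assume j: "j \<in> {1..k}"
    \<comment> \<open>As \<open>j\<close> divides \<open>0\<close>, the definition of
      \<open>dilate\<close> leaves a term at \<open>0\<close>; positivity of the weights removes
      it.\<close>
    have t0: "cnt w X 0 = 0"
    proof -
      have "{x \<in> X. w x = 0} = {}" using gradedD(1)[OF assms(1)] by force
      then show ?thesis by (simp only: cnt_def card.empty of_nat_0)
    qed
    let ?g = "\<lambda>m. dilate j (cnt w X) m * e (k - j) (n - m)"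
    have "conv (dilate j (cnt w X)) (e (k - j)) n = (\<Sum>m\<in>(\<lambda>i. j * i) ` {i \<in> {1..n}. j * i \<le> n}. ?g m)"
      unfolding conv_def
    proof (rule sum.mono_neutral_right)
      show "\<forall>m\<in>{..n} - (\<lambda>i. j * i) ` {i \<in> {1..n}. j * i \<le> n}. ?g m = 0"
      proof
        fix m assume m: "m \<in> {..n} - (\<lambda>i. j * i) ` {i \<in> {1..n}. j * i \<le> n}"
        show "?g m = 0"
        proof (cases "j dvd m \<and> m > 0")
          case True
          then obtain i where i: "m = j * i" by (auto elim: dvdE)
          then have "i \<ge> 1" "i \<le> m" using True j by (auto simp: Suc_le_eq)
          moreover have "m \<le> n" using m by simp
          ultimately have "i \<in> {i \<in> {1..n}. j * i \<le> n}" using i le_trans[of i m n] by simp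
          then show ?thesis using m i by blast
        next
          case False
          then show ?thesis using t0 by (auto simp: dilate_def)
        qed
      qed
    qed auto
    also have "\<dots> = (\<Sum>i\<in>{i \<in> {1..n}. j * i \<le> n}. ?g (j * i))"
      using j by (subst sum.reindex) (auto simp: inj_on_def)
    also have "\<dots> = (\<Sum>i = 1..n. if j * i \<le> n then cnt w X i * e (k - j) (n - j * i) else 0)"
      using j by (simp add: sum.If_cases dilate_def Int_def conj_ac flip: sum.inter_filter)
    finally show "(\<Sum>i = 1..n. if j * i \<le> n then cnt w X i * e (k - j) (n - j * i) else 0) = conv (dilate j (cnt w X)) (e (k - j)) n" ..
  qed
  finally show ?thesis .
qed

section \<open>Closure of slow variation under multiset constructions\<close>

lemma cnt_conv:
  assumes inj: "inj_on \<phi> (A \<times> B)" and im: "\<phi> ` (A \<times> B) = C"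
    and wts: "\<And>x y. x \<in> A \<Longrightarrow> y \<in> B \<Longrightarrow> w'' (\<phi> (x, y)) = w x + w' y"
    and fin: "\<And>n. finite {x \<in> A. w x = n}" "\<And>n. finite {x \<in> B. w' x = n}"
  shows "cnt w'' C n = conv (cnt w A) (cnt w' B) n"
proof -
  have eq: "{z \<in> C. w'' z = n} = \<phi> ` (\<Union>k\<le>n. {x \<in> A. w x = k} \<times> {y \<in> B. w' y = n - k})" (is "_ = \<phi> ` ?U")
  proof
    show "{z \<in> C. w'' z = n} \<subseteq> \<phi> ` ?U"
    proof
      fix z assume z: "z \<in> {z \<in> C. w'' z = n}"
      then obtain x y where xy: "x \<in> A" "y \<in> B" "z = \<phi> (x, y)" using im by auto
      then have "w x + w' y = n" using wts z by auto
      then have "(x, y) \<in> ?U" using xy by auto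
      then show "z \<in> \<phi> ` ?U" using xy by blast
    qed
    show "\<phi> ` ?U \<subseteq> {z \<in> C. w'' z = n}" using im wts by auto
  qed
  have "inj_on \<phi> ?U" by (rule inj_on_subset[OF inj]) auto
  then have "card {z \<in> C. w'' z = n} = card ?U" unfolding eq by (rule card_image)
  also have "\<dots> = (\<Sum>k\<le>n. card ({x \<in> A. w x = k} \<times> {y \<in> B. w' y = n - k}))"
    using fin by (intro card_UN_disjoint) (auto simp: finite_cartesian_product)
  finally show ?thesis by (simp add: cnt_def conv_def card_cartesian_product)
qed

lemma cnt_disjoint_UN:
  assumes "finite I" "\<And>i j. i \<in> I \<Longrightarrow> j \<in> I \<Longrightarrow> i \<noteq> j \<Longrightarrow> A i \<inter> A j = {}"
    "\<And>i n. i \<in> I \<Longrightarrow> finite {x \<in> A i. w x = n}"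
  shows "cnt w (\<Union>i\<in>I. A i) n = (\<Sum>i\<in>I. cnt w (A i) n)"
proof -
  have "{x \<in> (\<Union>i\<in>I. A i). w x = n} = (\<Union>i\<in>I. {x \<in> A i. w x = n})" by auto
  moreover have "card \<dots> = (\<Sum>i\<in>I. card {x \<in> A i. w x = n})"
    using assms by (intro card_UN_disjoint) auto
  ultimately show ?thesis by (simp add: cnt_def)
qed

lemma cnt_msets_Un:
  assumes "graded w (X \<union> Y)" "X \<inter> Y = {}"
  shows "cnt (wt w) (msets (X \<union> Y)) = conv (cnt (wt w) (msets X)) (cnt (wt w) (msets Y))"
proof
  fix n
  have gX: "graded w X" and gY: "graded w Y" using graded_subset[OF assms(1)] by auto
  have f1: "filter_mset (\<lambda>x. x \<in> X) (M + N) = M" if "M \<in> msets X" "N \<in> msets Y" for M N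
  proof -
    have "filter_mset (\<lambda>x. x \<in> X) M = M" using that by (auto simp: msets_def filter_mset_eq_conv)
    moreover have "filter_mset (\<lambda>x. x \<in> X) N = {#}" using that assms(2) by (auto simp: msets_def filter_mset_eq_conv)
    ultimately show ?thesis by simp
  qed
  show "cnt (wt w) (msets (X \<union> Y)) n = conv (cnt (wt w) (msets X)) (cnt (wt w) (msets Y)) n"
  proof (rule cnt_conv[where \<phi> = "\<lambda>(M, N). M + N"])
    show "inj_on (\<lambda>(M, N). M + N) (msets X \<times> msets Y)"
    proof (rule inj_onI, clarify)
      fix M N M' N' assume a: "M \<in> msets X" "N \<in> msets Y" "M' \<in> msets X" "N' \<in> msets Y" "M + N = M' + N'"
      then have "M = M'" using f1 by metis
      then show "M = M' \<and> N = N'" using a by simp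
    qed
    show "(\<lambda>(M, N). M + N) ` (msets X \<times> msets Y) = msets (X \<union> Y)"
    proof
      show "msets (X \<union> Y) \<subseteq> (\<lambda>(M, N). M + N) ` (msets X \<times> msets Y)"
      proof
        fix M assume "M \<in> msets (X \<union> Y)"
        then have "(filter_mset (\<lambda>x. x \<in> X) M, filter_mset (\<lambda>x. \<not> x \<in> X) M) \<in> msets X \<times> msets Y"
          by (auto simp: msets_def)
        then show "M \<in> (\<lambda>(M, N). M + N) ` (msets X \<times> msets Y)"
          by (rule rev_image_eqI) (simp flip: multiset_partition)
      qed
    qed (auto simp: msets_def)
  qed (use finite_msets_wt[OF gX] finite_msets_wt[OF gY] in auto)
qed

text \<open>Adding \<open>a\<close> is injective. The size before the addition is read off as
  \<open>size M - 1\<close>, with \<open>M \<noteq> {#}\<close> guarding the truncated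
  subtraction.\<close>

lemma cnt_msets_le_add:
  assumes "graded w X" "a \<in> X"
  shows "cnt (wt w) {M \<in> msets X. P (size M)} n \<le> cnt (wt w) {M \<in> msets X. P (size M - 1) \<and> M \<noteq> {#}} (n + w a)"
proof -
  have "card {M \<in> {M \<in> msets X. P (size M)}. wt w M = n} \<le> card {M \<in> {M \<in> msets X. P (size M - 1) \<and> M \<noteq> {#}}. wt w M = n + w a}"
  proof (rule card_inj_on_le)
    show "inj_on (add_mset a) {M \<in> {M \<in> msets X. P (size M)}. wt w M = n}" by (simp add: inj_on_def)
    show "finite {M \<in> {M \<in> msets X. P (size M - 1) \<and> M \<noteq> {#}}. wt w M = n + w a}"
      using finite_msets_wt[OF assms(1), of "n + w a"] by (rule rev_finite_subset) auto
  qed (use assms in auto)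
  then show ?thesis by (simp add: cnt_def)
qed

lemma cnt_msets_step:
  assumes "graded w X" "a \<in> X"
  shows "cnt (wt w) (msets X) n \<le> cnt (wt w) (msets X) (n + w a)"
proof -
  have "cnt (wt w) (msets X) n \<le> cnt (wt w) {M \<in> msets X. M \<noteq> {#}} (n + w a)"
    using cnt_msets_le_add[OF assms, of "\<lambda>_. True" n] by simp
  also have "\<dots> \<le> cnt (wt w) (msets X) (n + w a)"
    unfolding cnt_def of_nat_le_iff using finite_msets_wt[OF assms(1), of "n + w a"] by (intro card_mono) auto
  finally show ?thesis .
qed

lemma cnt_msets_steps:
  assumes "graded w X" "a \<in> X"
  shows "cnt (wt w) (msets X) n \<le> cnt (wt w) (msets X) (n + r * w a)"
proof (induction r)
  case (Suc r)
  then show ?case using cnt_msets_step[OF assms, of "n + r * w a"] by (simp add: algebra_simps)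
qed simp

text \<open>A finite product of geometric series, one factor per element.\<close>

lemma smooth_msets_finite:
  assumes "finite X" "graded w X"
  shows "smooth (cnt (wt w) (msets X))"
  using assms
proof (induction X rule: finite_induct)
  case empty
  have "cnt (wt w) (msets {}) n = 0" if "n \<ge> 1" for n using that by (auto simp: cnt_def msets_def)
  then show ?case by (intro smooth_eventually_zero[of _ 1]) auto
next
  case (insert x X)
  have wx: "w x > 0" using gradedD(1)[OF insert.prems, of x] by simp
  have eq: "{M \<in> msets {x}. wt w M = n} = (if w x dvd n then {replicate_mset (n div w x) x} else {})" for n
  proof -
    have "M \<in> msets {x} \<longleftrightarrow> (\<exists>k. M = replicate_mset k x)" for M
      by (auto simp: msets_def set_mset_subset_singletonD dest: set_mset_subset_singletonD split: if_splits)
    then show ?thesis using wx by auto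
  qed
  have "smooth (cnt (wt w) (msets {x}))"
    by (rule smooth_periodic[OF _ wx, of _ 0]) (auto simp: cnt_def eq)
  moreover have "smooth (cnt (wt w) (msets X))"
    using insert graded_subset[OF insert.prems] by blast
  moreover have "cnt (wt w) (msets ({x} \<union> X)) = conv (cnt (wt w) (msets {x})) (cnt (wt w) (msets X))"
    using insert by (intro cnt_msets_Un) auto
  ultimately show ?case using smooth_conv by simp
qed

text \<open>The elements of small weight are split off, so that the quasi-monotonicity of \<open>cnt w X\<close> holds from the
  start for the remaining ones.\<close>

theorem smooth_msets:
  assumes g: "graded w X" and t: "smooth (cnt w X)"
  shows "smooth (cnt (wt w) (msets X))"
proof -
  obtain b0 where b0: "b0 > 0" "smooth_at b0 (cnt w X)" using t unfolding smooth_def by auto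
  obtain c N where c: "c > 0" and N: "\<And>n j. n \<ge> N \<Longrightarrow> c * cnt w X n \<le> cnt w X (n + j * b0)"
    using smooth_atD(3)[OF b0(2)] by auto
  let ?Y = "{x \<in> X. w x < N}" and ?Z = "{x \<in> X. w x \<ge> N}"
  have gY: "graded w ?Y" and gZ: "graded w ?Z" using graded_subset[OF g] by auto
  have "finite ?Y" using graded_finite_le[OF g, of N] by (rule rev_finite_subset) auto
  then have 1: "smooth (cnt (wt w) (msets ?Y))" using gY by (rule smooth_msets_finite)
  have tZ: "cnt w ?Z n = (if n \<ge> N then cnt w X n else 0)" for n
  proof (cases "n \<ge> N")
    case True
    then have "{x \<in> ?Z. w x = n} = {x \<in> X. w x = n}" by auto
    then show ?thesis using True by (simp add: cnt_def)
  next
    case False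
    then have "{x \<in> ?Z. w x = n} = {}" by auto
    then show ?thesis using False by (simp only: cnt_def card.empty of_nat_0 if_False)
  qed
  have 2: "smooth (cnt (wt w) (msets ?Z))"
  proof (cases "?Z = {}")
    case True
    then have "finite ?Z" by (simp only: finite.emptyI)
    then show ?thesis using gZ by (rule smooth_msets_finite)
  next
    case False
    then obtain a where a: "a \<in> ?Z" by auto
    have wa: "w a > 0" by (rule gradedD(1)[OF gZ a])
    have sm0: "smooth_at b0 (cnt w ?Z)"
      unfolding smooth_at_def
    proof (intro conjI allI impI)
      fix e :: real assume "e > 0"
      then obtain N1 where "\<forall>n\<ge>N1. \<bar>cnt w X (n + b0) - cnt w X n\<bar> \<le> e * cnt w X n" using smooth_atD(2)[OF b0(2)] by blast
      then show "\<exists>N. \<forall>n\<ge>N. \<bar>cnt w ?Z (n + b0) - cnt w ?Z n\<bar> \<le> e * cnt w ?Z n"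
        unfolding tZ by (intro exI[of _ "max N N1"]) auto
    next
      show "\<exists>c>0. \<exists>M. \<forall>n\<ge>M. \<forall>j. c * cnt w ?Z n \<le> cnt w ?Z (n + j * b0)"
        unfolding tZ using c N by (intro exI[of _ c] conjI exI[of _ N]) auto
    qed auto
    \<comment> \<open>The period has to be a multiple of \<open>b0\<close> for \<open>t\<close>, and
      of the weight of an element for \<open>f\<close>: adding \<open>b0\<close> copies of
      \<open>a\<close> gives \<open>f_period\<close>.\<close>
    have "euler_pair (cnt w ?Z) (cnt (wt w) (msets ?Z)) (w a * b0) c"
    proof
      show "smooth_at (w a * b0) (cnt w ?Z)" by (rule smooth_at_mult[OF sm0])
      show "c * cnt w ?Z n \<le> cnt w ?Z (n + j * (w a * b0))" for n j
        unfolding tZ using N[of n "j * w a"] by (auto simp: mult_ac)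
      show "cnt (wt w) (msets ?Z) n \<le> cnt (wt w) (msets ?Z) (n + i)" if "cnt w ?Z i > 0" for i n
      proof -
        have "{x \<in> ?Z. w x = i} \<noteq> {}" using that by (auto simp: cnt_def card_gt_0_iff)
        then show ?thesis using cnt_msets_step[OF gZ] by blast
      qed
      show "cnt (wt w) (msets ?Z) n \<le> cnt (wt w) (msets ?Z) (n + w a * b0)" for n
        using cnt_msets_steps[OF gZ a, of n b0] by (simp add: mult.commute)
      show "real n * cnt (wt w) (msets ?Z) n = (\<Sum>j = 1..n. recip_tail j (cnt w ?Z) (cnt (wt w) (msets ?Z)) n)" for n
        by (rule euler_identity[OF gZ])
    qed (use wa b0 c in auto)
    then have "smooth_at (w a * b0) (cnt (wt w) (msets ?Z))" by (rule euler_pair.f_smooth_at)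
    then show ?thesis using wa b0 unfolding smooth_def by (intro exI[of _ "w a * b0"]) auto
  qed
  have "?Y \<inter> ?Z = {}" "?Y \<union> ?Z = X" by auto
  then have "cnt (wt w) (msets X) = conv (cnt (wt w) (msets ?Y)) (cnt (wt w) (msets ?Z))"
    using cnt_msets_Un[of w ?Y ?Z] g by (simp only:)
  then show ?thesis using smooth_conv[OF 1 2] by simp
qed

text \<open>Newton's identity reduces size \<open>k\<close> to smaller sizes by dilations,
  convolutions, sums and a scaling.\<close>

lemma smooth_msets_size:
  assumes g: "graded w X" and t: "smooth (cnt w X)"
  shows "smooth (cnt (wt w) {M \<in> msets X. size M = k})"
proof (induction k rule: less_induct)
  case (less k)
  let ?e = "\<lambda>k. cnt (wt w) {M \<in> msets X. size M = k}"
  show ?case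
  proof (cases "k = 0")
    case True
    then have "?e k n = 0" if "n \<ge> 1" for n using that by (auto simp: cnt_def)
    then show ?thesis by (intro smooth_eventually_zero[of _ 1]) auto
  next
    case False
    have "?e k = (\<lambda>n. 1 / real k * (\<Sum>j = 1..k. conv (dilate j (cnt w X)) (?e (k - j)) n))"
      using size_identity[OF g, of k] False by (auto simp: field_simps)
    moreover have "smooth (\<lambda>n. 1 / real k * (\<Sum>j = 1..k. conv (dilate j (cnt w X)) (?e (k - j)) n))"
      using less t by (intro smooth_scale smooth_sum smooth_conv smooth_dilate) auto
    ultimately show ?thesis by simp
  qed
qed

text \<open>Exchanges the unknown period \<open>b\<close> of \<open>f\<close> for a step
  \<open>m\<close> along which \<open>f\<close> is monotone: \<open>f (n + k * m)\<close> lies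
  between \<open>f n\<close> and \<open>f (n + k * m * b)\<close>.\<close>

lemma smooth_step_ratio:
  assumes sm: "smooth f" and step: "\<And>n. f n \<le> f (n + m)" and e: "e > 0"
  shows "\<exists>N. \<forall>n\<ge>N. f (n + k * m) \<le> (1 + e) * f n"
proof -
  obtain b where b: "b > 0" "smooth_at b f" using sm unfolding smooth_def by auto
  have steps: "f n \<le> f (n + r * m)" for n r
  proof (induction r)
    case (Suc r)
    then show ?case using step[of "n + r * m"] by (simp add: algebra_simps)
  qed simp
  obtain N where N: "\<forall>n\<ge>N. \<bar>f (n + (k * m) * b) - f n\<bar> \<le> e * f n"
    using smooth_at_ratio_mult[OF b(2) e] by blast
  have "f (n + k * m) \<le> (1 + e) * f n" if "n \<ge> N" for n
  proof -
    have "f (n + k * m) \<le> f (n + k * m + (k * (b - 1)) * m)" by (rule steps)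
    also have "n + k * m + (k * (b - 1)) * m = n + (k * m) * b"
      using b(1) by (cases b) (simp_all add: algebra_simps)
    also have "f \<dots> \<le> (1 + e) * f n" using N that by (fastforce simp: algebra_simps)
    finally show ?thesis .
  qed
  then show ?thesis by blast
qed

lemma cnt_msets_size_ge:
  assumes "graded w X" "a \<in> X"
  shows "cnt (wt w) (msets X) n \<le> cnt (wt w) {M \<in> msets X. k \<le> size M} (n + k * w a)"
proof -
  have "card {M \<in> msets X. wt w M = n} \<le> card {M \<in> {M \<in> msets X. k \<le> size M}. wt w M = n + k * w a}"
  proof (rule card_inj_on_le)
    show "inj_on (\<lambda>M. M + replicate_mset k a) {M \<in> msets X. wt w M = n}" by (simp add: inj_on_def)
    show "finite {M \<in> {M \<in> msets X. k \<le> size M}. wt w M = n + k * w a}"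
      using finite_msets_wt[OF assms(1), of "n + k * w a"] by (rule rev_finite_subset) auto
    show "(\<lambda>M. M + replicate_mset k a) ` {M \<in> msets X. wt w M = n} \<subseteq> {M \<in> {M \<in> msets X. k \<le> size M}. wt w M = n + k * w a}"
      using assms(2) by (auto simp: msets_def split: if_splits)
  qed
  then show ?thesis by (simp add: cnt_def)
qed

text \<open>Slow variation is not evidently kept when the smaller sizes are subtracted. Instead,
  adding \<open>k\<close> copies of \<open>a\<close> squeezes the count between
  \<open>f (n - k * w a)\<close> and \<open>f n\<close>, which are asymptotically equal.\<close>

lemma smooth_msets_size_ge:
  assumes g: "graded w X" and t: "smooth (cnt w X)"
  shows "smooth (cnt (wt w) {M \<in> msets X. k \<le> size M})"
proof (cases "X = {}")
  case True
  then have "cnt (wt w) {M \<in> msets X. k \<le> size M} n = 0" if "n \<ge> 1" for n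
    using that by (auto simp: cnt_def msets_def)
  then show ?thesis by (intro smooth_eventually_zero[of _ 1]) auto
next
  case False
  then obtain a where a: "a \<in> X" by auto
  let ?f = "cnt (wt w) (msets X)" and ?g = "cnt (wt w) {M \<in> msets X. k \<le> size M}"
  let ?m = "w a"
  have m: "?m > 0" using gradedD(1)[OF g a] .
  have sm: "smooth ?f" by (rule smooth_msets[OF g t])
  have gf: "?g n \<le> ?f n" for n
    unfolding cnt_def of_nat_le_iff using finite_msets_wt[OF g, of n] by (intro card_mono) auto
  have fg: "?f n \<le> ?g (n + k * ?m)" for n by (rule cnt_msets_size_ge[OF g a])
  have gstep: "?g n \<le> ?g (n + ?m)" for n
  proof -
    have "?g n \<le> cnt (wt w) {M \<in> msets X. k \<le> size M - 1 \<and> M \<noteq> {#}} (n + ?m)"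
      using cnt_msets_le_add[OF g a, of "\<lambda>s. k \<le> s"] .
    also have "\<dots> \<le> ?g (n + ?m)"
      unfolding cnt_def of_nat_le_iff using finite_msets_wt[OF g, of "n + ?m"]
      by (intro card_mono) (auto elim: rev_finite_subset)
    finally show ?thesis .
  qed
  have gsteps: "?g n \<le> ?g (n + j * ?m)" for n j
  proof (induction j)
    case (Suc j)
    then show ?case using gstep[of "n + j * ?m"] by (simp add: algebra_simps)
  qed simp
  have "smooth_at ?m ?g" unfolding smooth_at_def
  proof (intro conjI allI impI)
    fix e :: real assume e: "e > 0"
    obtain N where N: "\<forall>n\<ge>N. ?f (n + Suc k * ?m) \<le> (1 + e) * ?f n"
      using smooth_step_ratio[OF sm cnt_msets_step[OF g a] e] by blast
    have bd: "?g (n + ?m) - ?g n \<le> e * ?g n" if n: "n \<ge> N + k * ?m" for n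
    proof -
      define l where "l = n - k * ?m"
      have l: "n = l + k * ?m" "l \<ge> N" using n by (auto simp: l_def)
      have "?g (n + ?m) \<le> ?f (n + ?m)" by (rule gf)
      also have "?f (n + ?m) \<le> (1 + e) * ?f l"
      proof -
        have "n + ?m = l + Suc k * ?m" using l by simp
        then show ?thesis using N l(2) by (simp only:)
      qed
      also have "\<dots> \<le> (1 + e) * ?g n" using fg[of l] l e by (intro mult_left_mono) auto
      finally show ?thesis by (simp add: algebra_simps)
    qed
    then show "\<exists>N. \<forall>n\<ge>N. \<bar>?g (n + ?m) - ?g n\<bar> \<le> e * ?g n"
    proof (intro exI[of _ "N + k * ?m"] allI impI)
      fix n assume "N + k * ?m \<le> n"
      then have "?g (n + ?m) - ?g n \<le> e * ?g n" by (rule bd)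
      then show "\<bar>?g (n + ?m) - ?g n\<bar> \<le> e * ?g n" using gstep[of n] by linarith
    qed
  next
    show "\<exists>c>0. \<exists>N. \<forall>n\<ge>N. \<forall>j. c * ?g n \<le> ?g (n + j * ?m)"
      using gsteps by (intro exI[of _ 1]) auto
  qed auto
  then show ?thesis using m unfolding smooth_def by blast
qed

section \<open>Finite typings of unordered trees\<close>

datatype utree = Node "utree multiset"

primrec nodes :: "utree \<Rightarrow> nat" where
  "nodes (Node M) = Suc (\<Sum>\<^sub># (image_mset nodes M))"

lemma nodes_Node: "nodes (Node M) = Suc (wt nodes M)" by (simp add: wt_def)

declare nodes.simps [simp del] nodes_Node [simp]

text \<open>Bracket words of length \<open>2 n\<close> decode, on a stack, to all forests with \<open>n\<close> nodes.\<close>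

fun paren_step :: "utree multiset list \<Rightarrow> bool \<Rightarrow> utree multiset list" where
  "paren_step st True = {#} # st"
| "paren_step (M # N # st) False = add_mset (Node M) N # st"
| "paren_step st False = st"

text \<open>The hypothesis on single trees is the induction hypothesis of \<open>paren_tree\<close>,
  which afterwards discharges it for all forests.\<close>

lemma paren_forest:
  assumes "\<And>t. t \<in># M \<Longrightarrow> \<exists>w. length w = 2 * nodes t \<and> (\<forall>N st. foldl paren_step (N # st) w = add_mset t N # st)"
  shows "\<exists>w. length w = 2 * wt nodes M \<and> (\<forall>N st. foldl paren_step (N # st) w = (M + N) # st)"
  using assms
proof (induction M)
  case (add t M)
  obtain w where w: "length w = 2 * nodes t" "\<And>N st. foldl paren_step (N # st) w = add_mset t N # st"
    using add.prems[of t] by auto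
  obtain w' where w': "length w' = 2 * wt nodes M" "\<And>N st. foldl paren_step (N # st) w' = (M + N) # st"
    using add by auto
  show ?case using w w' by (intro exI[of _ "w @ w'"]) auto
qed (auto intro: exI[of _ "[]"])

lemma paren_tree: "\<exists>w. length w = 2 * nodes t \<and> (\<forall>N st. foldl paren_step (N # st) w = add_mset t N # st)"
proof (induction t)
  case (Node M)
  have "\<exists>w. length w = 2 * wt nodes M \<and> (\<forall>N st. foldl paren_step (N # st) w = (M + N) # st)"
    by (rule paren_forest) (rule Node)
  then obtain w where w: "length w = 2 * wt nodes M" "\<And>N st. foldl paren_step (N # st) w = (M + N) # st"
    by auto
  have "foldl paren_step (N # st) (True # w @ [False]) = add_mset (Node M) N # st" for N st
    by (simp add: w(2))
  moreover have "length (True # w @ [False]) = 2 * nodes (Node M)" by (simp add: w(1))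
  ultimately show ?case by blast
qed

lemma forests_encoded: "{M. wt nodes M = n} \<subseteq> (\<lambda>w. hd (foldl paren_step [{#}] w)) ` {w. set w \<subseteq> UNIV \<and> length w = 2 * n}"
proof
  fix M assume M: "M \<in> {M. wt nodes M = n}"
  have "\<exists>w. length w = 2 * wt nodes M \<and> (\<forall>N st. foldl paren_step (N # st) w = (M + N) # st)"
    by (rule paren_forest) (rule paren_tree)
  then obtain w where "length w = 2 * wt nodes M" "\<And>N st. foldl paren_step (N # st) w = (M + N) # st"
    by auto
  then show "M \<in> (\<lambda>w. hd (foldl paren_step [{#}] w)) ` {w. set w \<subseteq> UNIV \<and> length w = 2 * n}"
    using M by (intro image_eqI[of _ _ w]) auto
qed

lemma finite_forests: "finite {M. wt nodes M = n}"
  by (rule finite_subset[OF forests_encoded finite_imageI[OF finite_lists_length_eq]]) simp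

lemma card_forests: "card {M. wt nodes M = n} \<le> 4 ^ n"
proof -
  have "finite {w :: bool list. set w \<subseteq> UNIV \<and> length w = 2 * n}" by (rule finite_lists_length_eq) simp
  then have "card {M. wt nodes M = n} \<le> card {w :: bool list. set w \<subseteq> UNIV \<and> length w = 2 * n}"
    using forests_encoded by (rule surj_card_le)
  also have "\<dots> = 2 ^ (2 * n)" by (subst card_lists_length_eq) auto
  finally show ?thesis by (simp add: power_mult)
qed

lemma finite_trees: "finite {t. nodes t = n}"
proof -
  have "inj_on (\<lambda>t. {#t#}) {t. nodes t = n}" by (simp add: inj_on_def)
  moreover have "(\<lambda>t. {#t#}) ` {t. nodes t = n} \<subseteq> {M. wt nodes M = n}" by auto
  ultimately show ?thesis using finite_forests inj_on_finite by blast
qed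

section \<open>Weights of trees and thin sets\<close>

lemma nodes_pos [simp]: "0 < nodes t" by (cases t) simp

lemma finite_trees_in [simp]: "finite {t \<in> X. nodes t = n}"
  using finite_trees[of n] by (rule rev_finite_subset) auto

lemma graded_trees: "graded nodes X"
  by (simp add: graded_def)

lemma finite_trees_conj [simp]: "finite {t. P t \<and> nodes t = n}"
  using finite_trees[of n] by (rule rev_finite_subset) auto

lemma finite_forests_in [simp]: "finite {M \<in> X. wt nodes M = n}"
  using finite_forests[of n] by (rule rev_finite_subset) auto

text \<open>Radius of convergence at least \<open>1\<close>, put as summability so that injections
  transfer it by comparison of series.\<close>

definition thin :: "utree set \<Rightarrow> bool" where
  "thin X \<longleftrightarrow> (\<forall>x::real. 0 < x \<longrightarrow> x < 1 \<longrightarrow> summable (\<lambda>n. cnt nodes X n * x ^ n))"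

lemma thin_inj:
  assumes "thin Y" "inj_on \<phi> X" "\<phi> ` X \<subseteq> Y" "\<And>t. t \<in> X \<Longrightarrow> nodes (\<phi> t) = nodes t + s"
  shows "thin X"
  unfolding thin_def
proof (intro allI impI)
  fix x :: real assume x: "0 < x" "x < 1"
  have le: "cnt nodes X n \<le> cnt nodes Y (n + s)" for n
    unfolding cnt_def of_nat_le_iff
    by (rule card_inj_on_le[of \<phi>]) (use assms in \<open>auto intro: inj_on_subset\<close>)
  have "summable (\<lambda>n. cnt nodes Y n * x ^ n)" using assms(1) x by (auto simp: thin_def)
  then have "summable (\<lambda>n. cnt nodes Y (n + s) * x ^ (n + s))" by (rule summable_ignore_initial_segment)
  then have "summable (\<lambda>n. cnt nodes Y (n + s) * x ^ (n + s) / x ^ s)" by (rule summable_divide)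
  then have "summable (\<lambda>n. cnt nodes Y (n + s) * x ^ n)" using x by (simp add: power_add)
  then show "summable (\<lambda>n. cnt nodes X n * x ^ n)"
    by (rule summable_comparison_test'[of _ 0]) (use x le in \<open>simp add: mult_right_mono\<close>)
qed

lemma thin_subset: "thin Y \<Longrightarrow> X \<subseteq> Y \<Longrightarrow> thin X"
  by (rule thin_inj[of Y id X 0]) auto

text \<open>Some \<open>x < 1\<close> has \<open>x ^ s \<ge> 1 / 2\<close>; along the doubling
  progression the terms of the series at \<open>x\<close> then stay away from
  \<open>0\<close>.\<close>

lemma not_thin_doubling:
  assumes dbl: "\<And>n. 2 * cnt nodes X n \<le> cnt nodes X (n + s)" and "t \<in> X"
  shows "\<not> thin X"
proof
  assume th: "thin X"
  \<comment> \<open>Bernoulli's inequality gives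
    \<open>x ^ s \<ge> 1 - s / (2 * (s + 1)) \<ge> 1 / 2\<close>.\<close>
  define x where "x = 1 - 1 / (2 * (real s + 1))"
  have x: "0 < x" "x < 1" by (simp_all add: x_def field_simps)
  have "1 + real s * (- 1 / (2 * (real s + 1))) \<le> (1 + (- 1 / (2 * (real s + 1)))) ^ s"
    by (rule Bernoulli_inequality) (simp add: field_simps)
  moreover have "1 + real s * (- 1 / (2 * (real s + 1))) \<ge> 1 / 2" by (simp add: field_simps)
  moreover have "x = 1 + (- 1 / (2 * (real s + 1)))" by (simp add: x_def)
  ultimately have xs: "1 / 2 \<le> x ^ s" by (metis order_trans)
  define n0 where "n0 = nodes t"
  have "t \<in> {u \<in> X. nodes u = n0}" using assms(2) by (simp add: n0_def)
  then have "card {u \<in> X. nodes u = n0} > 0" by (auto simp: card_gt_0_iff)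
  then have base: "1 \<le> cnt nodes X n0" by (simp add: cnt_def)
  have low: "x ^ n0 \<le> cnt nodes X (n0 + m * s) * x ^ (n0 + m * s)" for m
  proof (induction m)
    case 0
    then show ?case using base x by simp
  next
    case (Suc m)
    have "x ^ n0 \<le> cnt nodes X (n0 + m * s) * x ^ (n0 + m * s)" by fact
    also have "\<dots> = (2 * cnt nodes X (n0 + m * s)) * (x ^ (n0 + m * s) * (1 / 2))" by simp
    also have "\<dots> \<le> cnt nodes X (n0 + m * s + s) * (x ^ (n0 + m * s) * x ^ s)"
      using dbl xs x by (intro mult_mono) auto
    also have "\<dots> = cnt nodes X (n0 + Suc m * s) * x ^ (n0 + Suc m * s)"
      by (simp add: algebra_simps power_add)
    finally show ?case .
  qed
  have "summable (\<lambda>n. cnt nodes X n * x ^ n)" using th x by (auto simp: thin_def)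
  then have "(\<lambda>n. cnt nodes X n * x ^ n) \<longlonglongrightarrow> 0" by (rule summable_LIMSEQ_zero)
  moreover have "x ^ n0 > 0" using x by simp
  ultimately obtain N where N: "\<And>n. n \<ge> N \<Longrightarrow> norm (cnt nodes X n * x ^ n - 0) < x ^ n0"
    by (meson LIMSEQ_iff)
  show False
  proof (cases "s = 0")
    case True
    then show ?thesis using dbl[of n0] base by simp
  next
    case False
    then have "n0 + N * s \<ge> N" by (cases s) auto
    then show ?thesis using N[of "n0 + N * s"] low[of N] x by simp
  qed
qed

text \<open>A one-hole context is a word of side forests, read from the hole upwards.\<close>

fun plug :: "utree multiset list \<Rightarrow> utree \<Rightarrow> utree" where
  "plug [] t = t"
| "plug (G # Gs) t = plug Gs (Node (add_mset t G))"

definition side :: "utree multiset list \<Rightarrow> nat" where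
  "side Gs = (\<Sum>G\<leftarrow>Gs. Suc (wt nodes G))"

lemma nodes_plug: "nodes (plug Gs t) = nodes t + side Gs"
  by (induction Gs arbitrary: t) (auto simp: side_def)

lemma plug_append: "plug (Us @ Vs) t = plug Vs (plug Us t)"
  by (induction Us arbitrary: t) auto

lemma plug_inj: "plug Gs t = plug Gs u \<longleftrightarrow> t = u"
  by (induction Gs arbitrary: t u) auto

text \<open>What the counting of trees relies on: finitely many types, and the type of a node
  determined by the counts of its children's types up to \<open>K\<close>.\<close>

locale tree_typing =
  fixes tyof :: "utree \<Rightarrow> nat" and K :: nat
  assumes finite_tyof: "finite (range tyof)"
    and tyof_Node: "\<And>M N. (\<And>a. min K (count (image_mset tyof M) a) = min K (count (image_mset tyof N) a)) \<Longrightarrow>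
      tyof (Node M) = tyof (Node N)"
begin

section \<open>Contexts and the dependency graph of types\<close>

definition T :: "nat \<Rightarrow> utree set" where "T i = {t. tyof t = i}"

text \<open>Edges lead from the type of a child to that of its parent, and only edges realised by a
  tree are present.\<close>

definition child :: "nat \<Rightarrow> nat \<Rightarrow> bool" where
  "child i j \<longleftrightarrow> (\<exists>G t. tyof t = i \<and> tyof (Node (add_mset t G)) = j)"

abbreviation reach :: "nat \<Rightarrow> nat \<Rightarrow> bool" where "reach \<equiv> child\<^sup>*\<^sup>*"

lemma tyof_ctx: "tyof t = tyof u \<Longrightarrow> tyof (Node (add_mset t G)) = tyof (Node (add_mset u G))"
  by (rule tyof_Node) simp

lemma tyof_ctx2: "tyof t = tyof u \<Longrightarrow> tyof t' = tyof u' \<Longrightarrow>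
    tyof (Node (add_mset t (add_mset t' G))) = tyof (Node (add_mset u (add_mset u' G)))"
  by (rule tyof_Node) simp

lemma reach_plug: "reach (tyof t) (tyof (plug Gs t))"
proof (induction Gs arbitrary: t)
  case (Cons G Gs)
  have "child (tyof t) (tyof (Node (add_mset t G)))" by (auto simp: child_def)
  then show ?case using Cons[of "Node (add_mset t G)"] by simp
qed simp

text \<open>Realise each edge by a side forest. Since types are congruences, a single context serves
  all trees of type \<open>i\<close>.\<close>

lemma reach_ctx: "reach i j \<Longrightarrow> \<exists>Gs. \<forall>t. tyof t = i \<longrightarrow> tyof (plug Gs t) = j"
proof (induction rule: rtranclp_induct)
  case base
  show ?case by (rule exI[of _ "[]"]) simp
next
  case (step j l)
  then obtain Gs where Gs: "\<forall>t. tyof t = i \<longrightarrow> tyof (plug Gs t) = j" by blast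
  obtain G u where u: "tyof u = j" "tyof (Node (add_mset u G)) = l" using step(2) by (auto simp: child_def)
  have "tyof (plug (Gs @ [G]) t) = l" if "tyof t = i" for t
    using tyof_ctx[of "plug Gs t" u G] Gs u that by (simp add: plug_append)
  then show ?case by blast
qed

text \<open>Plugging into a fixed context is injective and adds a constant size.\<close>

lemma thin_reach:
  assumes "thin (T j)" "reach i j" shows "thin (T i)"
proof -
  obtain Gs where "\<forall>t. tyof t = i \<longrightarrow> tyof (plug Gs t) = j" using reach_ctx[OF assms(2)] by blast
  then show ?thesis
    by (intro thin_inj[OF assms(1), of "plug Gs" _ "side Gs"]) (auto simp: inj_on_def plug_inj T_def nodes_plug)
qed

text \<open>Otherwise there would be a tree context of type \<open>k\<close> with two holes of type \<open>k\<close>, and filling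
  them in all possible ways makes the number of trees of type \<open>k\<close> double along a progression.\<close>

lemma at_most_one_child_in_scc:
  assumes th: "thin (T k)" and k: "tyof (Node (add_mset t1 (add_mset t2 G))) = k"
    and r: "reach k (tyof t1)" "reach k (tyof t2)"
  shows False
proof -
  obtain U1 where U1: "\<And>t. tyof t = k \<Longrightarrow> tyof (plug U1 t) = tyof t1" using reach_ctx[OF r(1)] by blast
  obtain U2 where U2: "\<And>t. tyof t = k \<Longrightarrow> tyof (plug U2 t) = tyof t2" using reach_ctx[OF r(2)] by blast
  define \<Phi> where "\<Phi> = (\<lambda>(A, B). Node (add_mset (plug U1 A) (add_mset (plug U2 B) G)))"
  define s where "s = Suc (side U1 + side U2 + wt nodes G)"
  have \<Phi>T: "\<Phi> (A, B) \<in> T k" if "A \<in> T k" "B \<in> T k" for A B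
    using tyof_ctx2[of "plug U1 A" t1 "plug U2 B" t2 G] U1 U2 k that by (simp add: \<Phi>_def T_def)
  have \<Phi>n: "nodes (\<Phi> (A, B)) = nodes A + nodes B + s" for A B by (simp add: \<Phi>_def s_def nodes_plug)
  \<comment> \<open>\<open>\<Phi>\<close> is at most two to one: the multiset of the two filled
    branches forgets only which of them belongs to which hole.\<close>
  have pairs: "real (card Z) \<le> 2 * cnt nodes (T k) (n + s)"
    if Z: "finite Z" "Z \<subseteq> T k \<times> T k" "\<And>A B. (A, B) \<in> Z \<Longrightarrow> nodes A + nodes B = n" for Z n
  proof -
    let ?E = "(plug U1 \<circ> fst) ` Z \<union> (plug U2 \<circ> snd) ` Z"
    have "finite ?E" using Z by simp
    then obtain f :: "utree \<Rightarrow> nat" where f: "inj_on f ?E" using finite_imp_inj_to_nat_seg by metis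
    \<comment> \<open>\<open>f\<close> orders the finitely many branches arbitrarily; the bit
      records the order of the two holes and restores injectivity.\<close>
    define \<Psi> where "\<Psi> = (\<lambda>(A, B). (\<Phi> (A, B), f (plug U1 A) \<le> f (plug U2 B)))"
    have "inj_on \<Psi> Z"
    proof (rule inj_onI, clarify)
      fix A B A' B' assume a: "(A, B) \<in> Z" "(A', B') \<in> Z" "\<Psi> (A, B) = \<Psi> (A', B')"
      let ?p = "plug U1 A" and ?q = "plug U2 B" and ?p' = "plug U1 A'" and ?q' = "plug U2 B'"
      have E: "?p \<in> ?E" "?q \<in> ?E" "?p' \<in> ?E" "?q' \<in> ?E" using a by force+
      have fle: "f ?p \<le> f ?q \<longleftrightarrow> f ?p' \<le> f ?q'" using a(3) by (simp add: \<Psi>_def)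
      have "{#?p, ?q#} + G = {#?p', ?q'#} + G" using a(3) by (simp add: \<Psi>_def \<Phi>_def)
      then have "{#?p, ?q#} = {#?p', ?q'#}" by (rule add_right_imp_eq)
      then consider "?p = ?p'" "?q = ?q'" | "?p = ?q'" "?q = ?p'" by (auto simp: add_eq_conv_ex)
      then have "?p = ?p' \<and> ?q = ?q'"
      proof cases
        case 2
        then have "f ?p = f ?q" using fle by auto
        then have "?p = ?q" using f E by (meson inj_onD)
        then show ?thesis using 2 by simp
      qed simp
      then show "A = A' \<and> B = B'" by (simp add: plug_inj)
    qed
    moreover have "\<Psi> ` Z \<subseteq> {t \<in> T k. nodes t = n + s} \<times> (UNIV :: bool set)"
    proof
      fix z assume "z \<in> \<Psi> ` Z"
      then obtain A B where AB: "(A, B) \<in> Z" "z = \<Psi> (A, B)" by auto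
      then have "\<Phi> (A, B) \<in> T k" "nodes (\<Phi> (A, B)) = n + s" using \<Phi>T \<Phi>n Z(2,3) by auto
      then show "z \<in> {t \<in> T k. nodes t = n + s} \<times> (UNIV :: bool set)" by (simp add: AB(2) \<Psi>_def)
    qed
    ultimately have "card Z \<le> card ({t \<in> T k. nodes t = n + s} \<times> (UNIV :: bool set))"
      by (intro card_inj_on_le[of \<Psi>]) auto
    then have "card Z \<le> 2 * card {t \<in> T k. nodes t = n + s}" by (simp add: card_cartesian_product mult.commute)
    then have "real (card Z) \<le> real (2 * card {t \<in> T k. nodes t = n + s})" by (simp only: of_nat_le_iff)
    then show ?thesis by (simp add: cnt_def)
  qed
  define A0 where "A0 = Node (add_mset t1 (add_mset t2 G))"
  have A0: "A0 \<in> T k" using k by (simp add: A0_def T_def)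
  \<comment> \<open>Combs of type \<open>k\<close> whose sizes form a proper arithmetic progression,
    hence pairwise distinct.\<close>
  define A where "A = (\<lambda>i. ((\<lambda>t. \<Phi> (t, A0)) ^^ i) A0)"
  have AT: "A i \<in> T k" for i by (induction i) (auto simp: A_def A0 \<Phi>T)
  have An: "nodes (A i) = nodes A0 + i * (nodes A0 + s)" for i
  proof (induction i)
    case (Suc i)
    have "A (Suc i) = \<Phi> (A i, A0)" by (simp add: A_def)
    then show ?case using Suc by (simp add: \<Phi>n)
  qed (simp add: A_def)
  have injA: "A i = A j \<Longrightarrow> i = j" for i j
  proof -
    assume "A i = A j"
    then have "nodes A0 + i * (nodes A0 + s) = nodes A0 + j * (nodes A0 + s)" using An by metis
    then have "i * (nodes A0 + s) = j * (nodes A0 + s)" by linarith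
    moreover have "nodes A0 + s \<noteq> 0" by (simp add: s_def)
    ultimately show "i = j" by (metis mult_right_cancel)
  qed
  define n1 where "n1 = 2 * nodes A0 + 7 * (nodes A0 + s) + s"
  \<comment> \<open>Eight pairs of equal total size: two to one, they give at least four trees of
    size \<open>n1\<close>. The second use of \<open>pairs\<close> halves once more, which leaves
    the factor \<open>2\<close>.\<close>
  let ?Z = "(\<lambda>i. (A i, A (7 - i))) ` {..7}"
  have "nodes (A i) + nodes (A (7 - i)) = 2 * nodes A0 + 7 * (nodes A0 + s)" if "i \<le> 7" for i
  proof -
    have "i * (nodes A0 + s) + (7 - i) * (nodes A0 + s) = 7 * (nodes A0 + s)"
      using that by (simp flip: add_mult_distrib)
    then show ?thesis by (simp add: An)
  qed
  then have "real (card ?Z) \<le> 2 * cnt nodes (T k) n1"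
    unfolding n1_def by (intro pairs) (auto simp: AT)
  moreover have "card ?Z = 8" by (subst card_image) (auto simp: inj_on_def dest: injA)
  ultimately have big: "4 \<le> cnt nodes (T k) n1" by simp
  have "2 * cnt nodes (T k) n \<le> cnt nodes (T k) (n + (n1 + s))" for n
  proof -
    have "real (card ({t \<in> T k. nodes t = n} \<times> {t \<in> T k. nodes t = n1})) \<le> 2 * cnt nodes (T k) (n + n1 + s)"
      by (intro pairs) auto
    then have "cnt nodes (T k) n * cnt nodes (T k) n1 \<le> 2 * cnt nodes (T k) (n + n1 + s)"
      by (simp add: card_cartesian_product cnt_def)
    moreover have "cnt nodes (T k) n * 4 \<le> cnt nodes (T k) n * cnt nodes (T k) n1"
      using big by (intro mult_left_mono) auto
    ultimately show ?thesis by (simp add: add.assoc)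
  qed
  then show False using not_thin_doubling[of "T k" "n1 + s" A0] A0 th by blast
qed

section \<open>Strongly connected components of thin types\<close>

definition scc :: "nat \<Rightarrow> nat set" where "scc k = {l. reach l k \<and> reach k l}"

lemma sccD: "l \<in> scc k \<Longrightarrow> reach l k" "l \<in> scc k \<Longrightarrow> reach k l"
  by (simp_all add: scc_def)

lemma scc_reach: "l \<in> scc k \<Longrightarrow> m \<in> scc k \<Longrightarrow> reach l m"
  by (rule rtranclp_trans[OF sccD(1) sccD(2)])

lemma scc_between:
  assumes "l \<in> scc k" "m \<in> scc k" "reach l i" "reach i m"
  shows "i \<in> scc k"
  using rtranclp_trans[OF sccD(2)[OF assms(1)] assms(3)] rtranclp_trans[OF assms(4) sccD(1)[OF assms(2)]]
  by (simp add: scc_def)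

lemma thin_scc: "thin (T k) \<Longrightarrow> l \<in> scc k \<Longrightarrow> thin (T l)"
  by (rule thin_reach[OF _ sccD(1)])

lemma scc_at_most_one:
  assumes th: "thin (T k)" and "tyof t1 \<in> scc k" "tyof t2 \<in> scc k"
  shows "tyof (Node (add_mset t1 (add_mset t2 G))) \<notin> scc k"
proof
  let ?l = "tyof (Node (add_mset t1 (add_mset t2 G)))"
  assume l: "?l \<in> scc k"
  show False
    by (rule at_most_one_child_in_scc[OF thin_scc[OF th l] refl scc_reach[OF l assms(2)] scc_reach[OF l assms(3)]])
qed

text \<open>At most one child has its type in the component, so it is marked, and child and side
  forest can be read off the multiset.\<close>

lemma scc_child_unique:
  assumes th: "thin (T k)" and "tyof t \<in> scc k" "tyof u \<in> scc k" "tyof (Node (add_mset t G)) \<in> scc k"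
    and eq: "add_mset t G = add_mset u H"
  shows "t = u \<and> G = H"
proof (rule ccontr)
  assume "\<not> (t = u \<and> G = H)"
  then have "t \<noteq> u" using eq by auto
  then obtain G' where "G = add_mset u G'" using eq by (metis add_eq_conv_ex)
  then show False using scc_at_most_one[OF th assms(2,3), of G'] assms(4) by simp
qed

text \<open>Unique readability of context words whose intermediate types stay in the component.
  Peeling starts with the last letter, at the root, where the marked child is visible.\<close>

lemma plug_eqD:
  assumes th: "thin (T k)"
  shows "length Us = length Vs \<Longrightarrow> (\<And>r. tyof (plug (take r Us) A) \<in> scc k) \<Longrightarrow>
    (\<And>r. tyof (plug (take r Vs) B) \<in> scc k) \<Longrightarrow> plug Us A = plug Vs B \<Longrightarrow> Us = Vs \<and> A = B"
proof (induction Us arbitrary: Vs rule: rev_induct)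
  case Nil
  then show ?case by simp
next
  case (snoc G Us)
  then obtain H Ws where Vs: "Vs = Ws @ [H]" "length Us = length Ws"
    by (cases Vs rule: rev_cases) auto
  have p1: "tyof (plug (take r Us) A) \<in> scc k" for r
    using snoc.prems(2)[of "min r (length Us)"] by (simp add: min_def split: if_splits)
  have p2: "tyof (plug (take r Ws) B) \<in> scc k" for r
    using snoc.prems(3)[of "min r (length Ws)"] Vs by (simp add: min_def split: if_splits)
  have eq: "add_mset (plug Us A) G = add_mset (plug Ws B) H"
    using snoc.prems(4) by (simp add: Vs plug_append)
  have "tyof (Node (add_mset (plug Us A) G)) \<in> scc k"
    using snoc.prems(2)[of "Suc (length Us)"] by (simp add: plug_append)
  then have "plug Us A = plug Ws B \<and> G = H"
    using scc_child_unique[OF th _ _ _ eq] p1[of "length Us"] p2[of "length Ws"] by simp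
  then show ?case using snoc.IH[OF Vs(2) p1 p2] Vs by simp
qed

text \<open>Two different side forests \<open>G\<close>, \<open>H\<close> would start two different closed words at \<open>k\<close>; composing them
  in both orders gives two injections of the same degree with disjoint images.\<close>

lemma scc_side_unique:
  assumes th: "thin (T k)" and t: "tyof t \<in> scc k"
    and G: "tyof (Node (add_mset t G)) \<in> scc k" and H: "tyof (Node (add_mset t H)) \<in> scc k"
  shows "G = H"
proof (rule ccontr)
  assume neq: "G \<noteq> H"
  let ?l = "tyof t"
  have thl: "thin (T ?l)" by (rule thin_scc[OF th t])
  have cl: "\<exists>Us. \<forall>u. tyof u = ?l \<longrightarrow> tyof (plug (F # Us) u) = ?l" if F: "tyof (Node (add_mset t F)) \<in> scc k" for F
  proof -
    have "reach (tyof (Node (add_mset t F))) ?l" by (rule scc_reach[OF F t])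
    from reach_ctx[OF this] obtain Us where Us: "\<And>u. tyof u = tyof (Node (add_mset t F)) \<Longrightarrow> tyof (plug Us u) = ?l"
      by auto
    have "tyof (plug (F # Us) u) = ?l" if "tyof u = ?l" for u
      using Us tyof_ctx[OF that, of F] by simp
    then show ?thesis by blast
  qed
  obtain Us where Us: "\<And>u. tyof u = ?l \<Longrightarrow> tyof (plug (G # Us) u) = ?l" using cl[OF G] by blast
  obtain Vs where Vs: "\<And>u. tyof u = ?l \<Longrightarrow> tyof (plug (H # Vs) u) = ?l" using cl[OF H] by blast
  \<comment> \<open>The two orders have equal length and equal size but different first letters, so
    by unique readability their images are disjoint.\<close>
  let ?X = "(G # Us) @ (H # Vs)" and ?Y = "(H # Vs) @ (G # Us)"
  have X: "tyof (plug ?X u) = ?l" and Y: "tyof (plug ?Y u) = ?l" if "tyof u = ?l" for u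
    by (simp_all only: plug_append Us[OF that] Vs[OF that] Us Vs)
  \<comment> \<open>Types met on a closed walk at \<open>?l\<close> lie between two members of the
    component, hence belong to it.\<close>
  have inC: "tyof (plug (take r Ws) u) \<in> scc k" if "tyof u = ?l" "tyof (plug Ws u) = ?l" for r Ws u
  proof -
    have "reach ?l (tyof (plug (take r Ws) u))" using reach_plug[of u "take r Ws"] that by simp
    moreover have "plug Ws u = plug (drop r Ws) (plug (take r Ws) u)" by (metis append_take_drop_id plug_append)
    then have "reach (tyof (plug (take r Ws) u)) ?l" using reach_plug[of "plug (take r Ws) u" "drop r Ws"] that by simp
    ultimately show ?thesis by (rule scc_between[OF t t])
  qed
  have disj: "plug ?X ` T ?l \<inter> plug ?Y ` T ?l = {}"
  proof (rule ccontr)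
    assume "plug ?X ` T ?l \<inter> plug ?Y ` T ?l \<noteq> {}"
    then obtain A B where AB: "tyof A = ?l" "tyof B = ?l" "plug ?X A = plug ?Y B" by (auto simp: T_def)
    have "length ?X = length ?Y" by simp
    then have "?X = ?Y" using plug_eqD[OF th _ inC inC AB(3)] AB X Y by blast
    then show False using neq by simp
  qed
  define s where "s = side ?X"
  have sY: "side ?Y = s" by (simp add: s_def side_def)
  have "2 * cnt nodes (T ?l) n \<le> cnt nodes (T ?l) (n + s)" for n
  proof -
    let ?S = "{u \<in> T ?l. nodes u = n}"
    have "card (plug ?X ` ?S \<union> plug ?Y ` ?S) = card (plug ?X ` ?S) + card (plug ?Y ` ?S)"
      using disj by (intro card_Un_disjoint) auto
    also have "\<dots> = 2 * card ?S"
      by (subst card_image, simp add: inj_on_def plug_inj del: plug.simps append_Cons)+ simp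
    finally have "2 * card ?S = card (plug ?X ` ?S \<union> plug ?Y ` ?S)" by simp
    also have "\<dots> \<le> card {u \<in> T ?l. nodes u = n + s}"
    proof (rule card_mono)
      have "plug ?X u \<in> {u \<in> T ?l. nodes u = n + s}" "plug ?Y u \<in> {u \<in> T ?l. nodes u = n + s}" if "u \<in> ?S" for u
        using X Y that sY unfolding T_def by (simp_all only: mem_Collect_eq nodes_plug s_def)
      then show "plug ?X ` ?S \<union> plug ?Y ` ?S \<subseteq> {u \<in> T ?l. nodes u = n + s}" by blast
    qed simp
    finally have "real (2 * card ?S) \<le> real (card {u \<in> T ?l. nodes u = n + s})" by (simp only: of_nat_le_iff)
    then show ?thesis by (simp add: cnt_def)
  qed
  moreover have "t \<in> T ?l" by (simp add: T_def)
  ultimately show False using not_thin_doubling[of "T ?l" s t] thl by blast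
qed

section \<open>Shifts and geometric series\<close>

definition shift :: "nat \<Rightarrow> (nat \<Rightarrow> real) \<Rightarrow> nat \<Rightarrow> real" where
  "shift s a n = (if n < s then 0 else a (n - s))"

lemma smooth_shift: assumes "smooth a" shows "smooth (shift s a)"
proof -
  have "shift s a n = conv (\<lambda>m. if m = s then 1 else 0) a n" for n
  proof -
    have "conv (\<lambda>m. if m = s then 1 else 0) a n = (\<Sum>k\<le>n. if k = s then a (n - k) else 0)"
      unfolding conv_def by (intro sum.cong) auto
    then show ?thesis by (simp add: shift_def)
  qed
  then have "shift s a = conv (\<lambda>m. if m = s then 1 else 0) a" by blast
  moreover have "smooth (\<lambda>m. if m = s then 1 else (0 :: real))"
    by (rule smooth_eventually_zero[of _ "Suc s"]) auto
  ultimately show ?thesis using smooth_conv assms by simp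
qed

lemma shift_shift: "shift s (shift r a) = shift (s + r) a"
  by (auto simp: shift_def fun_eq_iff)

lemma shift_add: "shift s (\<lambda>n. a n + b n) = (\<lambda>n. shift s a n + shift s b n)"
  by (auto simp: shift_def fun_eq_iff)

text \<open>In generating functions the solution is \<open>d / (1 - x ^ P)\<close>: a convolution
  with the indicator of the multiples of \<open>P\<close>.\<close>

lemma smooth_fixpoint:
  assumes d: "smooth d" and P: "P > 0" and a: "\<And>n. a n = d n + shift P a n"
  shows "smooth a"
proof -
  let ?i = "\<lambda>n. if P dvd n then 1 else (0 :: real)"
  have "a n = conv d ?i n" for n
  proof (induction n rule: less_induct)
    case (less n)
    show ?case
    proof (cases "n < P")
      case True
      have "d k * ?i (n - k) = 0" if "k \<in> {..n} - {n}" for k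
      proof -
        have "\<not> P dvd n - k" using that True by (intro nat_dvd_not_less) auto
        then show ?thesis by simp
      qed
      then have "conv d ?i n = (\<Sum>k\<in>{n}. d k * ?i (n - k))"
        unfolding conv_def by (intro sum.mono_neutral_right) auto
      then show ?thesis using a[of n] True by (simp add: shift_def)
    next
      case False
      have "d k * ?i (n - k) = 0" if "k \<in> {..n} - ({..n - P} \<union> {n})" for k
      proof -
        have "\<not> P dvd n - k" using that False by (intro nat_dvd_not_less) auto
        then show ?thesis by simp
      qed
      then have "conv d ?i n = (\<Sum>k\<in>{..n - P} \<union> {n}. d k * ?i (n - k))"
        unfolding conv_def by (intro sum.mono_neutral_right) auto
      also have "\<dots> = (\<Sum>k\<le>n - P. d k * ?i (n - k)) + d n"
        using P False by (subst sum.union_disjoint) auto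
      also have "(\<Sum>k\<le>n - P. d k * ?i (n - k)) = (\<Sum>k\<le>n - P. d k * ?i (n - P - k))"
      proof (rule sum.cong[OF refl])
        fix k assume "k \<in> {..n - P}"
        then have "n - k = (n - P - k) + P" using False by simp
        then show "d k * ?i (n - k) = d k * ?i (n - P - k)" by simp
      qed
      also have "\<dots> = a (n - P)" using less[of "n - P"] P False by (simp add: conv_def)
      finally show ?thesis using a[of n] False by (simp add: shift_def)
    qed
  qed
  then have "a = conv d ?i" by blast
  moreover have "smooth ?i" by (rule smooth_periodic[OF _ P, of _ 0]) auto
  ultimately show ?thesis using smooth_conv d by simp
qed

section \<open>Forests with prescribed capped type counts\<close>

definition profile :: "nat set \<Rightarrow> (nat \<Rightarrow> nat) \<Rightarrow> utree multiset set" where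
  "profile L v = {M \<in> msets {t. tyof t \<in> L}. \<forall>l\<in>L. min K (count (image_mset tyof M) l) = v l}"

lemma count_msets_T: "M \<in> msets (T l) \<Longrightarrow> count (image_mset tyof M) a = (if a = l then size M else 0)"
  by (induction M) (auto simp: T_def)

text \<open>A value below the threshold fixes the size exactly, the threshold itself bounds it only
  from below, and larger values are impossible.\<close>

lemma smooth_profile_single:
  assumes "smooth (cnt nodes (T l))"
  shows "smooth (cnt (wt nodes) {M \<in> msets (T l). min K (size M) = k})"
proof -
  consider "k < K" | "k = K" | "k > K" by linarith
  then show ?thesis
  proof cases
    case 1
    then have "{M \<in> msets (T l). min K (size M) = k} = {M \<in> msets (T l). size M = k}" by auto
    then show ?thesis using smooth_msets_size[OF graded_trees assms] by simp
  next
    case 2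
    then have "{M \<in> msets (T l). min K (size M) = k} = {M \<in> msets (T l). k \<le> size M}" by auto
    then show ?thesis using smooth_msets_size_ge[OF graded_trees assms] by simp
  next
    case 3
    then have "{M \<in> msets (T l). min K (size M) = k} = {}" by auto
    moreover have "cnt (wt nodes) {} = (\<lambda>n. 0)" by (simp add: cnt_def fun_eq_iff)
    ultimately show ?thesis using smooth_zero by (simp only:)
  qed
qed

text \<open>Trees of different types are chosen independently, so the class is a product over
  \<open>L\<close>, built up one type at a time.\<close>

lemma smooth_profile:
  assumes "finite L" "\<And>l. l \<in> L \<Longrightarrow> smooth (cnt nodes (T l))"
  shows "smooth (cnt (wt nodes) (profile L v))"
  using assms
proof (induction L rule: finite_induct)
  case empty
  have "profile {} v = {{#}}" by (auto simp: profile_def msets_def)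
  then have "cnt (wt nodes) (profile {} v) n = 0" if "n \<ge> 1" for n using that by (simp add: cnt_def)
  then show ?case by (intro smooth_eventually_zero[of _ 1]) auto
next
  case (insert l L)
  let ?A = "{M \<in> msets (T l). min K (size M) = v l}" and ?B = "profile L v"
  have cA: "count (image_mset tyof M) a = (if a = l then size M else 0)" if "M \<in> ?A" for M a
    using that count_msets_T[of M l a] by simp
  have cB: "count (image_mset tyof N) l = 0" if "N \<in> ?B" for N
  proof -
    have "l \<notin># image_mset tyof N" using that insert(2) by (auto simp: profile_def msets_def)
    then show ?thesis by (simp only: not_in_iff)
  qed
  have f1: "filter_mset (\<lambda>t. tyof t = l) (M + N) = M" if "M \<in> ?A" "N \<in> ?B" for M N
  proof -
    have "filter_mset (\<lambda>t. tyof t = l) M = M"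
      using that by (auto simp: msets_def T_def filter_mset_eq_conv)
    moreover have "filter_mset (\<lambda>t. tyof t = l) N = {#}"
      using that insert(2) by (auto simp: msets_def profile_def filter_mset_eq_conv)
    ultimately show ?thesis by simp
  qed
  have "cnt (wt nodes) (profile (insert l L) v) n = conv (cnt (wt nodes) ?A) (cnt (wt nodes) ?B) n" for n
  proof (rule cnt_conv[where \<phi> = "\<lambda>(M, N). M + N"])
    show "inj_on (\<lambda>(M, N). M + N) (?A \<times> ?B)"
    proof (rule inj_onI)
      fix p q assume "p \<in> ?A \<times> ?B" "q \<in> ?A \<times> ?B" and eq: "(\<lambda>(M, N). M + N) p = (\<lambda>(M, N). M + N) q"
      then obtain M N M' N' where pq: "p = (M, N)" "q = (M', N')"
        and M: "M \<in> ?A" "N \<in> ?B" "M' \<in> ?A" "N' \<in> ?B" by blast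
      have sums: "M + N = M' + N'" using eq pq by simp
      have "M = M'" using f1[OF M(1,2)] f1[OF M(3,4)] unfolding sums by (rule trans[OF sym])
      then show "p = q" using sums pq by simp
    qed
    show "(\<lambda>(M, N). M + N) ` (?A \<times> ?B) = profile (insert l L) v"
    proof
      show "(\<lambda>(M, N). M + N) ` (?A \<times> ?B) \<subseteq> profile (insert l L) v"
      proof
        fix z assume "z \<in> (\<lambda>(M, N). M + N) ` (?A \<times> ?B)"
        then obtain p where p: "z = (\<lambda>(M, N). M + N) p" "p \<in> ?A \<times> ?B" by (rule imageE)
        obtain M N where "p = (M, N)" by (cases p)
        then have M: "M \<in> ?A" "N \<in> ?B" "z = M + N" using p by simp_all
        have "M + N \<in> msets {t. tyof t \<in> insert l L}"
          using M by (auto simp: msets_def T_def profile_def)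
        moreover have "min K (count (image_mset tyof (M + N)) a) = v a" if "a \<in> insert l L" for a
        proof (cases "a = l")
          case True
          then show ?thesis using cA[OF M(1)] cB[OF M(2)] M(1) by simp
        next
          case False
          then have "a \<in> L" using that by simp
          then show ?thesis using cA[OF M(1), of a] M(2) False by (simp add: profile_def)
        qed
        ultimately show "z \<in> profile (insert l L) v" by (simp add: profile_def M(3))
      qed
      show "profile (insert l L) v \<subseteq> (\<lambda>(M, N). M + N) ` (?A \<times> ?B)"
      proof
        fix M assume M: "M \<in> profile (insert l L) v"
        define M1 where "M1 = filter_mset (\<lambda>t. tyof t = l) M"
        define M2 where "M2 = filter_mset (\<lambda>t. \<not> tyof t = l) M"
        have part: "M = M1 + M2" unfolding M1_def M2_def by (rule multiset_partition)
        have M1T: "M1 \<in> msets (T l)" by (auto simp: msets_def T_def M1_def)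
        have cnt_sum: "count (image_mset tyof M) a = count (image_mset tyof M1) a + count (image_mset tyof M2) a" for a
          by (simp add: part)
        have "l \<notin># image_mset tyof M2" by (auto simp: M2_def)
        then have "count (image_mset tyof M2) l = 0" by (simp only: not_in_iff)
        then have "count (image_mset tyof M) l = size M1"
          by (simp add: cnt_sum count_msets_T[OF M1T])
        then have m1: "M1 \<in> ?A" using M M1T by (simp add: profile_def)
        have "count (image_mset tyof M2) a = count (image_mset tyof M) a" if "a \<in> L" for a
        proof -
          have "a \<noteq> l" using that insert(2) by auto
          then show ?thesis by (simp add: cnt_sum count_msets_T[OF M1T])
        qed
        moreover have "M2 \<in> msets {t. tyof t \<in> L}" using M by (auto simp: profile_def msets_def M2_def)
        ultimately have m2: "M2 \<in> ?B" using M by (simp add: profile_def)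
        show "M \<in> (\<lambda>(M, N). M + N) ` (?A \<times> ?B)"
          by (rule image_eqI[of _ _ "(M1, M2)"]) (use m1 m2 part in simp_all)
      qed
    qed
  qed ((rule finite_forests_in)+ | simp)+
  then have "cnt (wt nodes) (profile (insert l L) v) = conv (cnt (wt nodes) ?A) (cnt (wt nodes) ?B)" by blast
  moreover have "smooth (cnt (wt nodes) ?A)" using insert.prems by (intro smooth_profile_single) simp
  moreover have "smooth (cnt (wt nodes) ?B)" using insert by simp
  ultimately show ?case using smooth_conv by simp
qed

definition base :: "nat set \<Rightarrow> nat \<Rightarrow> utree set" where
  "base L k = {Node M |M. tyof (Node M) = k \<and> (\<forall>u\<in>#M. tyof u \<in> L)}"

text \<open>Capped counts of the children determine the type of the parent, so finitely many
  disjoint profiles make up the class.\<close>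

lemma smooth_base:
  assumes fin: "finite L" and sm: "\<And>l. l \<in> L \<Longrightarrow> smooth (cnt nodes (T l))"
  shows "smooth (cnt nodes (base L k))"
proof -
  \<comment> \<open>\<open>PiE\<close> fixes the functions outside \<open>L\<close>, so different
    elements of \<open>V\<close> differ on \<open>L\<close> and have disjoint profiles.\<close>
  define V where "V = {v \<in> PiE L (\<lambda>_. {..K}). \<exists>M\<in>profile L v. tyof (Node M) = k}"
  have same: "tyof (Node M) = tyof (Node N)" if "M \<in> profile L v" "N \<in> profile L v" for M N v
  proof (rule tyof_Node)
    fix a
    show "min K (count (image_mset tyof M) a) = min K (count (image_mset tyof N) a)"
    proof (cases "a \<in> L")
      case True
      then show ?thesis using that by (simp add: profile_def)
    next
      case False
      then have "a \<notin># image_mset tyof M" "a \<notin># image_mset tyof N" using that by (auto simp: profile_def msets_def)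
      then show ?thesis by (simp only: not_in_iff)
    qed
  qed
  define F where "F = {M. tyof (Node M) = k \<and> (\<forall>u\<in>#M. tyof u \<in> L)}"
  have F: "F = (\<Union>v\<in>V. profile L v)"
  proof
    show "F \<subseteq> (\<Union>v\<in>V. profile L v)"
    proof
      fix M assume M: "M \<in> F"
      let ?v = "restrict (\<lambda>l. min K (count (image_mset tyof M) l)) L"
      have "M \<in> profile L ?v" using M by (auto simp: profile_def msets_def F_def)
      moreover have "?v \<in> PiE L (\<lambda>_. {..K})" by auto
      ultimately have "?v \<in> V" "M \<in> profile L ?v" using M by (auto simp: V_def F_def)
      then show "M \<in> (\<Union>v\<in>V. profile L v)" by blast
    qed
    show "(\<Union>v\<in>V. profile L v) \<subseteq> F"
    proof
      fix M assume "M \<in> (\<Union>v\<in>V. profile L v)"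
      then obtain v N where v: "M \<in> profile L v" "N \<in> profile L v" "tyof (Node N) = k" by (auto simp: V_def)
      then show "M \<in> F" using same[OF v(1,2)] by (auto simp: F_def profile_def msets_def)
    qed
  qed
  have "finite (PiE L (\<lambda>_. {..K}))" using fin by (intro finite_PiE) auto
  then have finV: "finite V" by (simp add: V_def)
  have disj: "profile L v \<inter> profile L v' = {}" if "v \<in> V" "v' \<in> V" "v \<noteq> v'" for v v'
  proof (rule ccontr)
    assume "profile L v \<inter> profile L v' \<noteq> {}"
    then obtain M where "M \<in> profile L v" "M \<in> profile L v'" by blast
    then have "\<And>l. l \<in> L \<Longrightarrow> v l = v' l" by (auto simp: profile_def)
    then have "v = v'" using that by (intro PiE_ext[of v L "\<lambda>_. {..K}"]) (auto simp: V_def)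
    then show False using that by simp
  qed
  have "cnt (wt nodes) F n = (\<Sum>v\<in>V. cnt (wt nodes) (profile L v) n)" for n
    unfolding F using finV disj by (intro cnt_disjoint_UN) auto
  then have "cnt (wt nodes) F = (\<lambda>n. \<Sum>v\<in>V. cnt (wt nodes) (profile L v) n)" by blast
  then have smF: "smooth (cnt (wt nodes) F)"
    using smooth_sum[OF finV, of "\<lambda>v. cnt (wt nodes) (profile L v)"] smooth_profile[OF fin sm] by simp
  \<comment> \<open>The shift by \<open>1\<close> is the root.\<close>
  have "cnt nodes (base L k) n = shift 1 (cnt (wt nodes) F) n" for n
  proof (cases n)
    case 0
    have "{t \<in> base L k. nodes t = 0} = {}" by auto
    then have "cnt nodes (base L k) 0 = 0" by (simp only: cnt_def card.empty of_nat_0)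
    then show ?thesis using 0 by (simp add: shift_def)
  next
    case (Suc m)
    have "{t \<in> base L k. nodes t = n} = Node ` {M \<in> F. wt nodes M = m}"
      by (auto simp: base_def F_def Suc)
    then have "card {t \<in> base L k. nodes t = n} = card {M \<in> F. wt nodes M = m}"
      by (simp add: card_image inj_on_def)
    then show ?thesis by (simp add: cnt_def shift_def Suc)
  qed
  then have "cnt nodes (base L k) = shift 1 (cnt (wt nodes) F)" by blast
  then show ?thesis using smooth_shift[OF smF] by simp
qed

section \<open>Induction along the dependency graph\<close>

lemma child_in_range: "child i j \<Longrightarrow> i \<in> range tyof"
  by (auto simp: child_def)

lemma finite_reach: "finite {i. reach i k}"
proof -
  have "{i. reach i k} \<subseteq> insert k (range tyof)"
    using child_in_range by (auto elim: converse_rtranclpE)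
  then show ?thesis using finite_tyof finite_subset by blast
qed

definition lower :: "nat \<Rightarrow> nat set" where "lower k = {i. reach i k} - scc k"

lemma finite_lower: "finite (lower k)" by (simp add: lower_def finite_reach)

lemma child_scc_or_lower:
  assumes "k \<in> scc k0" "child i k" shows "i \<in> scc k0 \<or> i \<in> lower k0"
  using converse_rtranclp_into_rtranclp[OF assms(2) sccD(1)[OF assms(1)]] by (simp add: lower_def)

lemma child_mem: "u \<in># M \<Longrightarrow> child (tyof u) (tyof (Node M))"
  by (auto simp: child_def dest!: multi_member_split)

lemma scc_self [simp]: "k \<in> scc k" by (simp add: scc_def)

text \<open>A child type in the component of \<open>k\<close> would close a cycle through
  \<open>k\<close>.\<close>

lemma T_trivial_scc:
  assumes "\<not> child\<^sup>+\<^sup>+ k k" shows "T k = base (lower k) k"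
proof
  show "T k \<subseteq> base (lower k) k"
  proof
    fix t assume t: "t \<in> T k"
    obtain M where M: "t = Node M" by (cases t)
    have "tyof u \<in> lower k" if "u \<in># M" for u
    proof -
      have c: "child (tyof u) k" using child_mem[OF that] t M by (simp add: T_def)
      have "tyof u \<notin> scc k"
      proof
        assume "tyof u \<in> scc k"
        then have "child\<^sup>+\<^sup>+ k k" using c by (meson sccD(2) rtranclp_into_tranclp1)
        then show False using assms by simp
      qed
      then show ?thesis using child_scc_or_lower[OF scc_self c] by simp
    qed
    then show "t \<in> base (lower k) k" using t M by (auto simp: base_def T_def)
  qed
qed (auto simp: base_def T_def)

text \<open>By uniqueness of the side forests the types of the component form a single cycle, and going around it
  once writes the sequence as a smooth one plus a shift of itself.\<close>

lemma smooth_cyclic_scc: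
  assumes th: "thin (T k0)" and cyc: "child\<^sup>+\<^sup>+ k0 k0"
    and IH: "\<And>l. l \<in> lower k0 \<Longrightarrow> smooth (cnt nodes (T l))"
  shows "smooth (cnt nodes (T k0))"
proof -
  let ?C = "scc k0" and ?L = "lower k0"
  have finC: "finite ?C" using finite_reach[of k0] by (rule rev_finite_subset) (auto simp: scc_def)
  have cycC: "child\<^sup>+\<^sup>+ k k" if "k \<in> ?C" for k
  proof -
    have "child\<^sup>+\<^sup>+ k k0" using sccD(1)[OF that] cyc by (rule rtranclp_tranclp_tranclp)
    then show ?thesis using sccD(2)[OF that] by (rule tranclp_rtranclp_tranclp)
  qed
  \<comment> \<open>Every type of the component has one successor in it, reached through one side
    forest; \<open>\<sigma>\<close> and \<open>\<gamma>\<close> will name them.\<close>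
  have "\<exists>l G. \<forall>t H. tyof t = k \<longrightarrow> l \<in> ?C \<and> tyof (Node (add_mset t G)) = l \<and>
      (tyof (Node (add_mset t H)) \<in> ?C \<longrightarrow> H = G)" if k: "k \<in> ?C" for k
  proof -
    obtain l where l: "child k l" "reach l k" using cycC[OF k] by (auto dest: tranclpD)
    have lC: "l \<in> ?C" using scc_between[OF k k _ l(2)] l(1) by blast
    obtain G u where G: "tyof u = k" "tyof (Node (add_mset u G)) = l" using l(1) by (auto simp: child_def)
    have "tyof (Node (add_mset t G)) = l" if "tyof t = k" for t using tyof_ctx[of t u G] that G by simp
    moreover from this have "H = G" if "tyof t = k" "tyof (Node (add_mset t H)) \<in> ?C" for t H
      using scc_side_unique[OF th, of t H G] that k lC by simp
    ultimately show ?thesis using lC by blast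
  qed
  then obtain \<sigma> \<gamma> where sg: "\<And>k t H. k \<in> ?C \<Longrightarrow> tyof t = k \<Longrightarrow> \<sigma> k \<in> ?C \<and> tyof (Node (add_mset t (\<gamma> k))) = \<sigma> k \<and>
      (tyof (Node (add_mset t H)) \<in> ?C \<longrightarrow> H = \<gamma> k)" by metis
  have occurs: "\<exists>t. tyof t = k" if "k \<in> ?C" for k
    using cycC[OF that] child_in_range by (auto dest!: tranclpD)
  have sC: "\<sigma> k \<in> ?C" if "k \<in> ?C" for k using sg that occurs by blast
  have next_eq: "\<sigma> k = l" if "k \<in> ?C" "l \<in> ?C" "child k l" for k l
  proof -
    obtain H t where "tyof t = k" "tyof (Node (add_mset t H)) = l" using \<open>child k l\<close> by (auto simp: child_def)
    then show ?thesis using sg[OF that(1), of t H] that by auto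
  qed
  have "?C \<subseteq> \<sigma> ` ?C"
  proof
    fix k assume k: "k \<in> ?C"
    from cycC[OF k] have "\<exists>l. reach k l \<and> child l k"
      by (cases rule: tranclp.cases) (auto dest: tranclp_into_rtranclp)
    then obtain l where l: "reach k l" "child l k" by blast
    have "l \<in> ?C" using scc_between[OF k k l(1)] l(2) by blast
    then show "k \<in> \<sigma> ` ?C" using next_eq[OF _ k l(2)] by blast
  qed
  \<comment> \<open>Every type on a cycle has a predecessor in the component, so
    \<open>\<sigma>\<close> maps the finite component onto itself and is injective.\<close>
  then have injS: "inj_on \<sigma> ?C"
  proof -
    have "\<sigma> ` ?C = ?C" using \<open>?C \<subseteq> \<sigma> ` ?C\<close> sC by blast
    then show ?thesis using finC by (intro eq_card_imp_inj_on) simp_all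
  qed
  \<comment> \<open>A tree of type \<open>\<sigma> k\<close> has either no child in the component,
    and is then in \<open>base\<close>, or exactly one, of type \<open>k\<close> and with siblings
    \<open>\<gamma> k\<close>.\<close>
  have split: "cnt nodes (T (\<sigma> k)) n = cnt nodes (base ?L (\<sigma> k)) n + shift (Suc (wt nodes (\<gamma> k))) (cnt nodes (T k)) n"
    if k: "k \<in> ?C" for k n
  proof -
    let ?up = "\<lambda>t. Node (add_mset t (\<gamma> k))" and ?w = "Suc (wt nodes (\<gamma> k))"
    have Teq: "T (\<sigma> k) = base ?L (\<sigma> k) \<union> ?up ` T k"
    proof
      show "T (\<sigma> k) \<subseteq> base ?L (\<sigma> k) \<union> ?up ` T k"
      proof
        fix t assume t: "t \<in> T (\<sigma> k)"
        obtain M where M: "t = Node M" by (cases t)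
        show "t \<in> base ?L (\<sigma> k) \<union> ?up ` T k"
        proof (cases "\<exists>u\<in>#M. tyof u \<in> ?C")
          case True
          then obtain u H where u: "M = add_mset u H" "tyof u \<in> ?C" by (metis multi_member_split)
          have tt: "tyof (Node (add_mset u H)) = \<sigma> k" using t M u by (simp add: T_def)
          then have "H = \<gamma> (tyof u)" "\<sigma> (tyof u) = \<sigma> k"
            using sg[OF u(2) refl, of H] tt sC[OF k] by auto
          then have "tyof u = k" using injS u(2) k by (meson inj_onD)
          then have "t = ?up u" "u \<in> T k" using M u \<open>H = _\<close> by (auto simp: T_def)
          then show ?thesis by blast
        next
          case False
          have "tyof u \<in> ?L" if "u \<in># M" for u
            using child_scc_or_lower[OF sC[OF k], of "tyof u"] child_mem[OF that] t M False that by (auto simp: T_def)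
          then show ?thesis using t M by (auto simp: base_def T_def)
        qed
      qed
      show "base ?L (\<sigma> k) \<union> ?up ` T k \<subseteq> T (\<sigma> k)" using sg[OF k] by (auto simp: base_def T_def)
    qed
    have "base ?L (\<sigma> k) \<inter> ?up ` T k = {}"
    proof (rule ccontr)
      assume "base ?L (\<sigma> k) \<inter> ?up ` T k \<noteq> {}"
      then obtain u where "u \<in> T k" "?up u \<in> base ?L (\<sigma> k)" by blast
      then show False using k by (auto simp: base_def T_def lower_def)
    qed
    then have disj: "{t \<in> base ?L (\<sigma> k). nodes t = n} \<inter> {t \<in> ?up ` T k. nodes t = n} = {}" by blast
    have "{t \<in> T (\<sigma> k). nodes t = n} = {t \<in> base ?L (\<sigma> k). nodes t = n} \<union> {t \<in> ?up ` T k. nodes t = n}"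
      unfolding Teq by blast
    then have "card {t \<in> T (\<sigma> k). nodes t = n} = card {t \<in> base ?L (\<sigma> k). nodes t = n} + card {t \<in> ?up ` T k. nodes t = n}"
      using disj by (simp add: card_Un_disjoint)
    moreover have "real (card {t \<in> ?up ` T k. nodes t = n}) = shift ?w (cnt nodes (T k)) n"
    proof (cases "n < ?w")
      case True
      then have "{t \<in> ?up ` T k. nodes t = n} = {}" by auto
      then show ?thesis using True by (simp only: shift_def card.empty if_True of_nat_0)
    next
      case False
      then have "{t \<in> ?up ` T k. nodes t = n} = ?up ` {t \<in> T k. nodes t = n - ?w}" by auto
      then have "card {t \<in> ?up ` T k. nodes t = n} = card {t \<in> T k. nodes t = n - ?w}"
        by (simp add: card_image inj_on_def)
      then show ?thesis using False by (simp add: shift_def cnt_def)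
    qed
    ultimately show ?thesis by (simp add: cnt_def)
  qed
  \<comment> \<open>\<open>W \<ge> p\<close> ensures a positive shift after a full round, as the
    fixed-point equation requires.\<close>
  have iter: "\<exists>d W. smooth d \<and> W \<ge> p \<and> (\<forall>n. cnt nodes (T ((\<sigma> ^^ p) k0)) n = d n + shift W (cnt nodes (T k0)) n) \<and> (\<sigma> ^^ p) k0 \<in> ?C" for p
  proof (induction p)
    case 0
    show ?case by (intro exI[of _ "\<lambda>n. 0"] exI[of _ 0]) (auto simp: smooth_zero shift_def)
  next
    case (Suc p)
    then obtain d W where d: "smooth d" "W \<ge> p" "\<And>n. cnt nodes (T ((\<sigma> ^^ p) k0)) n = d n + shift W (cnt nodes (T k0)) n"
      "(\<sigma> ^^ p) k0 \<in> ?C" by blast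
    let ?k = "(\<sigma> ^^ p) k0"
    let ?w = "Suc (wt nodes (\<gamma> ?k))"
    let ?d = "\<lambda>n. cnt nodes (base ?L (\<sigma> ?k)) n + shift ?w d n"
    have "cnt nodes (T ?k) = (\<lambda>n. d n + shift W (cnt nodes (T k0)) n)" using d(3) by blast
    then have "cnt nodes (T (\<sigma> ?k)) n = ?d n + shift (?w + W) (cnt nodes (T k0)) n" for n
      using split[OF d(4), of n] by (simp add: shift_add shift_shift)
    moreover have "smooth ?d"
      using smooth_base[OF finite_lower IH] d(1) by (intro smooth_add smooth_shift) auto
    ultimately show ?case using d(2) sC[OF d(4)] by (intro exI[of _ ?d] exI[of _ "?w + W"]) auto
  qed
  \<comment> \<open>Within the component every walk follows \<open>\<sigma>\<close>, so a closed
    walk makes \<open>k0\<close> periodic.\<close>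
  have "\<exists>p>0. (\<sigma> ^^ p) k0 = k0"
  proof -
    have "child\<^sup>+\<^sup>+ k0 l \<Longrightarrow> reach l k0 \<Longrightarrow> \<exists>p>0. (\<sigma> ^^ p) k0 = l" for l
    proof (induction rule: tranclp_induct)
      case (base l)
      then have "l \<in> ?C" by (auto simp: scc_def)
      then show ?case using next_eq[OF scc_self _ base(1)] by (intro exI[of _ 1]) simp
    next
      case (step l m)
      have rl: "reach l k0" using step.hyps(2) step.prems by (rule converse_rtranclp_into_rtranclp)
      have "l \<in> ?C" using rl step.hyps(1) by (auto simp: scc_def dest: tranclp_into_rtranclp)
      moreover have "m \<in> ?C" using step.prems step.hyps by (auto simp: scc_def dest: tranclp_into_rtranclp)
      ultimately have "\<sigma> l = m" using next_eq step.hyps(2) by blast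
      moreover obtain p where "p > 0" "(\<sigma> ^^ p) k0 = l" using step.IH[OF rl] by blast
      ultimately show ?case by (intro exI[of _ "Suc p"]) simp
    qed
    then show ?thesis using cyc by blast
  qed
  then obtain p where p: "p > 0" "(\<sigma> ^^ p) k0 = k0" by blast
  obtain d W where d: "smooth d" "W \<ge> p" and
    "\<forall>n. cnt nodes (T ((\<sigma> ^^ p) k0)) n = d n + shift W (cnt nodes (T k0)) n"
    using iter[of p] by blast
  then have "cnt nodes (T k0) n = d n + shift W (cnt nodes (T k0)) n" for n
    unfolding p(2) by blast
  then show ?thesis using d(2) p(1) by (intro smooth_fixpoint[OF d(1)]) simp_all
qed

text \<open>Passing from \<open>k\<close> to a type in \<open>lower k\<close> strictly shrinks the
  set of types that reach it, because \<open>k\<close> itself drops out.\<close>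

theorem thin_smooth:
  assumes "thin (T k)" shows "smooth (cnt nodes (T k))"
  using assms
proof (induction "card {i. reach i k}" arbitrary: k rule: less_induct)
  case less
  have IH: "smooth (cnt nodes (T l))" if l: "l \<in> lower k" for l
  proof (rule less.hyps)
    have "reach l k" using l by (simp add: lower_def)
    then show "thin (T l)" using thin_reach[OF less.prems] by blast
    have "k \<notin> {i. reach i l}" using l by (auto simp: lower_def scc_def)
    moreover have "{i. reach i l} \<subseteq> {i. reach i k}" using \<open>reach l k\<close> by (auto intro: rtranclp_trans)
    ultimately have "{i. reach i l} \<subset> {i. reach i k}" by blast
    then show "card {i. reach i l} < card {i. reach i k}" using finite_reach by (rule psubset_card_mono[rotated])
  qed
  show ?case
  proof (cases "child\<^sup>+\<^sup>+ k k")
    case True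
    then show ?thesis using smooth_cyclic_scc[OF less.prems] IH by blast
  next
    case False
    then show ?thesis using T_trivial_scc smooth_base[OF finite_lower IH] by simp
  qed
qed

corollary thin_smooth_union:
  assumes "thin {t. tyof t \<in> A}" shows "smooth (cnt nodes {t. tyof t \<in> A})"
proof -
  let ?A = "A \<inter> range tyof"
  have "{t. tyof t \<in> A} = (\<Union>i\<in>?A. T i)" by (auto simp: T_def)
  then have "cnt nodes {t. tyof t \<in> A} n = (\<Sum>i\<in>?A. cnt nodes (T i) n)" for n
    by (simp only:) (rule cnt_disjoint_UN; use finite_tyof in \<open>auto simp: T_def\<close>)
  then have "cnt nodes {t. tyof t \<in> A} = (\<lambda>n. \<Sum>i\<in>?A. cnt nodes (T i) n)" by blast
  moreover have "smooth (cnt nodes (T i))" if "i \<in> ?A" for i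
    by (rule thin_smooth, rule thin_subset[OF assms]) (use that in \<open>auto simp: T_def\<close>)
  ultimately show ?thesis using smooth_sum[of ?A "\<lambda>i. cnt nodes (T i)"] finite_tyof by simp
qed

end

section \<open>The multiset of trees of a forest\<close>

text \<open>Forests that may be empty, as the part below a leaf is.\<close>

definition forest0 :: "'a struct \<Rightarrow> bool" where
  "forest0 S \<longleftrightarrow> finite (universe S) \<and> less_rel S \<subseteq> universe S \<times> universe S \<and>
     irrefl (less_rel S) \<and> trans (less_rel S) \<and> (\<forall>x\<in>universe S. total_on (upset S x) (less_rel S))"

definition roots :: "'a struct \<Rightarrow> 'a set" where
  "roots S = {m \<in> universe S. \<forall>y. (m, y) \<notin> less_rel S}"

definition below :: "'a struct \<Rightarrow> 'a \<Rightarrow> 'a set" where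
  "below S x = {y \<in> universe S. (y, x) \<in> less_rel S}"

definition dcone :: "'a struct \<Rightarrow> 'a \<Rightarrow> 'a set" where
  "dcone S x = insert x (below S x)"

lemma is_forest_iff: "is_forest S \<longleftrightarrow> forest0 S \<and> universe S \<noteq> {}"
  by (auto simp: is_forest_def forest0_def finite_poset_def)

lemma substruct_simps [simp]: "universe (substruct S B) = B" "less_rel (substruct S B) = less_rel S \<inter> B \<times> B"
  by (simp_all add: substruct_def)

lemma forest0_substruct: "forest0 S \<Longrightarrow> B \<subseteq> universe S \<Longrightarrow> forest0 (substruct S B)"
proof (cases "B = {}")
  case True
  then show ?thesis by (simp add: forest0_def irrefl_def trans_def)
next
  case False
  assume "forest0 S" "B \<subseteq> universe S"
  then show ?thesis using is_forest_substruct[of S B] False by (auto simp: is_forest_iff)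
qed

lemma below_subset: "below S x \<subseteq> universe S" by (auto simp: below_def)

lemma roots_subset: "roots S \<subseteq> universe S" by (auto simp: roots_def)

lemma rootsD: "x \<in> roots S \<Longrightarrow> x \<in> universe S"
  by (simp add: roots_def)

lemma finite_roots: "forest0 S \<Longrightarrow> finite (roots S)"
  by (auto simp: forest0_def roots_def)

lemma card_below:
  assumes "finite (universe S)" "irrefl (less_rel S)" "x \<in> universe S"
  shows "card (below S x) < card (universe S)"
proof (rule psubset_card_mono)
  show "below S x \<subset> universe S" using assms by (auto simp: below_def irrefl_def)
qed (use assms in simp)

text \<open>The guard makes the recursion terminate: in a finite irreflexive structure the part
  strictly below an element is smaller than the whole.\<close>

function shape :: "'a struct \<Rightarrow> utree multiset" where
  "shape S = (if finite (universe S) \<and> irrefl (less_rel S)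
     then \<Sum>x\<in>roots S. {#Node (shape (substruct S (below S x)))#} else {#})"
  by pat_completeness auto
termination
  by (relation "Wellfounded.measure (\<lambda>S. card (universe S))") (auto simp: roots_def intro!: card_below)

declare shape.simps [simp del]

lemma shape_unfold: "forest0 S \<Longrightarrow> shape S = (\<Sum>x\<in>roots S. {#Node (shape (substruct S (below S x)))#})"
  by (subst shape.simps) (auto simp: forest0_def)

lemma root_exists:
  assumes "forest0 S" "y \<in> universe S"
  shows "\<exists>x\<in>roots S. y \<in> dcone S x"
proof -
  have "is_forest S" using assms by (auto simp: is_forest_iff)
  from forest_below_maximal[OF this assms(2)] show ?thesis
    using assms(2) by (auto simp: roots_def dcone_def below_def)
qed

text \<open>Two roots above \<open>y\<close> lie in the chain of elements above \<open>y\<close>,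
  whereas distinct roots are incomparable.\<close>

lemma root_unique:
  assumes "forest0 S" "x \<in> roots S" "x' \<in> roots S" "y \<in> dcone S x" "y \<in> dcone S x'"
  shows "x = x'"
proof (rule ccontr)
  assume neq: "x \<noteq> x'"
  have y: "y \<in> universe S" using assms by (auto simp: dcone_def below_def roots_def)
  then have "total_on (upset S y) (less_rel S)" using assms(1) by (simp add: forest0_def)
  moreover have "x \<in> upset S y" "x' \<in> upset S y"
    using assms by (auto simp: dcone_def below_def roots_def upset_def)
  ultimately have "(x, x') \<in> less_rel S \<or> (x', x) \<in> less_rel S" using neq by (auto simp: total_on_def)
  then show False using assms(2,3) by (auto simp: roots_def)
qed

lemma cone_down:
  assumes "forest0 S" "y \<in> dcone S x" "(z, y) \<in> less_rel S" shows "z \<in> below S x"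
  using assms by (auto simp: dcone_def below_def forest0_def dest: transD)

text \<open>Together with \<open>cone_down\<close>: the cones of the roots are closed under
  comparability, so they are the components.\<close>

lemma cone_up:
  assumes "forest0 S" "x \<in> roots S" "y \<in> dcone S x" "(y, z) \<in> less_rel S" shows "z \<in> dcone S x"
proof -
  have z: "z \<in> universe S" using assms by (auto simp: forest0_def)
  then obtain x' where x': "x' \<in> roots S" "z \<in> dcone S x'" using root_exists[OF assms(1)] by blast
  then have "y \<in> dcone S x'" using cone_down[OF assms(1) x'(2) assms(4)] by (simp add: dcone_def)
  then have "x = x'" using root_unique[OF assms(1,2) x'(1) assms(3)] by blast
  then show ?thesis using x'(2) by blast
qed

lemma universe_cones: "forest0 S \<Longrightarrow> universe S = (\<Union>x\<in>roots S. dcone S x)"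
  using root_exists[of S] by (auto simp: roots_def dcone_def below_def)

lemma cones_disjoint: "forest0 S \<Longrightarrow> x \<in> roots S \<Longrightarrow> x' \<in> roots S \<Longrightarrow> x \<noteq> x' \<Longrightarrow> dcone S x \<inter> dcone S x' = {}"
  using root_unique[of S] by blast

section \<open>Isomorphism as equality of shapes\<close>

definition iso_via :: "('a \<Rightarrow> 'b) \<Rightarrow> 'a struct \<Rightarrow> 'b struct \<Rightarrow> bool" where
  "iso_via h S S' \<longleftrightarrow> bij_betw h (universe S) (universe S') \<and>
     (\<forall>x\<in>universe S. \<forall>y\<in>universe S. (x, y) \<in> less_rel S \<longleftrightarrow> (h x, h y) \<in> less_rel S')"

lemma struct_iso_via: "S \<simeq>\<^sub>s S' \<longleftrightarrow> (\<exists>h. iso_via h S S')"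
  by (simp add: struct_iso_def iso_via_def)

lemma iso_via_substruct:
  assumes "iso_via h S S'" "B \<subseteq> universe S"
  shows "iso_via h (substruct S B) (substruct S' (h ` B))"
proof -
  have "inj_on h B" using assms by (auto simp: iso_via_def bij_betw_def intro: inj_on_subset)
  then show ?thesis using assms by (auto simp: iso_via_def bij_betw_def subset_iff)
qed

lemma iso_via_roots:
  assumes "iso_via h S S'" "less_rel S \<subseteq> universe S \<times> universe S" "less_rel S' \<subseteq> universe S' \<times> universe S'"
  shows "roots S' = h ` roots S"
proof -
  have im: "h ` universe S = universe S'" using assms by (simp add: iso_via_def bij_betw_def)
  have rel: "\<And>x y. x \<in> universe S \<Longrightarrow> y \<in> universe S \<Longrightarrow> (x, y) \<in> less_rel S \<longleftrightarrow> (h x, h y) \<in> less_rel S'"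
    using assms by (simp add: iso_via_def)
  show ?thesis
  proof
    show "roots S' \<subseteq> h ` roots S"
    proof
      fix m assume m: "m \<in> roots S'"
      then obtain x where x: "x \<in> universe S" "m = h x" using im by (auto simp: roots_def)
      have "(x, y) \<notin> less_rel S" for y
        using m rel[OF x(1), of y] x assms(2) by (auto simp: roots_def)
      then show "m \<in> h ` roots S" using x by (auto simp: roots_def)
    qed
    show "h ` roots S \<subseteq> roots S'"
    proof
      fix m assume "m \<in> h ` roots S"
      then obtain x where x: "x \<in> roots S" "m = h x" by blast
      have "(h x, y) \<notin> less_rel S'" for y
      proof
        assume "(h x, y) \<in> less_rel S'"
        moreover from this obtain z where "z \<in> universe S" "y = h z" using assms(3) im by blast
        ultimately show False using rel x by (auto simp: roots_def)
      qed
      then show "m \<in> roots S'" using x im by (auto simp: roots_def)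
    qed
  qed
qed

lemma iso_via_below:
  assumes "iso_via h S S'" "x \<in> universe S"
  shows "below S' (h x) = h ` below S x"
  using assms by (fastforce simp: iso_via_def bij_betw_def below_def)

lemma shape_iso_via:
  "iso_via h S S' \<Longrightarrow> forest0 S \<Longrightarrow> forest0 S' \<Longrightarrow> shape S = shape S'"
proof (induction "card (universe S)" arbitrary: S S' rule: less_induct)
  case less
  have sub: "less_rel S \<subseteq> universe S \<times> universe S" "less_rel S' \<subseteq> universe S' \<times> universe S'"
    using less.prems by (auto simp: forest0_def)
  have R: "roots S' = h ` roots S" by (rule iso_via_roots[OF less.prems(1) sub])
  have inj: "inj_on h (roots S)"
    using less.prems(1) roots_subset[of S] by (auto simp: iso_via_def bij_betw_def intro: inj_on_subset)
  have "shape (substruct S (below S x)) = shape (substruct S' (below S' (h x)))" if x: "x \<in> roots S" for x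
  proof (rule less.hyps)
    have xU: "x \<in> universe S" by (rule rootsD[OF x])
    show "card (universe (substruct S (below S x))) < card (universe S)"
      using card_below[of S x] less.prems(2) xU by (simp add: forest0_def)
    show "iso_via h (substruct S (below S x)) (substruct S' (below S' (h x)))"
      unfolding iso_via_below[OF less.prems(1) xU] by (rule iso_via_substruct[OF less.prems(1) below_subset])
  qed (rule forest0_substruct[OF less.prems(2) below_subset] forest0_substruct[OF less.prems(3) below_subset])+
  then show ?case
    unfolding shape_unfold[OF less.prems(2)] shape_unfold[OF less.prems(3)] R
    by (subst sum.reindex[OF inj]) (intro sum.cong refl, simp only: comp_def)
qed

lemma in_sum_singletons: "finite B \<Longrightarrow> c \<in># (\<Sum>x\<in>B. {#g x#}) \<longleftrightarrow> (\<exists>y\<in>B. c = g y)"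
  by (induction B rule: finite_induct) auto

text \<open>Serves to match the roots of two forests of equal shape so that matched roots carry
  equal subtrees.\<close>

lemma sum_singletons_eq_bij:
  assumes "finite A" "finite B" "(\<Sum>x\<in>A. {#f x#}) = (\<Sum>x\<in>B. {#g x#})"
  shows "\<exists>\<phi>. bij_betw \<phi> A B \<and> (\<forall>x\<in>A. g (\<phi> x) = f x)"
  using assms
proof (induction A arbitrary: B rule: finite_induct)
  case empty
  have "y \<notin> B" for y using in_sum_singletons[OF empty(1), of "g y" g] empty(2) by auto
  then have "B = {}" by blast
  then show ?case by (simp add: bij_betw_def)
next
  case (insert x A)
  have eq: "add_mset (f x) (\<Sum>x\<in>A. {#f x#}) = (\<Sum>x\<in>B. {#g x#})" using insert by simp
  have "f x \<in># (\<Sum>x\<in>B. {#g x#})" unfolding eq[symmetric] by simp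
  then obtain y where y: "y \<in> B" "f x = g y" using in_sum_singletons[OF insert.prems(1), of "f x"] by auto
  have "(\<Sum>x\<in>B. {#g x#}) = add_mset (g y) (\<Sum>x\<in>B - {y}. {#g x#})"
    using insert.prems(1) y(1) by (subst sum.remove[of B y]) auto
  then have "(\<Sum>x\<in>A. {#f x#}) = (\<Sum>x\<in>B - {y}. {#g x#})" using eq y(2) by simp
  then obtain \<phi> where \<phi>: "bij_betw \<phi> A (B - {y})" "\<forall>x\<in>A. g (\<phi> x) = f x"
    using insert.IH[of "B - {y}"] insert.prems(1) by auto
  let ?\<phi> = "\<phi>(x := y)"
  have "bij_betw ?\<phi> A (B - {y})" using \<phi>(1) insert(2) by (subst bij_betw_cong[of _ _ \<phi>]) auto
  moreover have "bij_betw ?\<phi> {x} {y}" by simp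
  ultimately have "bij_betw ?\<phi> (A \<union> {x}) ((B - {y}) \<union> {y})" by (rule bij_betw_combine) simp
  moreover have "A \<union> {x} = insert x A" "(B - {y}) \<union> {y} = B" using y by auto
  moreover have "\<forall>z\<in>insert x A. g (?\<phi> z) = f z" using \<phi>(2) y(2) by auto
  ultimately show ?case by metis
qed

text \<open>Match the roots by shape, take isomorphisms below them by induction on size, and glue:
  elements of different components are incomparable on both sides.\<close>

lemma iso_of_shape:
  "forest0 S \<Longrightarrow> forest0 S' \<Longrightarrow> shape S = shape S' \<Longrightarrow> \<exists>h. iso_via h S S'"
proof (induction "card (universe S)" arbitrary: S S' rule: less_induct)
  case less
  note F = less.prems(1) and F' = less.prems(2)
  have sub: "less_rel S \<subseteq> universe S \<times> universe S" "less_rel S' \<subseteq> universe S' \<times> universe S'"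
    using F F' by (auto simp: forest0_def)
  obtain \<phi> where \<phi>: "bij_betw \<phi> (roots S) (roots S')"
    and \<phi>s: "\<And>x. x \<in> roots S \<Longrightarrow> Node (shape (substruct S' (below S' (\<phi> x)))) = Node (shape (substruct S (below S x)))"
    using sum_singletons_eq_bij[OF finite_roots[OF F] finite_roots[OF F'], of "\<lambda>x. Node (shape (substruct S (below S x)))"
      "\<lambda>x. Node (shape (substruct S' (below S' x)))"] less.prems(3)
    unfolding shape_unfold[OF F] shape_unfold[OF F'] by blast
  have \<phi>R: "\<phi> x \<in> roots S'" if "x \<in> roots S" for x using \<phi> that by (auto simp: bij_betw_def)
  have "\<exists>h. iso_via h (substruct S (below S x)) (substruct S' (below S' (\<phi> x)))" if x: "x \<in> roots S" for x
  proof (rule less.hyps)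
    have "x \<in> universe S" by (rule rootsD[OF x])
    then show "card (universe (substruct S (below S x))) < card (universe S)"
      using card_below[of S x] F by (simp add: forest0_def)
    show "shape (substruct S (below S x)) = shape (substruct S' (below S' (\<phi> x)))" using \<phi>s[OF x] by simp
  qed (rule forest0_substruct[OF F below_subset] forest0_substruct[OF F' below_subset])+
  then have "\<forall>x\<in>roots S. \<exists>h. iso_via h (substruct S (below S x)) (substruct S' (below S' (\<phi> x)))" by (rule ballI)
  from bchoice[OF this] obtain k where "\<forall>x\<in>roots S. iso_via (k x) (substruct S (below S x)) (substruct S' (below S' (\<phi> x)))" ..
  then have k: "\<And>x. x \<in> roots S \<Longrightarrow> iso_via (k x) (substruct S (below S x)) (substruct S' (below S' (\<phi> x)))" by (rule bspec)
  define h where "h = (\<lambda>x y. if y = x then \<phi> x else k x y)"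
  have xb: "x \<notin> below S x" for x using F by (auto simp: forest0_def below_def irrefl_def)
  have xb': "x \<notin> below S' x" for x using F' by (auto simp: forest0_def below_def irrefl_def)
  have kb: "k x ` below S x = below S' (\<phi> x)" "inj_on (k x) (below S x)" if "x \<in> roots S" for x
    using k[OF that] by (auto simp: iso_via_def bij_betw_def)
  have hc: "bij_betw (h x) (dcone S x) (dcone S' (\<phi> x))" if x: "x \<in> roots S" for x
  proof -
    have kx: "h x y = k x y" if "y \<in> below S x" for y using that xb by (auto simp: h_def)
    have "inj_on (h x) (dcone S x)" unfolding dcone_def
    proof (subst inj_on_insert, intro conjI)
      show "inj_on (h x) (below S x)" using kb(2)[OF x] kx by (simp add: inj_on_def)
      show "h x x \<notin> h x ` (below S x - {x})"
      proof
        assume "h x x \<in> h x ` (below S x - {x})"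
        then obtain y where "y \<in> below S x" "\<phi> x = k x y" using kx by (auto simp: h_def)
        then have "\<phi> x \<in> below S' (\<phi> x)" using kb(1)[OF x] by blast
        then show False using xb' by blast
      qed
    qed
    moreover have "h x ` dcone S x = dcone S' (\<phi> x)"
    proof -
      have "h x ` below S x = k x ` below S x" using kx by (rule image_cong[OF refl])
      then show ?thesis unfolding dcone_def image_insert kb(1)[OF x] by (simp add: h_def)
    qed
    ultimately show ?thesis by (simp add: bij_betw_def)
  qed
  have hrel: "(y, z) \<in> less_rel S \<longleftrightarrow> (h x y, h x z) \<in> less_rel S'"
    if x: "x \<in> roots S" and y: "y \<in> dcone S x" and z: "z \<in> dcone S x" for x y z
  proof -
    have \<phi>x: "(\<phi> x, w) \<notin> less_rel S'" for w using \<phi>R[OF x] by (auto simp: roots_def)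
    have xw: "(x, w) \<notin> less_rel S" for w using x by (auto simp: roots_def)
    consider "y = x" | "y \<in> below S x" "z = x" "y \<noteq> x" | "y \<in> below S x" "z \<in> below S x"
      using y z xb[of x] by (auto simp: dcone_def)
    then show ?thesis
    proof cases
      case 1
      then show ?thesis using \<phi>x xw by (simp add: h_def)
    next
      case 2
      have "k x y \<in> below S' (\<phi> x)" using kb(1)[OF x] 2 by blast
      then show ?thesis using 2 by (auto simp: h_def below_def)
    next
      case 3
      have "k x y \<in> below S' (\<phi> x)" "k x z \<in> below S' (\<phi> x)" using kb(1)[OF x] 3 by blast+
      moreover have "y \<noteq> x" "z \<noteq> x" using 3 xb by auto
      ultimately show ?thesis using k[OF x] 3 by (simp add: iso_via_def h_def)
    qed
  qed
  \<comment> \<open>Selects the piece of the glued map that applies to \<open>y\<close>.\<close>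
  define \<rho> where "\<rho> = (\<lambda>y. THE x. x \<in> roots S \<and> y \<in> dcone S x)"
  have \<rho>: "\<rho> y = x" if "x \<in> roots S" "y \<in> dcone S x" for x y
    unfolding \<rho>_def using that root_unique[OF F] by (intro the_equality) auto
  have \<rho>R: "\<rho> y \<in> roots S" "y \<in> dcone S (\<rho> y)" if "y \<in> universe S" for y
    using root_exists[OF F that] \<rho> by auto
  have hU: "h (\<rho> y) y \<in> dcone S' (\<phi> (\<rho> y))" if "y \<in> universe S" for y
    using hc[OF \<rho>R(1)[OF that]] \<rho>R(2)[OF that] by (auto simp: bij_betw_def)
  have "bij_betw (\<lambda>y. h (\<rho> y) y) (universe S) (universe S')"
    unfolding bij_betw_def
  proof
    show "inj_on (\<lambda>y. h (\<rho> y) y) (universe S)"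
    proof (rule inj_onI)
      fix y z assume yz: "y \<in> universe S" "z \<in> universe S" "h (\<rho> y) y = h (\<rho> z) z"
      then have "\<phi> (\<rho> y) = \<phi> (\<rho> z)"
        using root_unique[OF F' \<phi>R \<phi>R] hU[OF yz(1)] hU[OF yz(2)] \<rho>R by metis
      then have "\<rho> y = \<rho> z" using \<phi> \<rho>R yz(1,2) by (meson bij_betw_inv_into_left bij_betw_imp_inj_on inj_onD)
      then show "y = z" using hc[OF \<rho>R(1)[OF yz(1)]] yz \<rho>R by (metis bij_betw_imp_inj_on inj_onD)
    qed
    show "(\<lambda>y. h (\<rho> y) y) ` universe S = universe S'"
    proof
      show "(\<lambda>y. h (\<rho> y) y) ` universe S \<subseteq> universe S'"
        using hU \<phi>R \<rho>R universe_cones[OF F'] by blast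
      show "universe S' \<subseteq> (\<lambda>y. h (\<rho> y) y) ` universe S"
      proof
        fix z assume "z \<in> universe S'"
        then obtain x' where x': "x' \<in> roots S'" "z \<in> dcone S' x'" using root_exists[OF F'] by blast
        then obtain x where x: "x \<in> roots S" "x' = \<phi> x" using \<phi> by (auto simp: bij_betw_def)
        then obtain y where y: "y \<in> dcone S x" "z = h x y" using hc[OF x(1)] x' by (auto simp: bij_betw_def)
        then have "y \<in> universe S" using x universe_cones[OF F] by blast
        then show "z \<in> (\<lambda>y. h (\<rho> y) y) ` universe S" using y \<rho>[OF x(1) y(1)] by blast
      qed
    qed
  qed
  moreover have "(y, z) \<in> less_rel S \<longleftrightarrow> (h (\<rho> y) y, h (\<rho> z) z) \<in> less_rel S'"
    if yz: "y \<in> universe S" "z \<in> universe S" for y z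
  proof (cases "\<rho> y = \<rho> z")
    case True
    then have "z \<in> dcone S (\<rho> y)" using \<rho>R(2)[OF yz(2)] by simp
    then show ?thesis using hrel[OF \<rho>R[OF yz(1)]] True by simp
  next
    case False
    have "(y, z) \<notin> less_rel S"
    proof
      assume "(y, z) \<in> less_rel S"
      then have "z \<in> dcone S (\<rho> y)" using cone_up[OF F \<rho>R(1)[OF yz(1)] \<rho>R(2)[OF yz(1)]] by blast
      then show False using \<rho>[OF \<rho>R(1)[OF yz(1)]] False by auto
    qed
    moreover have "(h (\<rho> y) y, h (\<rho> z) z) \<notin> less_rel S'"
    proof
      assume "(h (\<rho> y) y, h (\<rho> z) z) \<in> less_rel S'"
      then have "h (\<rho> z) z \<in> dcone S' (\<phi> (\<rho> y))"
        using cone_up[OF F' \<phi>R[OF \<rho>R(1)[OF yz(1)]] hU[OF yz(1)]] by blast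
      then have "\<phi> (\<rho> y) = \<phi> (\<rho> z)"
        using root_unique[OF F' \<phi>R \<phi>R] hU[OF yz(2)] \<rho>R yz by metis
      then show False using \<phi> \<rho>R yz False by (meson bij_betw_imp_inj_on inj_onD)
    qed
    ultimately show ?thesis by simp
  qed
  ultimately show ?case unfolding iso_via_def by blast
qed

section \<open>Sizes, trees and sums in terms of shapes\<close>

lemma wt_sum: "finite A \<Longrightarrow> wt w (\<Sum>x\<in>A. g x) = (\<Sum>x\<in>A. wt w (g x))"
  by (induction A rule: finite_induct) auto

lemma wt_shape: "forest0 S \<Longrightarrow> wt nodes (shape S) = card (universe S)"
proof (induction "card (universe S)" arbitrary: S rule: less_induct)
  case less
  note F = less.prems
  have "wt nodes (shape (substruct S (below S x))) = card (below S x)" if x: "x \<in> roots S" for x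
  proof -
    have "x \<in> universe S" by (rule rootsD[OF x])
    then have "card (universe (substruct S (below S x))) < card (universe S)"
      using card_below[of S x] F by (simp add: forest0_def)
    then show ?thesis using less.hyps forest0_substruct[OF F below_subset] by fastforce
  qed
  then have "wt nodes (shape S) = (\<Sum>x\<in>roots S. card (dcone S x))"
    unfolding shape_unfold[OF F] wt_sum[OF finite_roots[OF F]]
  proof (intro sum.cong refl)
    fix x assume x: "x \<in> roots S" and h: "\<And>x. x \<in> roots S \<Longrightarrow> wt nodes (shape (substruct S (below S x))) = card (below S x)"
    have "finite (below S x)" "x \<notin> below S x" using F by (auto simp: forest0_def below_def irrefl_def)
    then show "wt nodes {#Node (shape (substruct S (below S x)))#} = card (dcone S x)"
      using h[OF x] by (simp add: dcone_def)
  qed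
  also have "\<dots> = card (\<Union>x\<in>roots S. dcone S x)"
  proof (rule card_UN_disjoint[symmetric])
    show "\<forall>x\<in>roots S. finite (dcone S x)" using F by (auto simp: forest0_def below_def dcone_def)
  qed (use finite_roots[OF F] cones_disjoint[OF F] in auto)
  also have "\<dots> = card (universe S)" using universe_cones[OF F] by simp
  finally show ?case .
qed

lemma size_shape: "forest0 S \<Longrightarrow> size (shape S) = card (roots S)"
proof -
  assume F: "forest0 S"
  have "size (\<Sum>x\<in>A. {#g x#}) = card A" if "finite A" for A and g :: "'a \<Rightarrow> utree"
    using that by (induction A rule: finite_induct) auto
  from this[OF finite_roots[OF F]] show ?thesis unfolding shape_unfold[OF F] .
qed

lemma shape_empty_iff: "forest0 S \<Longrightarrow> shape S = {#} \<longleftrightarrow> universe S = {}"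
  using wt_shape[of S] size_shape[of S] universe_cones[of S] roots_subset[of S] finite_roots[of S]
  by (metis UN_empty card_eq_0_iff size_eq_0_iff_empty subset_empty)

lemma is_tree_iff: "is_tree S \<longleftrightarrow> forest0 S \<and> size (shape S) = 1"
proof
  assume t: "is_tree S"
  then have F: "forest0 S" by (simp add: is_tree_def is_forest_iff)
  obtain g where g: "g \<in> universe S" "\<forall>x\<in>universe S. x = g \<or> (x, g) \<in> less_rel S"
    using t by (auto simp: is_tree_def)
  have "(g, y) \<notin> less_rel S" for y
  proof
    assume gy: "(g, y) \<in> less_rel S"
    then have "y \<in> universe S" using F by (auto simp: forest0_def)
    then have "(g, g) \<in> less_rel S" using g gy F by (metis forest0_def transD)
    then show False using F by (auto simp: forest0_def irrefl_def)
  qed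
  then have "roots S = {g}" using g by (auto simp: roots_def)
  then show "forest0 S \<and> size (shape S) = 1" using F size_shape[OF F] by simp
next
  assume a: "forest0 S \<and> size (shape S) = 1"
  then obtain g where g: "roots S = {g}" using size_shape by (metis card_1_singletonE)
  have "x = g \<or> (x, g) \<in> less_rel S" if "x \<in> universe S" for x
    using root_exists[of S x] a that g by (auto simp: dcone_def below_def)
  moreover have "g \<in> universe S" by (rule rootsD) (simp add: g)
  ultimately show "is_tree S" using a by (auto simp: is_tree_def is_forest_iff)
qed

lemma struct_sum_universe: "universe (struct_sum Ts) = {(i, x). i < length Ts \<and> x \<in> universe (Ts ! i)}"
  and struct_sum_rel: "((i, x), (j, y)) \<in> less_rel (struct_sum Ts) \<longleftrightarrow> i < length Ts \<and> j = i \<and> (x, y) \<in> less_rel (Ts ! i)"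
  by (auto simp: struct_sum_def)

lemma forest0_struct_sum:
  assumes "\<And>T. T \<in> set Ts \<Longrightarrow> forest0 T" shows "forest0 (struct_sum Ts)"
proof -
  let ?S = "struct_sum Ts"
  have F: "forest0 (Ts ! i)" if "i < length Ts" for i using assms that by simp
  have "universe ?S = (\<Union>i<length Ts. {i} \<times> universe (Ts ! i))" by (auto simp: struct_sum_universe)
  moreover have "finite (universe (Ts ! i))" if "i < length Ts" for i using F[OF that] by (simp add: forest0_def)
  ultimately have "finite (universe ?S)" by simp
  moreover have "less_rel ?S \<subseteq> universe ?S \<times> universe ?S"
    using F by (fastforce simp: struct_sum_def forest0_def)
  moreover have "irrefl (less_rel ?S)"
    using F by (auto simp: irrefl_def struct_sum_rel forest0_def)
  moreover have "trans (less_rel ?S)"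
  proof (rule transI)
    fix p q r assume a: "(p, q) \<in> less_rel ?S" "(q, r) \<in> less_rel ?S"
    obtain i x j y k z where [simp]: "p = (i, x)" "q = (j, y)" "r = (k, z)" by (cases p, cases q, cases r)
    have i: "i < length Ts" "j = i" "k = i" "(x, y) \<in> less_rel (Ts ! i)" "(y, z) \<in> less_rel (Ts ! i)"
      using a by (auto simp: struct_sum_rel)
    then have "(x, z) \<in> less_rel (Ts ! i)" using F[OF i(1)] by (meson forest0_def transD)
    then show "(p, r) \<in> less_rel ?S" using i by (simp add: struct_sum_rel)
  qed
  moreover have "total_on (upset ?S p) (less_rel ?S)" if p: "p \<in> universe ?S" for p
  proof (rule total_onI)
    fix q r assume a: "q \<in> upset ?S p" "r \<in> upset ?S p" "q \<noteq> r"
    obtain i x j y k z where [simp]: "p = (i, x)" "q = (j, y)" "r = (k, z)" by (cases p, cases q, cases r)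
    have i: "i < length Ts" "x \<in> universe (Ts ! i)" using p by (auto simp: struct_sum_universe)
    have jk: "j = i" "k = i" "y \<in> upset (Ts ! i) x" "z \<in> upset (Ts ! i) x"
      using a(1,2) i by (auto simp: upset_def struct_sum_rel struct_sum_universe)
    have "total_on (upset (Ts ! i) x) (less_rel (Ts ! i))" using F[OF i(1)] i(2) by (simp add: forest0_def)
    then have "(y, z) \<in> less_rel (Ts ! i) \<or> (z, y) \<in> less_rel (Ts ! i)"
      using jk a(3) by (auto simp: total_on_def)
    then show "(q, r) \<in> less_rel ?S \<or> (r, q) \<in> less_rel ?S" using jk i by (auto simp: struct_sum_rel)
  qed
  ultimately show ?thesis by (simp add: forest0_def)
qed

lemma shape_struct_sum:
  assumes F: "\<And>T. T \<in> set Ts \<Longrightarrow> forest0 T"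
  shows "shape (struct_sum Ts) = (\<Sum>T\<leftarrow>Ts. shape T)"
proof -
  let ?S = "struct_sum Ts"
  have FS: "forest0 ?S" using forest0_struct_sum F by blast
  have R: "roots ?S = (SIGMA i : {..<length Ts}. roots (Ts ! i))"
    by (auto simp: roots_def struct_sum_universe struct_sum_rel)
  have piece: "shape (substruct ?S (below ?S (i, x))) = shape (substruct (Ts ! i) (below (Ts ! i) x))"
    if i: "i < length Ts" and x: "x \<in> roots (Ts ! i)" for i x
  proof (rule shape_iso_via[symmetric, of "\<lambda>y. (i, y)"])
    have Fi: "forest0 (Ts ! i)" using F i by simp
    have "below ?S (i, x) = (\<lambda>y. (i, y)) ` below (Ts ! i) x"
      using i by (auto simp: below_def struct_sum_universe struct_sum_rel)
    then show "iso_via (\<lambda>y. (i, y)) (substruct (Ts ! i) (below (Ts ! i) x)) (substruct ?S (below ?S (i, x)))"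
      using i by (auto simp: iso_via_def bij_betw_def inj_on_def struct_sum_rel)
    show "forest0 (substruct (Ts ! i) (below (Ts ! i) x))" by (rule forest0_substruct[OF Fi below_subset])
    show "forest0 (substruct ?S (below ?S (i, x)))" by (rule forest0_substruct[OF FS below_subset])
  qed
  have fin: "finite (roots (Ts ! i))" if "i < length Ts" for i by (rule finite_roots[OF F[OF nth_mem[OF that]]])
  have "shape ?S = (\<Sum>p\<in>(SIGMA i : {..<length Ts}. roots (Ts ! i)). {#Node (shape (substruct ?S (below ?S p)))#})"
    unfolding shape_unfold[OF FS] R ..
  also have "\<dots> = (\<Sum>i<length Ts. \<Sum>x\<in>roots (Ts ! i). {#Node (shape (substruct ?S (below ?S (i, x))))#})"
    using fin by (subst sum.Sigma) (auto simp: case_prod_unfold)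
  also have "\<dots> = (\<Sum>i<length Ts. shape (Ts ! i))"
  proof (rule sum.cong[OF refl])
    fix i assume i: "i \<in> {..<length Ts}"
    then have "forest0 (Ts ! i)" using F by simp
    then show "(\<Sum>x\<in>roots (Ts ! i). {#Node (shape (substruct ?S (below ?S (i, x))))#}) = shape (Ts ! i)"
      using piece i by (simp add: shape_unfold)
  qed
  also have "\<dots> = (\<Sum>T\<leftarrow>Ts. shape T)" by (simp add: sum_list_sum_nth atLeast0LessThan)
  finally show ?thesis .
qed

section \<open>Realising every multiset of trees over the natural numbers\<close>

lemma forest0_transfer:
  assumes "forest0 S" "inj_on g (universe S)"
  defines "S' \<equiv> (g ` universe S, (\<lambda>(x, y). (g x, g y)) ` less_rel S)"
  shows "forest0 S'" "iso_via g S S'"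
proof -
  have sub: "less_rel S \<subseteq> universe S \<times> universe S" using assms(1) by (simp add: forest0_def)
  have rel: "(g x, g y) \<in> less_rel S' \<longleftrightarrow> (x, y) \<in> less_rel S" if "x \<in> universe S" "y \<in> universe S" for x y
  proof
    assume "(g x, g y) \<in> less_rel S'"
    then obtain x' y' where "(x', y') \<in> less_rel S" "g x = g x'" "g y = g y'" by (auto simp: S'_def)
    moreover from this have "x = x'" "y = y'" using sub that assms(2) by (auto dest: inj_onD)
    ultimately show "(x, y) \<in> less_rel S" by simp
  qed (force simp: S'_def)
  show iso: "iso_via g S S'" using assms(2) rel by (simp add: iso_via_def bij_betw_def S'_def)
  have U: "universe S' = g ` universe S" by (simp add: S'_def)
  have sub': "less_rel S' \<subseteq> universe S' \<times> universe S'" using sub by (auto simp: S'_def)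
  have "irrefl (less_rel S')"
  proof (rule irreflI)
    fix p show "(p, p) \<notin> less_rel S'"
    proof
      assume p: "(p, p) \<in> less_rel S'"
      then obtain x where "x \<in> universe S" "p = g x" using sub' U by blast
      then show False using p rel assms(1) by (auto simp: forest0_def irrefl_def)
    qed
  qed
  moreover have "trans (less_rel S')"
  proof (rule transI)
    fix p q r assume a: "(p, q) \<in> less_rel S'" "(q, r) \<in> less_rel S'"
    then have "p \<in> g ` universe S" "q \<in> g ` universe S" "r \<in> g ` universe S" using sub' U by auto
    then obtain x y z where "x \<in> universe S" "p = g x" "y \<in> universe S" "q = g y" "z \<in> universe S" "r = g z"
      by (elim imageE)
    then show "(p, r) \<in> less_rel S'" using a rel assms(1) by (metis forest0_def transD)
  qed
  moreover have "total_on (upset S' p) (less_rel S')" if p: "p \<in> universe S'" for p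
  proof (rule total_onI)
    fix q r assume a: "q \<in> upset S' p" "r \<in> upset S' p" "q \<noteq> r"
    obtain x y z where xyz: "x \<in> universe S" "p = g x" "y \<in> universe S" "q = g y" "z \<in> universe S" "r = g z"
      using p a(1,2) U by (auto simp: upset_def)
    then have "y \<in> upset S x" "z \<in> upset S x" using a(1,2) rel assms(2) by (auto simp: upset_def dest: inj_onD)
    moreover have "total_on (upset S x) (less_rel S)" using assms(1) xyz by (simp add: forest0_def)
    ultimately have "(y, z) \<in> less_rel S \<or> (z, y) \<in> less_rel S" using a(3) xyz by (auto simp: total_on_def)
    then show "(q, r) \<in> less_rel S' \<or> (r, q) \<in> less_rel S'" using rel xyz by simp
  qed
  moreover have "finite (universe S')" using assms(1) U by (simp add: forest0_def)
  ultimately show "forest0 S'" using sub' by (simp add: forest0_def)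
qed

lemma shape_transfer:
  assumes "forest0 S" "inj_on g (universe S)"
  shows "shape (g ` universe S, (\<lambda>(x, y). (g x, g y)) ` less_rel S) = shape S"
  using shape_iso_via[OF forest0_transfer(2)[OF assms] assms(1) forest0_transfer(1)[OF assms]] by simp

lemma trans_add_top: "trans r \<Longrightarrow> z \<notin> U \<Longrightarrow> r \<subseteq> U \<times> U \<Longrightarrow> trans (r \<union> U \<times> {z})"
  unfolding trans_def by blast

text \<open>Relabelling by \<open>Suc\<close> frees \<open>0\<close> for the new root.\<close>

lemma add_root:
  fixes S :: "nat struct"
  assumes F: "forest0 S"
  shows "\<exists>S' :: nat struct. forest0 S' \<and> shape S' = {#Node (shape S)#}"
proof -
  let ?U = "Suc ` universe S" and ?r = "(\<lambda>(x, y). (Suc x, Suc y)) ` less_rel S"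
  have inj: "inj_on Suc (universe S)" by simp
  note F1 = forest0_transfer(1)[OF F inj]
  define S' where "S' = (insert 0 ?U, ?r \<union> ?U \<times> {0})"
  have sub: "?r \<subseteq> ?U \<times> ?U" using F1 by (simp add: forest0_def)
  have F': "forest0 S'"
  proof -
    have "total_on (upset S' x) (less_rel S')" if "x \<in> universe S'" for x
    proof (cases "x = 0")
      case True
      then have "upset S' x = {0}" using sub by (auto simp: upset_def S'_def)
      then show ?thesis by (simp add: total_on_def)
    next
      case False
      then have x: "x \<in> ?U" using that by (simp add: S'_def)
      then have "upset S' x = insert 0 (upset (?U, ?r) x)" using sub False by (auto simp: upset_def S'_def)
      moreover have "total_on (upset (?U, ?r) x) ?r"
      proof -
        have "\<forall>x\<in>universe (?U, ?r). total_on (upset (?U, ?r) x) (less_rel (?U, ?r))"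
          using F1 unfolding forest0_def by blast
        then show ?thesis using x by (simp only: fst_conv snd_conv)
      qed
      moreover have "upset (?U, ?r) x \<subseteq> ?U" by (auto simp: upset_def)
      ultimately show ?thesis unfolding total_on_def S'_def by auto
    qed
    moreover have "irrefl (less_rel S')" using F1 by (auto simp: S'_def forest0_def irrefl_def)
    moreover have "trans (less_rel S')"
    proof -
      have "trans ?r" using F1 by (simp add: forest0_def)
      moreover have "0 \<notin> ?U" by simp
      ultimately show ?thesis using sub unfolding S'_def snd_conv
        by (rule trans_add_top)
    qed
    moreover have "finite (universe S')" using F by (simp add: S'_def forest0_def)
    moreover have "less_rel S' \<subseteq> universe S' \<times> universe S'" using sub by (auto simp: S'_def)
    ultimately show ?thesis by (simp add: forest0_def)
  qed
  have R: "roots S' = {0}" using sub by (auto simp: roots_def S'_def)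
  have B: "below S' 0 = ?U" using sub by (auto simp: below_def S'_def)
  have "substruct S' (below S' 0) = (?U, ?r)" unfolding B using sub by (auto simp: substruct_def S'_def)
  then have "shape S' = {#Node (shape S)#}"
    unfolding shape_unfold[OF F'] R using shape_transfer[OF F inj] by simp
  then show ?thesis using F' by blast
qed

text \<open>Realisability of single trees is a hypothesis so that the induction over trees can call
  this lemma.\<close>

lemma shape_surj_forest:
  assumes "\<And>t. t \<in># M \<Longrightarrow> \<exists>S :: nat struct. forest0 S \<and> shape S = {#t#}"
  shows "\<exists>S :: nat struct. forest0 S \<and> shape S = M"
  using assms
proof (induction M)
  case empty
  have "forest0 ({}, {}) \<and> shape ({}, {}) = {#}"
    using shape_empty_iff[of "({}, {})"] by (simp add: forest0_def irrefl_def trans_def)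
  then show ?case by blast
next
  case (add t M)
  obtain S1 S2 :: "nat struct" where S: "forest0 S1" "shape S1 = {#t#}" "forest0 S2" "shape S2 = M"
    using add by (metis union_single_eq_member insert_iff set_mset_add_mset_insert)
  let ?S = "struct_sum [S1, S2]"
  have F: "forest0 ?S" using S by (intro forest0_struct_sum) auto
  have sh: "shape ?S = add_mset t M" using S by (subst shape_struct_sum) auto
  \<comment> \<open>A sum lives on pairs; the pairing function brings it back to
    \<open>nat\<close>.\<close>
  have inj: "inj_on prod_encode (universe ?S)" by (simp add: inj_on_def)
  show ?case using forest0_transfer(1)[OF F inj] shape_transfer[OF F inj] sh by metis
qed

lemma shape_surj_tree: "\<exists>S :: nat struct. forest0 S \<and> shape S = {#t#}"
proof (induction t)
  case (Node M)
  then obtain S :: "nat struct" where "forest0 S" "shape S = M" using shape_surj_forest[of M] by auto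
  then show ?case using add_root by metis
qed

lemma shape_surj: "\<exists>S :: nat struct. forest0 S \<and> shape S = M"
  using shape_surj_forest[of M] shape_surj_tree by blast

section \<open>Monadic second-order types\<close>

primrec qdepth :: "mso \<Rightarrow> nat" where
  "qdepth (Less x y) = 0"
| "qdepth (Equal x y) = 0"
| "qdepth (Member x X) = 0"
| "qdepth (Neg \<phi>) = qdepth \<phi>"
| "qdepth (Conj \<phi> \<psi>) = max (qdepth \<phi>) (qdepth \<psi>)"
| "qdepth (Ex_elem x \<phi>) = Suc (qdepth \<phi>)"
| "qdepth (Ex_set X \<phi>) = Suc (qdepth \<phi>)"

text \<open>These atoms compose well: over a disjoint union without relations across,
  \<open>Meet\<close> and \<open>Below\<close> hold if they hold in one of the parts, and only
  \<open>Two\<close> has a mixed case.\<close>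

datatype atom = Meet nat nat | Below nat nat | Two nat

instance atom :: countable by countable_datatype

text \<open>Elements are represented by singletons; \<open>Two i\<close> says that the \<open>i\<close>-th set has at least two elements.\<close>

definition atoms :: "nat \<Rightarrow> 'a rel \<Rightarrow> (nat \<Rightarrow> 'a set) \<Rightarrow> atom set" where
  "atoms k r P = {Meet i j |i j. i < k \<and> j < k \<and> P i \<inter> P j \<noteq> {}} \<union>
     {Below i j |i j. i < k \<and> j < k \<and> (\<exists>x\<in>P i. \<exists>y\<in>P j. (x, y) \<in> r)} \<union>
     {Two i |i. i < k \<and> (\<exists>x\<in>P i. \<exists>y\<in>P i. x \<noteq> y)}"

lemma atoms_iff [simp]:
  "Meet i j \<in> atoms k r P \<longleftrightarrow> i < k \<and> j < k \<and> P i \<inter> P j \<noteq> {}"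
  "Below i j \<in> atoms k r P \<longleftrightarrow> i < k \<and> j < k \<and> (\<exists>x\<in>P i. \<exists>y\<in>P j. (x, y) \<in> r)"
  "Two i \<in> atoms k r P \<longleftrightarrow> i < k \<and> (\<exists>x\<in>P i. \<exists>y\<in>P i. x \<noteq> y)"
  by (simp_all add: atoms_def)

text \<open>The depth \<open>q\<close> type of a structure with \<open>k\<close> distinguished sets, coded by a natural number
  through Ackermann's coding of hereditarily finite sets.\<close>

primrec ty :: "nat \<Rightarrow> nat \<Rightarrow> 'a set \<Rightarrow> 'a rel \<Rightarrow> (nat \<Rightarrow> 'a set) \<Rightarrow> nat" where
  "ty 0 k U r P = set_encode (to_nat ` atoms k r P)"
| "ty (Suc q) k U r P = set_encode ((\<lambda>B. ty q (Suc k) U r (P(k := B))) ` Pow U)"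

definition all_atoms :: "nat \<Rightarrow> atom set" where
  "all_atoms k = case_prod Meet ` ({..<k} \<times> {..<k}) \<union> case_prod Below ` ({..<k} \<times> {..<k}) \<union> Two ` {..<k}"

lemma finite_all_atoms: "finite (all_atoms k)" by (simp add: all_atoms_def)

lemma atoms_subset: "atoms k r P \<subseteq> all_atoms k"
  by (auto simp: atoms_def all_atoms_def)

lemma finite_atoms [simp]: "finite (atoms k r P)"
  using atoms_subset finite_all_atoms by (rule finite_subset)

text \<open>A finite range of codes fixed by depth and number of sets alone, hence uniform over all
  finite structures.\<close>

primrec types :: "nat \<Rightarrow> nat \<Rightarrow> nat set" where
  "types 0 k = (\<lambda>A. set_encode (to_nat ` A)) ` Pow (all_atoms k)"
| "types (Suc q) k = set_encode ` Pow (types q (Suc k))"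

lemma finite_types: "finite (types q k)"
  by (induction q arbitrary: k) (auto simp: finite_all_atoms)

lemma ty_types: "finite U \<Longrightarrow> ty q k U r P \<in> types q k"
proof (induction q arbitrary: k P)
  case 0
  then show ?case using atoms_subset[of k r P] by auto
next
  case (Suc q)
  then show ?case by auto
qed

section \<open>Composition of types on codes\<close>

definition dec_atoms :: "nat \<Rightarrow> atom set" where
  "dec_atoms x = {a. to_nat a \<in> set_decode x}"

lemma finite_dec_atoms [simp]: "finite (dec_atoms x)"
  using finite_vimageI[OF finite_set_decode[of x] inj_to_nat] by (simp add: dec_atoms_def vimage_def)

lemma dec_atoms_encode [simp]: "finite A \<Longrightarrow> dec_atoms (set_encode (to_nat ` A)) = A"
  by (auto simp: dec_atoms_def set_encode_inverse inj_image_mem_iff)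

text \<open>The mixed case: a set that meets both parts has two elements in the union.\<close>

definition add_atoms :: "atom set \<Rightarrow> atom set \<Rightarrow> atom set" where
  "add_atoms A B = A \<union> B \<union> {Two i |i. Meet i i \<in> A \<and> Meet i i \<in> B}"

lemma add_atoms_iff [simp]:
  "Meet i j \<in> add_atoms A B \<longleftrightarrow> Meet i j \<in> A \<or> Meet i j \<in> B"
  "Below i j \<in> add_atoms A B \<longleftrightarrow> Below i j \<in> A \<or> Below i j \<in> B"
  "Two i \<in> add_atoms A B \<longleftrightarrow> Two i \<in> A \<or> Two i \<in> B \<or> Meet i i \<in> A \<and> Meet i i \<in> B"
  by (auto simp: add_atoms_def)

lemma finite_add_atoms [simp]: "finite A \<Longrightarrow> finite B \<Longrightarrow> finite (add_atoms A B)"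
proof -
  assume a: "finite A" "finite B"
  have "{Two i |i. Meet i i \<in> A \<and> Meet i i \<in> B} \<subseteq> Two ` ((\<lambda>i. Meet i i) -` A)" by auto
  moreover have "finite ((\<lambda>i. Meet i i) -` A)" by (rule finite_vimageI[OF a(1)]) (simp add: inj_def)
  ultimately have "finite {Two i |i. Meet i i \<in> A \<and> Meet i i \<in> B}" by (meson finite_imageI finite_subset)
  then show ?thesis using a by (simp add: add_atoms_def)
qed

text \<open>Feferman--Vaught composition: a subset of a disjoint union is a pair of subsets, so the
  options of the two parts are combined pairwise.\<close>

primrec add :: "nat \<Rightarrow> nat \<Rightarrow> nat \<Rightarrow> nat" where
  "add 0 = (\<lambda>x y. set_encode (to_nat ` add_atoms (dec_atoms x) (dec_atoms y)))"
| "add (Suc q) = (\<lambda>x y. set_encode (case_prod (add q) ` (set_decode x \<times> set_decode y)))"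

text \<open>The type of the empty structure, which at every depth offers the empty set as its only
  option.\<close>

primrec zero :: "nat \<Rightarrow> nat" where
  "zero 0 = set_encode {}"
| "zero (Suc q) = set_encode {zero q}"

lemma decode_zero_Suc: "set_decode (zero (Suc q)) = {zero q}"
  by (simp only: zero.simps set_encode_inverse finite.intros)

lemma add_comm: "add q x y = add q y x"
proof (induction q arbitrary: x y)
  case 0
  have "add_atoms (dec_atoms x) (dec_atoms y) = add_atoms (dec_atoms y) (dec_atoms x)" by (auto simp: add_atoms_def)
  then show ?case by simp
next
  case (Suc q)
  have "case_prod (add q) ` (set_decode x \<times> set_decode y) = case_prod (add q) ` (set_decode y \<times> set_decode x)"
    using Suc by (fastforce simp: image_iff)
  then show ?case by simp
qed

lemma decode_add_Suc: "set_decode (add (Suc q) x y) = case_prod (add q) ` (set_decode x \<times> set_decode y)"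
  by (simp add: set_encode_inverse)

lemma add_assoc: "add q (add q x y) w = add q x (add q y w)"
proof (induction q arbitrary: x y w)
  case 0
  have "add_atoms (add_atoms (dec_atoms x) (dec_atoms y)) (dec_atoms w)
      = add_atoms (dec_atoms x) (add_atoms (dec_atoms y) (dec_atoms w))"
    by (auto simp: add_atoms_def)
  then show ?case by simp
next
  case (Suc q)
  have "case_prod (add q) ` (set_decode (add (Suc q) x y) \<times> set_decode w)
      = case_prod (add q) ` (set_decode x \<times> set_decode (add (Suc q) y w))" (is "?L = ?R")
  proof
    show "?L \<subseteq> ?R"
    proof
      fix u assume "u \<in> ?L"
      then obtain a b c where abc: "a \<in> set_decode x" "b \<in> set_decode y" "c \<in> set_decode w" "u = add q (add q a b) c"
        unfolding decode_add_Suc by auto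
      have "add q b c \<in> set_decode (add (Suc q) y w)" unfolding decode_add_Suc using abc by force
      then show "u \<in> ?R" unfolding abc(4) Suc using abc(1) by force
    qed
    show "?R \<subseteq> ?L"
    proof
      fix u assume "u \<in> ?R"
      then obtain a b c where abc: "a \<in> set_decode x" "b \<in> set_decode y" "c \<in> set_decode w" "u = add q a (add q b c)"
        unfolding decode_add_Suc by auto
      have "add q a b \<in> set_decode (add (Suc q) x y)" unfolding decode_add_Suc using abc by force
      then show "u \<in> ?L" unfolding abc(4) Suc[symmetric] using abc(3) by force
    qed
  qed
  then show ?case by (simp only: add.simps)
qed

interpretation add: comp_fun_commute "add q" for q
proof
  show "add q y \<circ> add q x = add q x \<circ> add q y" for x y
  proof
    fix w
    show "(add q y \<circ> add q x) w = (add q x \<circ> add q y) w"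
      using add_assoc[of q y x w] add_assoc[of q x y w] add_comm[of q x y] by simp
  qed
qed

definition msum :: "nat \<Rightarrow> nat multiset \<Rightarrow> nat" where
  "msum q m = fold_mset (add q) (zero q) m"

lemma msum_empty [simp]: "msum q {#} = zero q"
  and msum_add [simp]: "msum q (add_mset a m) = add q a (msum q m)"
  by (simp_all add: msum_def)

lemma msum_cong_union: "msum q m = msum q m' \<Longrightarrow> msum q (n + m) = msum q (n + m')"
  by (induction n) auto

text \<open>Composition for a new greatest element; \<open>R\<close> holds the indices of the sets
  that contain it. A further set omits it or contains it, the latter adding \<open>k\<close> to
  \<open>R\<close>. \<open>Meet i i\<close> says that the \<open>i\<close>-th set is
  nonempty.\<close>

primrec add_top :: "nat \<Rightarrow> nat \<Rightarrow> nat set \<Rightarrow> nat \<Rightarrow> nat" where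
  "add_top 0 = (\<lambda>k R x. set_encode (to_nat ` (dec_atoms x \<union> {Meet i j |i j. i \<in> R \<and> j \<in> R} \<union>
     {Two i |i. i \<in> R \<and> Meet i i \<in> dec_atoms x} \<union> {Below i j |i j. j \<in> R \<and> Meet i i \<in> dec_atoms x})))"
| "add_top (Suc q) = (\<lambda>k R x. set_encode (add_top q (Suc k) R ` set_decode x \<union> add_top q (Suc k) (insert k R) ` set_decode x))"

primrec tree_ty :: "nat \<Rightarrow> utree \<Rightarrow> nat" where
  "tree_ty q (Node M) = add_top q 0 {} (msum q (image_mset (tree_ty q) M))"

section \<open>Types of unions, rooted trees and forests\<close>

lemma ty_cong:
  assumes "\<And>x y. x \<in> U \<Longrightarrow> y \<in> U \<Longrightarrow> (x, y) \<in> r \<longleftrightarrow> (x, y) \<in> r'"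
    and "\<And>i. i < k \<Longrightarrow> P i = P' i" "\<And>i. i < k \<Longrightarrow> P i \<subseteq> U"
  shows "ty q k U r P = ty q k U r' P'"
  using assms(2,3)
proof (induction q arbitrary: k P P')
  case 0
  have rel: "(\<exists>x\<in>P i. \<exists>y\<in>P j. (x, y) \<in> r) \<longleftrightarrow> (\<exists>x\<in>P' i. \<exists>y\<in>P' j. (x, y) \<in> r')" if "i < k" "j < k" for i j
  proof -
    have "x \<in> U" "y \<in> U" if "x \<in> P' i" "y \<in> P' j" for x y
      using 0 \<open>i < k\<close> \<open>j < k\<close> that by auto
    then show ?thesis using assms(1) 0(1) that by simp
  qed
  have "a \<in> atoms k r P \<longleftrightarrow> a \<in> atoms k r' P'" for a
  proof (cases a)
    case (Meet i j)
    then show ?thesis using 0(1)[of i] 0(1)[of j] by auto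
  next
    case (Below i j)
    then show ?thesis using rel[of i j] by auto
  next
    case (Two i)
    then show ?thesis using 0(1)[of i] by auto
  qed
  then have "atoms k r P = atoms k r' P'" by blast
  then show ?case by simp
next
  case (Suc q)
  have eq: "ty q (Suc k) U r (P(k := B)) = ty q (Suc k) U r' (P'(k := B))" if "B \<subseteq> U" for B
    using Suc.prems that by (intro Suc.IH) (auto simp: less_Suc_eq)
  have "(\<lambda>B. ty q (Suc k) U r (P(k := B))) ` Pow U = (\<lambda>B. ty q (Suc k) U r' (P'(k := B))) ` Pow U"
    by (rule image_cong[OF refl]) (rule eq, simp)
  then show ?case by (simp only: ty.simps)
qed

text \<open>A new set is determined by its traces on the two parts, and any two traces occur
  together; this matches the pairing in \<open>add\<close>.\<close>

lemma ty_union: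
  assumes fin: "finite U1" "finite U2" and disj: "U1 \<inter> U2 = {}"
    and sep: "\<And>x y. x \<in> U1 \<Longrightarrow> y \<in> U2 \<Longrightarrow> (x, y) \<notin> r \<and> (y, x) \<notin> r"
    and P: "\<And>i. i < k \<Longrightarrow> P i \<subseteq> U1 \<union> U2"
  shows "ty q k (U1 \<union> U2) r P = add q (ty q k U1 r (\<lambda>i. P i \<inter> U1)) (ty q k U2 r (\<lambda>i. P i \<inter> U2))"
  using P
proof (induction q arbitrary: k P)
  case 0
  let ?A = "atoms k r (\<lambda>i. P i \<inter> U1)" and ?B = "atoms k r (\<lambda>i. P i \<inter> U2)"
  have Psub: "x \<in> U1 \<or> x \<in> U2" if "x \<in> P i" "i < k" for x i using 0 that by blast
  have "a \<in> atoms k r P \<longleftrightarrow> a \<in> add_atoms ?A ?B" for a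
  proof (cases a)
    case (Meet i j)
    then show ?thesis using Psub by auto
  next
    case (Below i j)
    have "x \<in> U1 \<and> y \<in> U1 \<or> x \<in> U2 \<and> y \<in> U2" if "x \<in> P i" "y \<in> P j" "i < k" "j < k" "(x, y) \<in> r" for x y
      using Psub[of x i] Psub[of y j] sep that by blast
    note both = this
    have "(\<exists>x\<in>P i. \<exists>y\<in>P j. (x, y) \<in> r) \<longleftrightarrow>
        (\<exists>x\<in>P i \<inter> U1. \<exists>y\<in>P j \<inter> U1. (x, y) \<in> r) \<or> (\<exists>x\<in>P i \<inter> U2. \<exists>y\<in>P j \<inter> U2. (x, y) \<in> r)"
      (is "?L \<longleftrightarrow> ?R") if ij: "i < k" "j < k"
    proof
      assume ?L
      then obtain x y where "x \<in> P i" "y \<in> P j" "(x, y) \<in> r" by blast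
      then show ?R using both[OF _ _ ij, of x y] by blast
    qed blast
    then show ?thesis using Below by auto
  next
    case (Two i)
    show ?thesis
    proof (cases "i < k")
      case True
      have "(\<exists>x\<in>P i. \<exists>y\<in>P i. x \<noteq> y) \<longleftrightarrow> (\<exists>x\<in>P i \<inter> U1. \<exists>y\<in>P i \<inter> U1. x \<noteq> y) \<or> (\<exists>x\<in>P i \<inter> U2. \<exists>y\<in>P i \<inter> U2. x \<noteq> y)
          \<or> (P i \<inter> U1 \<noteq> {} \<and> P i \<inter> U2 \<noteq> {})" (is "?L \<longleftrightarrow> ?R")
      proof
        assume ?L
        then obtain x y where xy: "x \<in> P i" "y \<in> P i" "x \<noteq> y" by blast
        then show ?R using Psub[OF xy(1) True] Psub[OF xy(2) True] by blast
      next
        assume ?R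
        then consider "\<exists>x\<in>P i. \<exists>y\<in>P i. x \<noteq> y" | x y where "x \<in> P i" "x \<in> U1" "y \<in> P i" "y \<in> U2" by auto
        then show ?L
        proof cases
          case 2
          then have "x \<noteq> y" using disj by auto
          then show ?thesis using 2 by blast
        qed
      qed
      then show ?thesis using Two True by simp
    next
      case False
      then show ?thesis using Two by simp
    qed
  qed
  then have "atoms k r P = add_atoms ?A ?B" by blast
  then show ?case by simp
next
  case (Suc q)
  have IH: "ty q (Suc k) (U1 \<union> U2) r (P(k := B)) = add q (ty q (Suc k) U1 r ((\<lambda>i. P i \<inter> U1)(k := B \<inter> U1)))
      (ty q (Suc k) U2 r ((\<lambda>i. P i \<inter> U2)(k := B \<inter> U2)))" if "B \<subseteq> U1 \<union> U2" for B
  proof -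
    have "ty q (Suc k) (U1 \<union> U2) r (P(k := B)) = add q (ty q (Suc k) U1 r (\<lambda>i. (P(k := B)) i \<inter> U1))
      (ty q (Suc k) U2 r (\<lambda>i. (P(k := B)) i \<inter> U2))"
      using Suc.prems that by (intro Suc.IH) (auto simp: less_Suc_eq)
    moreover have "(\<lambda>i. (P(k := B)) i \<inter> U) = (\<lambda>i. P i \<inter> U)(k := B \<inter> U)" for U by (rule ext) simp
    ultimately show ?thesis by simp
  qed
  let ?f1 = "\<lambda>B. ty q (Suc k) U1 r ((\<lambda>i. P i \<inter> U1)(k := B))" and ?f2 = "\<lambda>B. ty q (Suc k) U2 r ((\<lambda>i. P i \<inter> U2)(k := B))"
  have "(\<lambda>B. ty q (Suc k) (U1 \<union> U2) r (P(k := B))) ` Pow (U1 \<union> U2) = case_prod (add q) ` (?f1 ` Pow U1 \<times> ?f2 ` Pow U2)"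
  proof
    show "(\<lambda>B. ty q (Suc k) (U1 \<union> U2) r (P(k := B))) ` Pow (U1 \<union> U2) \<subseteq> case_prod (add q) ` (?f1 ` Pow U1 \<times> ?f2 ` Pow U2)"
    proof clarify
      fix B assume B: "B \<subseteq> U1 \<union> U2"
      have "(?f1 (B \<inter> U1), ?f2 (B \<inter> U2)) \<in> ?f1 ` Pow U1 \<times> ?f2 ` Pow U2" by blast
      then show "ty q (Suc k) (U1 \<union> U2) r (P(k := B)) \<in> case_prod (add q) ` (?f1 ` Pow U1 \<times> ?f2 ` Pow U2)"
        unfolding IH[OF B] by (rule rev_image_eqI) simp
    qed
    show "case_prod (add q) ` (?f1 ` Pow U1 \<times> ?f2 ` Pow U2) \<subseteq> (\<lambda>B. ty q (Suc k) (U1 \<union> U2) r (P(k := B))) ` Pow (U1 \<union> U2)"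
    proof
      fix u assume "u \<in> case_prod (add q) ` (?f1 ` Pow U1 \<times> ?f2 ` Pow U2)"
      then obtain p where p: "u = case_prod (add q) p" "p \<in> ?f1 ` Pow U1 \<times> ?f2 ` Pow U2" by (rule imageE)
      obtain a b where "p = (a, b)" by (cases p)
      with p have "u = add q a b" "a \<in> ?f1 ` Pow U1" "b \<in> ?f2 ` Pow U2" by (simp_all only: mem_Sigma_iff prod.case)
      then obtain B1 B2 where B: "B1 \<subseteq> U1" "B2 \<subseteq> U2" "u = add q (?f1 B1) (?f2 B2)" by blast
      have cap: "(B1 \<union> B2) \<inter> U1 = B1" "(B1 \<union> B2) \<inter> U2 = B2" using B(1,2) disj by auto
      have "B1 \<union> B2 \<subseteq> U1 \<union> U2" using B(1,2) by auto
      from IH[OF this] have "u = ty q (Suc k) (U1 \<union> U2) r (P(k := B1 \<union> B2))" unfolding cap B(3) by (rule sym)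
      then show "u \<in> (\<lambda>B. ty q (Suc k) (U1 \<union> U2) r (P(k := B))) ` Pow (U1 \<union> U2)" using B by blast
    qed
  qed
  then show ?case using fin by (simp add: set_encode_inverse)
qed

text \<open>Each subset of \<open>U\<close> is the trace of two sets, with and without
  \<open>w\<close>, which accounts for the two images in \<open>add_top\<close>.\<close>

lemma ty_add_top:
  assumes fin: "finite U" and w: "w \<notin> U" and top: "\<And>y. y \<in> U \<Longrightarrow> (y, w) \<in> r \<and> (w, y) \<notin> r" "(w, w) \<notin> r"
    and P: "\<And>i. i < k \<Longrightarrow> P i \<subseteq> insert w U"
  shows "ty q k (insert w U) r P = add_top q k {i. i < k \<and> w \<in> P i} (ty q k U r (\<lambda>i. P i \<inter> U))"
  using P
proof (induction q arbitrary: k P)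
  case 0
  let ?A = "atoms k r (\<lambda>i. P i \<inter> U)" and ?R = "{i. i < k \<and> w \<in> P i}"
  have Psub: "x = w \<or> x \<in> U" if "x \<in> P i" "i < k" for x i using 0 that by blast
  have "a \<in> atoms k r P \<longleftrightarrow> a \<in> ?A \<union> {Meet i j |i j. i \<in> ?R \<and> j \<in> ?R} \<union>
     {Two i |i. i \<in> ?R \<and> Meet i i \<in> ?A} \<union> {Below i j |i j. j \<in> ?R \<and> Meet i i \<in> ?A}" for a
  proof (cases a)
    case (Meet i j)
    then show ?thesis using Psub by auto
  next
    case (Below i j)
    show ?thesis
    proof (cases "i < k \<and> j < k")
      case True
      have "(\<exists>x\<in>P i. \<exists>y\<in>P j. (x, y) \<in> r) \<longleftrightarrow> (\<exists>x\<in>P i \<inter> U. \<exists>y\<in>P j \<inter> U. (x, y) \<in> r) \<or> (w \<in> P j \<and> P i \<inter> U \<noteq> {})" (is "?L \<longleftrightarrow> ?Q")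
      proof
        assume ?L
        then obtain x y where xy: "x \<in> P i" "y \<in> P j" "(x, y) \<in> r" by blast
        then have "x \<in> U" using Psub[of x i] Psub[of y j] True top by blast
        then show ?Q using xy Psub[of y j] True by blast
      next
        assume ?Q
        then show ?L using top(1) by auto
      qed
      then show ?thesis using Below True by simp
    next
      case False
      then show ?thesis using Below by auto
    qed
  next
    case (Two i)
    show ?thesis
    proof (cases "i < k")
      case True
      have "(\<exists>x\<in>P i. \<exists>y\<in>P i. x \<noteq> y) \<longleftrightarrow> (\<exists>x\<in>P i \<inter> U. \<exists>y\<in>P i \<inter> U. x \<noteq> y) \<or> (w \<in> P i \<and> P i \<inter> U \<noteq> {})" (is "?L \<longleftrightarrow> ?Q")
      proof
        assume ?L
        then obtain x y where xy: "x \<in> P i" "y \<in> P i" "x \<noteq> y" by blast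
        then show ?Q using Psub[OF xy(1) True] Psub[OF xy(2) True] by blast
      next
        assume ?Q
        then consider "\<exists>x\<in>P i. \<exists>y\<in>P i. x \<noteq> y" | y where "w \<in> P i" "y \<in> P i" "y \<in> U" by auto
        then show ?L
        proof cases
          case 2
          then have "w \<noteq> y" using w by auto
          then show ?thesis using 2 by blast
        qed
      qed
      then show ?thesis using Two True by simp
    next
      case False
      then show ?thesis using Two by simp
    qed
  qed
  then have "atoms k r P = ?A \<union> {Meet i j |i j. i \<in> ?R \<and> j \<in> ?R} \<union>
     {Two i |i. i \<in> ?R \<and> Meet i i \<in> ?A} \<union> {Below i j |i j. j \<in> ?R \<and> Meet i i \<in> ?A}" by blast
  then show ?case by (simp only: ty.simps add_top.simps dec_atoms_encode[OF finite_atoms])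
next
  case (Suc q)
  let ?R = "{i. i < k \<and> w \<in> P i}" and ?f = "\<lambda>B. ty q (Suc k) U r ((\<lambda>i. P i \<inter> U)(k := B))"
  have IH: "ty q (Suc k) (insert w U) r (P(k := B)) = add_top q (Suc k) (if w \<in> B then insert k ?R else ?R) (?f (B \<inter> U))"
    if "B \<subseteq> insert w U" for B
  proof -
    have "ty q (Suc k) (insert w U) r (P(k := B)) =
        add_top q (Suc k) {i. i < Suc k \<and> w \<in> (P(k := B)) i} (ty q (Suc k) U r (\<lambda>i. (P(k := B)) i \<inter> U))"
      using Suc.prems that by (intro Suc.IH) (auto simp: less_Suc_eq)
    moreover have "(\<lambda>i. (P(k := B)) i \<inter> U) = (\<lambda>i. P i \<inter> U)(k := B \<inter> U)" by (rule ext) simp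
    moreover have "{i. i < Suc k \<and> w \<in> (P(k := B)) i} = (if w \<in> B then insert k ?R else ?R)"
      by (auto simp: less_Suc_eq)
    ultimately show ?thesis by simp
  qed
  have "(\<lambda>B. ty q (Suc k) (insert w U) r (P(k := B))) ` Pow (insert w U) =
      add_top q (Suc k) ?R ` ?f ` Pow U \<union> add_top q (Suc k) (insert k ?R) ` ?f ` Pow U" (is "?L = ?Q")
  proof
    show "?L \<subseteq> ?Q"
    proof clarify
      fix B assume B: "B \<subseteq> insert w U" "ty q (Suc k) (insert w U) r (P(k := B)) \<notin> add_top q (Suc k) (insert k ?R) ` ?f ` Pow U"
      have "B \<inter> U \<in> Pow U" by blast
      then show "ty q (Suc k) (insert w U) r (P(k := B)) \<in> add_top q (Suc k) ?R ` ?f ` Pow U"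
        using B(2) unfolding IH[OF B(1)] by (cases "w \<in> B") auto
    qed
    show "?Q \<subseteq> ?L"
    proof
      fix u assume "u \<in> ?Q"
      then obtain B where B: "B \<subseteq> U" "u = add_top q (Suc k) ?R (?f B) \<or> u = add_top q (Suc k) (insert k ?R) (?f B)" by blast
      have "w \<notin> B" "B \<inter> U = B" "insert w B \<inter> U = B" using B(1) w by auto
      have i1: "ty q (Suc k) (insert w U) r (P(k := B)) = add_top q (Suc k) ?R (?f B)"
        using IH[of B] B(1) \<open>w \<notin> B\<close> \<open>B \<inter> U = B\<close> by (simp only: if_False subset_insertI2)
      have i2: "ty q (Suc k) (insert w U) r (P(k := insert w B)) = add_top q (Suc k) (insert k ?R) (?f B)"
        using IH[OF insert_mono[OF B(1)]] \<open>insert w B \<inter> U = B\<close> by (simp only: insertI1 if_True)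
      have "B \<in> Pow (insert w U)" "insert w B \<in> Pow (insert w U)" using B(1) by auto
      then show "u \<in> ?L" using B(2) unfolding i1[symmetric] i2[symmetric] by blast
    qed
  qed
  then show ?case using fin by (simp add: set_encode_inverse)
qed

lemma ty_empty: "ty q k {} r (\<lambda>_. {}) = zero q"
proof -
  have "(\<And>i. i < k \<Longrightarrow> P i = {}) \<Longrightarrow> ty q k {} r P = zero q" for P
  proof (induction q arbitrary: k P)
    case 0
    then have "atoms k r P = {}" by (auto simp: atoms_def)
    then show ?case by simp
  next
    case (Suc q)
    have "ty q (Suc k) {} r (P(k := {})) = zero q" using Suc.prems by (intro Suc.IH) (auto simp: less_Suc_eq)
    then show ?case by simp
  qed
  then show ?thesis by simp
qed

text \<open>Outer induction on the size for the part below a root, inner induction on the set of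
  roots for the disjoint union of the cones.\<close>

lemma ty_shape: "forest0 S \<Longrightarrow> ty q 0 (universe S) (less_rel S) (\<lambda>_. {}) = msum q (image_mset (tree_ty q) (shape S))"
proof (induction "card (universe S)" arbitrary: S rule: less_induct)
  case less
  note F = less.prems
  let ?r = "less_rel S"
  have fin: "finite (universe S)" using F by (simp add: forest0_def)
  have one: "ty q 0 (dcone S x) ?r (\<lambda>_. {}) = tree_ty q (Node (shape (substruct S (below S x))))" if x: "x \<in> roots S" for x
  proof -
    have xU: "x \<in> universe S" by (rule rootsD[OF x])
    have "card (universe (substruct S (below S x))) < card (universe S)"
      using card_below[of S x] F xU by (simp add: forest0_def)
    then have IH: "ty q 0 (below S x) (?r \<inter> below S x \<times> below S x) (\<lambda>_. {}) = msum q (image_mset (tree_ty q) (shape (substruct S (below S x))))"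
      using less.hyps[of "substruct S (below S x)"] forest0_substruct[OF F below_subset] by simp
    have "ty q 0 (below S x) ?r (\<lambda>_. {}) = ty q 0 (below S x) (?r \<inter> below S x \<times> below S x) (\<lambda>_. {})"
      by (rule ty_cong) auto
    moreover have "ty q 0 (insert x (below S x)) ?r (\<lambda>_. {}) = add_top q 0 {i. i < 0 \<and> x \<in> (\<lambda>_. {}) i} (ty q 0 (below S x) ?r (\<lambda>i. {} \<inter> below S x))"
    proof (rule ty_add_top)
      show "finite (below S x)" using fin by (simp add: below_def)
      show "x \<notin> below S x" using x by (auto simp: roots_def below_def)
    qed (use x in \<open>auto simp: roots_def below_def\<close>)
    ultimately show ?thesis using IH by (simp add: dcone_def)
  qed
  have "ty q 0 (\<Union>x\<in>A. dcone S x) ?r (\<lambda>_. {}) = msum q (\<Sum>x\<in>A. {#tree_ty q (Node (shape (substruct S (below S x))))#})"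
    if "finite A" "A \<subseteq> roots S" for A
    using that
  proof (induction A rule: finite_induct)
    case empty
    then show ?case by (simp add: ty_empty)
  next
    case (insert x A)
    have x: "x \<in> roots S" and A: "A \<subseteq> roots S" using insert.prems by auto
    have finc: "finite (dcone S y)" for y using fin by (simp add: dcone_def below_def)
    have "ty q 0 (dcone S x \<union> (\<Union>x\<in>A. dcone S x)) ?r (\<lambda>_. {}) =
        add q (ty q 0 (dcone S x) ?r (\<lambda>i. {} \<inter> dcone S x)) (ty q 0 (\<Union>x\<in>A. dcone S x) ?r (\<lambda>i. {} \<inter> (\<Union>x\<in>A. dcone S x)))"
    proof (rule ty_union)
      show "dcone S x \<inter> (\<Union>x\<in>A. dcone S x) = {}" using cones_disjoint[OF F x] A insert(2) by blast
      show "(y, z) \<notin> ?r \<and> (z, y) \<notin> ?r" if yz: "y \<in> dcone S x" "z \<in> (\<Union>x\<in>A. dcone S x)" for y z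
      proof -
        obtain x' where x': "x' \<in> A" "z \<in> dcone S x'" using yz by blast
        have "x' \<in> roots S" "x' \<noteq> x" using x' A insert(2) by auto
        then have "z \<notin> dcone S x" "y \<notin> dcone S x'" using cones_disjoint[OF F x] x' yz by blast+
        then show ?thesis using cone_up[OF F x yz(1), of z] cone_up[OF F \<open>x' \<in> roots S\<close> x'(2), of y] by blast
      qed
    qed (use finc insert(1) in auto)
    then show ?case using insert one[OF x] A by simp
  qed
  from this[OF finite_roots[OF F]] have "ty q 0 (universe S) ?r (\<lambda>_. {}) = msum q (\<Sum>x\<in>roots S. {#tree_ty q (Node (shape (substruct S (below S x))))#})"
    by (simp flip: universe_cones[OF F])
  moreover have "image_mset (tree_ty q) (\<Sum>x\<in>A. {#g x#}) = (\<Sum>x\<in>A. {#tree_ty q (g x)#})" if "finite A" for A and g :: "'a \<Rightarrow> utree"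
    using that by (induction A rule: finite_induct) auto
  ultimately show ?case unfolding shape_unfold[OF F] using finite_roots[OF F] by simp
qed

text \<open>Obtained by realising \<open>M\<close> as the shape of a finite structure, whose type
  lies in the range.\<close>

lemma msum_in_types: "msum q (image_mset (tree_ty q) M) \<in> types q 0"
proof -
  obtain S :: "nat struct" where S: "forest0 S" "shape S = M" using shape_surj by blast
  then have "finite (universe S)" by (simp add: forest0_def)
  from ty_types[OF this, of q 0 "less_rel S" "\<lambda>_. {}"] show ?thesis unfolding ty_shape[OF S(1)] S(2) .
qed

lemma add_top_types: "x \<in> types q k \<Longrightarrow> R \<subseteq> {..<k} \<Longrightarrow> add_top q k R x \<in> types q k"
proof (induction q arbitrary: k R x)
  case 0
  then obtain A where A: "A \<subseteq> all_atoms k" "x = set_encode (to_nat ` A)" by auto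
  have "finite A" using A(1) finite_all_atoms by (rule finite_subset)
  then have "dec_atoms x = A" using A(2) by simp
  moreover have "A \<union> {Meet i j |i j. i \<in> R \<and> j \<in> R} \<union> {Two i |i. i \<in> R \<and> Meet i i \<in> A} \<union>
      {Below i j |i j. j \<in> R \<and> Meet i i \<in> A} \<subseteq> all_atoms k"
    using A(1) 0(2) by (auto simp: all_atoms_def)
  ultimately show ?case by auto
next
  case (Suc q)
  then obtain Y where Y: "Y \<subseteq> types q (Suc k)" "x = set_encode Y" by auto
  have "finite Y" using Y(1) finite_types by (rule finite_subset)
  then have "set_decode x = Y" using Y(2) by (simp add: set_encode_inverse)
  moreover have "add_top q (Suc k) R ` Y \<subseteq> types q (Suc k)"
    using Suc.prems(2) Y(1) by (intro image_subsetI Suc.IH) auto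
  moreover have "add_top q (Suc k) (insert k R) ` Y \<subseteq> types q (Suc k)"
    using Suc.prems(2) Y(1) by (intro image_subsetI Suc.IH) auto
  ultimately show ?case by simp
qed

lemma tree_ty_types: "tree_ty q t \<in> types q 0"
proof -
  obtain M where "t = Node M" by (cases t)
  then show ?thesis using add_top_types[OF msum_in_types[of q M], of "{}"] by simp
qed

text \<open>Choosing a set in \<open>n\<close> copies of a structure of type \<open>x\<close> means
  choosing one option of \<open>x\<close> per copy, and only the multiset of choices
  matters.\<close>

lemma decode_msum_replicate:
  "set_decode (msum (Suc q) (replicate_mset n x)) = msum q ` {m. size m = n \<and> set_mset m \<subseteq> set_decode x}"
proof (induction n)
  case 0
  have "{m. size m = 0 \<and> set_mset m \<subseteq> set_decode x} = {{#}}" by auto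
  then show ?case by (simp only: replicate_mset_0 msum_empty decode_zero_Suc image_insert image_empty)
next
  case (Suc n)
  have "set_decode (msum (Suc q) (replicate_mset (Suc n) x)) =
      case_prod (add q) ` (set_decode x \<times> msum q ` {m. size m = n \<and> set_mset m \<subseteq> set_decode x})"
    unfolding replicate_mset_Suc msum_add decode_add_Suc Suc ..
  also have "\<dots> = msum q ` {m. size m = Suc n \<and> set_mset m \<subseteq> set_decode x}" (is "?L = ?R")
  proof
    show "?L \<subseteq> ?R"
    proof
      fix u assume "u \<in> ?L"
      then obtain p where p: "u = case_prod (add q) p" "p \<in> set_decode x \<times> msum q ` {m. size m = n \<and> set_mset m \<subseteq> set_decode x}"
        by (rule imageE)
      obtain a b where "p = (a, b)" by (cases p)
      with p have ab: "a \<in> set_decode x" "b \<in> msum q ` {m. size m = n \<and> set_mset m \<subseteq> set_decode x}" "u = add q a b"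
        by (simp_all only: mem_Sigma_iff prod.case)
      then obtain m where "size m = n" "set_mset m \<subseteq> set_decode x" "b = msum q m" by blast
      then show "u \<in> ?R" using ab by (intro image_eqI[of _ _ "add_mset a m"]) simp_all
    qed
    show "?R \<subseteq> ?L"
    proof
      fix u assume "u \<in> ?R"
      then obtain m where m: "size m = Suc n" "set_mset m \<subseteq> set_decode x" "u = msum q m" by blast
      obtain a m' where "m = add_mset a m'" using m(1) by (metis size_eq_Suc_imp_eq_union)
      then show "u \<in> ?L" using m by (intro image_eqI[of _ _ "(a, msum q m')"]) auto
    qed
  qed
  finally show ?case .
qed

section \<open>Saturation of repeated types\<close>

lemma pigeonhole_mset:
  assumes "finite Z" "set_mset m \<subseteq> Z" "card Z * K < size m"
  shows "\<exists>a\<in>Z. K < count m a"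
proof (rule ccontr)
  assume "\<not> (\<exists>a\<in>Z. K < count m a)"
  then have "count m a \<le> K" if "a \<in> Z" for a using that by (meson not_le)
  then have "(\<Sum>a\<in>Z. count m a) \<le> card Z * K" using sum_bounded_above[of Z "count m" K] by simp
  moreover have "size m = (\<Sum>a\<in>set_mset m. count m a)" by (simp add: size_multiset_overloaded_eq)
  moreover have "\<dots> \<le> (\<Sum>a\<in>Z. count m a)" using assms by (intro sum_mono2) auto
  ultimately show False using assms(3) by linarith
qed

lemma msum_absorb:
  assumes "msum q (replicate_mset (Suc K) a) = msum q (replicate_mset K a)" "K \<le> count m a"
  shows "msum q (add_mset a m) = msum q m"
proof -
  have "replicate_mset K a \<subseteq># m" using assms(2) by (simp add: count_le_replicate_mset_subset_eq)
  then obtain m' where m: "m = m' + replicate_mset K a" by (metis subset_mset.le_iff_add add.commute)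
  have "add_mset a m = m' + replicate_mset (Suc K) a" by (simp add: m)
  then show ?thesis using msum_cong_union[OF assms(1), of m'] m by simp
qed

text \<open>Monadic second-order logic cannot count copies beyond a threshold.\<close>

lemma aperiodic: "\<exists>K. \<forall>x\<in>types q k. msum q (replicate_mset (Suc K) x) = msum q (replicate_mset K x)"
proof (induction q arbitrary: k)
  case 0
  \<comment> \<open>Atoms distinguish none, one and at least two, so two copies already
    saturate.\<close>
  have "msum 0 (replicate_mset (Suc 2) x) = msum 0 (replicate_mset 2 x)" for x
  proof -
    have "add_atoms A (add_atoms A (add_atoms A {})) = add_atoms A (add_atoms A {})" for A
      by (auto simp: add_atoms_def)
    moreover have "dec_atoms (set_encode {}) = {}" by (simp add: dec_atoms_def set_encode_inverse)
    ultimately show ?thesis by (simp add: numeral_2_eq_2)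
  qed
  then show ?case by blast
next
  case (Suc q)
  let ?Z = "types q (Suc k)"
  obtain K where K: "\<And>x. x \<in> ?Z \<Longrightarrow> msum q (replicate_mset (Suc K) x) = msum q (replicate_mset K x)"
    using Suc[of "Suc k"] by blast
  \<comment> \<open>Among more than \<open>card ?Z * K\<close> options one occurs more than
    \<open>K\<close> times, and by induction a copy of it may be removed or added.\<close>
  define n where "n = Suc (card ?Z * K)"
  have "msum (Suc q) (replicate_mset (Suc n) x) = msum (Suc q) (replicate_mset n x)" if x: "x \<in> types (Suc q) k" for x
  proof -
    have sub: "set_decode x \<subseteq> ?Z"
    proof -
      obtain Y where "Y \<subseteq> ?Z" "x = set_encode Y" using x by auto
      then show ?thesis using finite_types finite_subset by (metis set_encode_inverse)
    qed
    let ?M = "\<lambda>n. {m. size m = n \<and> set_mset m \<subseteq> set_decode x}"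
    have "msum q ` ?M (Suc n) = msum q ` ?M n"
    proof
      show "msum q ` ?M (Suc n) \<subseteq> msum q ` ?M n"
      proof
        fix u assume "u \<in> msum q ` ?M (Suc n)"
        then obtain m where m: "size m = Suc n" "set_mset m \<subseteq> set_decode x" "u = msum q m" by blast
        then obtain a where a: "a \<in> ?Z" "K < count m a"
          using pigeonhole_mset[OF finite_types, of m q "Suc k" K] sub by (auto simp: n_def)
        then obtain m' where m': "m = add_mset a m'" by (metis count_greater_zero_iff gr_zeroI multi_member_split not_less0)
        then have "K \<le> count m' a" using a by simp
        then have "msum q m = msum q m'" unfolding m' by (rule msum_absorb[OF K[OF a(1)]])
        then show "u \<in> msum q ` ?M n" using m m' by (intro image_eqI[of _ _ m']) auto
      qed
      show "msum q ` ?M n \<subseteq> msum q ` ?M (Suc n)"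
      proof
        fix u assume "u \<in> msum q ` ?M n"
        then obtain m where m: "size m = n" "set_mset m \<subseteq> set_decode x" "u = msum q m" by blast
        then obtain a where a: "a \<in> ?Z" "K < count m a"
          using pigeonhole_mset[OF finite_types, of m q "Suc k" K] sub by (auto simp: n_def)
        then have "a \<in># m" by (metis count_greater_zero_iff gr_zeroI not_less0)
        moreover have "msum q (add_mset a m) = msum q m" using msum_absorb[OF K[OF a(1)]] a(2) by simp
        ultimately show "u \<in> msum q ` ?M (Suc n)" using m by (intro image_eqI[of _ _ "add_mset a m"]) auto
      qed
    qed
    then have "set_decode (msum (Suc q) (replicate_mset (Suc n) x)) = set_decode (msum (Suc q) (replicate_mset n x))"
      by (simp only: decode_msum_replicate)
    then show ?thesis by (metis set_decode_inverse)
  qed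
  then show ?case by blast
qed

text \<open>Where the counts differ, both are at least \<open>K\<close>; a surplus copy is absorbed
  and the total size drops.\<close>

lemma msum_capped:
  assumes K: "\<And>a. a \<in> Z \<Longrightarrow> msum q (replicate_mset (Suc K) a) = msum q (replicate_mset K a)"
  shows "set_mset m \<subseteq> Z \<Longrightarrow> set_mset m' \<subseteq> Z \<Longrightarrow> (\<And>a. min K (count m a) = min K (count m' a)) \<Longrightarrow> msum q m = msum q m'"
proof (induction "size m + size m'" arbitrary: m m' rule: less_induct)
  case less
  have red: "msum q m1 = msum q m2"
    if m: "size m1 + size m2 = size m + size m'" "set_mset m1 \<subseteq> Z" "set_mset m2 \<subseteq> Z" "\<And>a. min K (count m1 a) = min K (count m2 a)"
      and a: "count m1 a < count m2 a" for m1 m2 a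
  proof -
    obtain n where n: "m2 = add_mset a n" using a by (metis count_greater_zero_iff gr_zeroI multi_member_split not_less0)
    have Kle: "K \<le> count m1 a" using m(4)[of a] a by (auto simp: min_def split: if_splits)
    then have "K \<le> count n a" using a n by simp
    then have eq: "msum q m2 = msum q n" unfolding n using m(3) n by (intro msum_absorb[OF K]) auto
    have "msum q m1 = msum q n"
    proof (rule less.hyps)
      show "size m1 + size n < size m + size m'" using m(1) n by simp
      show "min K (count m1 b) = min K (count n b)" for b
        using m(4)[of b] n Kle \<open>K \<le> count n a\<close> by (cases "b = a") auto
    qed (use m n in auto)
    then show ?thesis using eq by simp
  qed
  show ?case
  proof (cases "m = m'")
    case False
    then obtain a where "count m a \<noteq> count m' a" by (meson multiset_eqI)
    then consider "count m a < count m' a" | "count m' a < count m a" by linarith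
    then show ?thesis
    proof cases
      case 1
      then show ?thesis using red[of m m' a] less.prems by auto
    next
      case 2
      then show ?thesis using red[of m' m a] less.prems by (auto simp: add.commute)
    qed
  qed simp
qed

section \<open>Equal types satisfy the same formulas\<close>

lemma atoms_restrict:
  "atoms k r P = {a \<in> atoms (Suc k) r (P(k := B)). case a of Meet i j \<Rightarrow> i < k \<and> j < k | Below i j \<Rightarrow> i < k \<and> j < k | Two i \<Rightarrow> i < k}"
proof (rule set_eqI)
  fix a show "a \<in> atoms k r P \<longleftrightarrow> a \<in> {a \<in> atoms (Suc k) r (P(k := B)). case a of Meet i j \<Rightarrow> i < k \<and> j < k | Below i j \<Rightarrow> i < k \<and> j < k | Two i \<Rightarrow> i < k}"
    by (cases a) auto
qed

text \<open>The answering move of the Ehrenfeucht--Fraisse game.\<close>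

lemma ty_Suc_ex:
  assumes "finite U" "finite U'" "ty (Suc q) k U r P = ty (Suc q) k U' r' P'" "B \<subseteq> U"
  shows "\<exists>B'\<subseteq>U'. ty q (Suc k) U r (P(k := B)) = ty q (Suc k) U' r' (P'(k := B'))"
proof -
  have "(\<lambda>B. ty q (Suc k) U r (P(k := B))) ` Pow U = (\<lambda>B. ty q (Suc k) U' r' (P'(k := B))) ` Pow U'"
    using assms(1-3) by (simp add: set_encode_eq)
  moreover have "ty q (Suc k) U r (P(k := B)) \<in> (\<lambda>B. ty q (Suc k) U r (P(k := B))) ` Pow U" using assms(4) by blast
  ultimately show ?thesis by blast
qed

text \<open>The remaining depth is spent on dummy moves with the empty set; restriction then
  recovers the atoms of the old sets.\<close>

lemma ty_atoms:
  assumes "finite U" "finite U'"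
  shows "ty q k U r P = ty q k U' r' P' \<Longrightarrow> atoms k r P = atoms k r' P'"
proof (induction q arbitrary: k P P')
  case 0
  then show ?case using dec_atoms_encode[OF finite_atoms] by (metis ty.simps(1))
next
  case (Suc q)
  obtain B' where "B' \<subseteq> U'" "ty q (Suc k) U r (P(k := {})) = ty q (Suc k) U' r' (P'(k := B'))"
    using ty_Suc_ex[OF assms Suc.prems, of "{}"] by blast
  then have "atoms (Suc k) r (P(k := {})) = atoms (Suc k) r' (P'(k := B'))" using Suc.IH by blast
  then show ?case using atoms_restrict[of k r P "{}"] atoms_restrict[of k r' P' B'] by simp
qed

text \<open>\<open>\<rho>\<close> and \<open>\<sigma>\<close> place element and set variables among
  the \<open>k\<close> distinguished sets, elements as singletons.\<close>

definition env_ok :: "nat \<Rightarrow> (nat \<Rightarrow> 'a set) \<Rightarrow> (nat \<Rightarrow> nat) \<Rightarrow> (nat \<Rightarrow> nat) \<Rightarrow> (nat \<Rightarrow> 'a) \<Rightarrow> (nat \<Rightarrow> 'a set) \<Rightarrow> nat set \<Rightarrow> nat set \<Rightarrow> bool" where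
  "env_ok k P \<rho> \<sigma> v V E F \<longleftrightarrow> (\<forall>x\<in>E. \<rho> x < k \<and> P (\<rho> x) = {v x}) \<and> (\<forall>X\<in>F. \<sigma> X < k \<and> P (\<sigma> X) = V X)"

lemma env_ok_elem: "env_ok k P \<rho> \<sigma> v V (E - {x}) F \<Longrightarrow> env_ok (Suc k) (P(k := {a})) (\<rho>(x := k)) \<sigma> (v(x := a)) V E F"
  by (auto simp: env_ok_def less_Suc_eq)

lemma env_ok_set: "env_ok k P \<rho> \<sigma> v V E (F - {X}) \<Longrightarrow> env_ok (Suc k) (P(k := B)) \<rho> (\<sigma>(X := k)) v (V(X := B)) E F"
  by (auto simp: env_ok_def less_Suc_eq)

lemma env_ok_mono: "env_ok k P \<rho> \<sigma> v V E F \<Longrightarrow> E' \<subseteq> E \<Longrightarrow> F' \<subseteq> F \<Longrightarrow> env_ok k P \<rho> \<sigma> v V E' F'"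
  by (auto simp: env_ok_def)

text \<open>\<open>Meet k k\<close> and the failure of \<open>Two k\<close> characterise singletons
  at position \<open>k\<close>.\<close>

lemma singleton_transfer:
  assumes "finite U" "finite U'" "ty q (Suc k) U r (P(k := {a})) = ty q (Suc k) U' r' (P'(k := B'))"
  shows "\<exists>a'. B' = {a'}"
proof -
  have at: "atoms (Suc k) r (P(k := {a})) = atoms (Suc k) r' (P'(k := B'))" by (rule ty_atoms[OF assms])
  have "Meet k k \<in> atoms (Suc k) r (P(k := {a}))" "Two k \<notin> atoms (Suc k) r (P(k := {a}))" by simp_all
  then have "B' \<noteq> {}" "\<forall>x\<in>B'. \<forall>y\<in>B'. x = y" unfolding at by simp_all
  then show ?thesis by blast
qed

text \<open>An element quantifier is played as a set move with a singleton, whose answer is again a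
  singleton. A quantified variable always gets the new position \<open>k\<close>, so shadowing
  causes no conflict.\<close>

lemma sat_ty:
  fixes r :: "'a rel" and r' :: "'b rel"
  assumes fin: "finite U" "finite U'"
  shows "ty q k U r P = ty q k U' r' P' \<Longrightarrow> qdepth \<phi> \<le> q \<Longrightarrow>
    env_ok k P \<rho> \<sigma> v V (fv_elem \<phi>) (fv_set \<phi>) \<Longrightarrow> env_ok k P' \<rho> \<sigma> v' V' (fv_elem \<phi>) (fv_set \<phi>) \<Longrightarrow>
    sat (U, r) v V \<phi> \<longleftrightarrow> sat (U', r') v' V' \<phi>"
proof (induction \<phi> arbitrary: q k P P' \<rho> \<sigma> v V v' V')
  case (Less x y)
  have "atoms k r P = atoms k r' P'" by (rule ty_atoms[OF fin Less.prems(1)])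
  then have "Below (\<rho> x) (\<rho> y) \<in> atoms k r P \<longleftrightarrow> Below (\<rho> x) (\<rho> y) \<in> atoms k r' P'" by simp
  moreover have "\<rho> x < k" "\<rho> y < k" "P (\<rho> x) = {v x}" "P (\<rho> y) = {v y}" "P' (\<rho> x) = {v' x}" "P' (\<rho> y) = {v' y}"
    using Less.prems(3,4) by (simp_all add: env_ok_def)
  ultimately have "(v x, v y) \<in> r \<longleftrightarrow> (v' x, v' y) \<in> r'" by simp
  then show ?case by simp
next
  case (Equal x y)
  have "atoms k r P = atoms k r' P'" by (rule ty_atoms[OF fin Equal.prems(1)])
  then have "Meet (\<rho> x) (\<rho> y) \<in> atoms k r P \<longleftrightarrow> Meet (\<rho> x) (\<rho> y) \<in> atoms k r' P'" by simp
  moreover have "\<rho> x < k" "\<rho> y < k" "P (\<rho> x) = {v x}" "P (\<rho> y) = {v y}" "P' (\<rho> x) = {v' x}" "P' (\<rho> y) = {v' y}"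
    using Equal.prems(3,4) by (simp_all add: env_ok_def)
  ultimately have "{v x} \<inter> {v y} \<noteq> {} \<longleftrightarrow> {v' x} \<inter> {v' y} \<noteq> {}" by (simp only: atoms_iff simp_thms)
  moreover have "{a} \<inter> {b} \<noteq> {} \<longleftrightarrow> a = b" for a b :: 'a by auto
  moreover have "{a} \<inter> {b} \<noteq> {} \<longleftrightarrow> a = b" for a b :: 'b by auto
  ultimately show ?case by (simp only: sat.simps)
next
  case (Member x X)
  have "atoms k r P = atoms k r' P'" by (rule ty_atoms[OF fin Member.prems(1)])
  then have "Meet (\<rho> x) (\<sigma> X) \<in> atoms k r P \<longleftrightarrow> Meet (\<rho> x) (\<sigma> X) \<in> atoms k r' P'" by simp
  then show ?case using Member.prems(3,4) by (simp add: env_ok_def)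
next
  case (Neg \<phi>)
  then show ?case using Neg.IH[OF Neg.prems(1)] by simp
next
  case (Conj \<phi> \<psi>)
  have "sat (U, r) v V \<phi> \<longleftrightarrow> sat (U', r') v' V' \<phi>"
    by (rule Conj.IH(1)[OF Conj.prems(1) _ env_ok_mono[OF Conj.prems(3)] env_ok_mono[OF Conj.prems(4)]])
      (use Conj.prems(2) in simp_all)
  moreover have "sat (U, r) v V \<psi> \<longleftrightarrow> sat (U', r') v' V' \<psi>"
    by (rule Conj.IH(2)[OF Conj.prems(1) _ env_ok_mono[OF Conj.prems(3)] env_ok_mono[OF Conj.prems(4)]])
      (use Conj.prems(2) in simp_all)
  ultimately show ?case by simp
next
  case (Ex_elem x \<phi>)
  obtain q' where q: "q = Suc q'" "qdepth \<phi> \<le> q'" using Ex_elem.prems(2) by (cases q) auto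
  have eq: "ty (Suc q') k U r P = ty (Suc q') k U' r' P'" using Ex_elem.prems(1) q by simp
  have e1: "env_ok k P \<rho> \<sigma> v V (fv_elem \<phi> - {x}) (fv_set \<phi>)" and e2: "env_ok k P' \<rho> \<sigma> v' V' (fv_elem \<phi> - {x}) (fv_set \<phi>)"
    using Ex_elem.prems(3,4) by simp_all
  have key: "sat (U, r) (v(x := a)) V \<phi> \<longleftrightarrow> sat (U', r') (v'(x := a')) V' \<phi>"
    if "ty q' (Suc k) U r (P(k := {a})) = ty q' (Suc k) U' r' (P'(k := {a'}))" for a a'
    by (rule Ex_elem.IH[OF that q(2) env_ok_elem[OF e1] env_ok_elem[OF e2]])
  show ?case
  proof
    assume "sat (U, r) v V (Ex_elem x \<phi>)"
    then obtain a where a: "a \<in> U" "sat (U, r) (v(x := a)) V \<phi>" by auto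
    obtain B' where B': "B' \<subseteq> U'" "ty q' (Suc k) U r (P(k := {a})) = ty q' (Suc k) U' r' (P'(k := B'))"
      using ty_Suc_ex[OF fin eq, of "{a}"] a(1) by blast
    obtain a' where a': "B' = {a'}" using singleton_transfer[OF fin B'(2)] by blast
    have "sat (U', r') (v'(x := a')) V' \<phi>" using key[OF B'(2)[unfolded a']] a(2) by simp
    then show "sat (U', r') v' V' (Ex_elem x \<phi>)" using B'(1) a' by auto
  next
    assume "sat (U', r') v' V' (Ex_elem x \<phi>)"
    then obtain a' where a': "a' \<in> U'" "sat (U', r') (v'(x := a')) V' \<phi>" by auto
    obtain B where B: "B \<subseteq> U" "ty q' (Suc k) U' r' (P'(k := {a'})) = ty q' (Suc k) U r (P(k := B))"
      using ty_Suc_ex[OF fin(2,1) eq[symmetric], of "{a'}"] a'(1) by blast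
    obtain a where a: "B = {a}" using singleton_transfer[OF fin(2,1) B(2)] by blast
    have "sat (U, r) (v(x := a)) V \<phi>" using key[OF B(2)[unfolded a, symmetric]] a'(2) by simp
    then show "sat (U, r) v V (Ex_elem x \<phi>)" using B(1) a by auto
  qed
next
  case (Ex_set X \<phi>)
  obtain q' where q: "q = Suc q'" "qdepth \<phi> \<le> q'" using Ex_set.prems(2) by (cases q) auto
  have eq: "ty (Suc q') k U r P = ty (Suc q') k U' r' P'" using Ex_set.prems(1) q by simp
  have e1: "env_ok k P \<rho> \<sigma> v V (fv_elem \<phi>) (fv_set \<phi> - {X})" and e2: "env_ok k P' \<rho> \<sigma> v' V' (fv_elem \<phi>) (fv_set \<phi> - {X})"
    using Ex_set.prems(3,4) by simp_all
  have key: "sat (U, r) v (V(X := B)) \<phi> \<longleftrightarrow> sat (U', r') v' (V'(X := B')) \<phi>"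
    if "ty q' (Suc k) U r (P(k := B)) = ty q' (Suc k) U' r' (P'(k := B'))" for B B'
    by (rule Ex_set.IH[OF that q(2) env_ok_set[OF e1] env_ok_set[OF e2]])
  show ?case
  proof
    assume "sat (U, r) v V (Ex_set X \<phi>)"
    then obtain B where B: "B \<subseteq> U" "sat (U, r) v (V(X := B)) \<phi>" by auto
    obtain B' where B': "B' \<subseteq> U'" "ty q' (Suc k) U r (P(k := B)) = ty q' (Suc k) U' r' (P'(k := B'))"
      using ty_Suc_ex[OF fin eq B(1)] by blast
    then show "sat (U', r') v' V' (Ex_set X \<phi>)" using key[OF B'(2)] B(2) by auto
  next
    assume "sat (U', r') v' V' (Ex_set X \<phi>)"
    then obtain B' where B': "B' \<subseteq> U'" "sat (U', r') v' (V'(X := B')) \<phi>" by auto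
    obtain B where B: "B \<subseteq> U" "ty q' (Suc k) U' r' (P'(k := B')) = ty q' (Suc k) U r (P(k := B))"
      using ty_Suc_ex[OF fin(2,1) eq[symmetric] B'(1)] by blast
    then show "sat (U, r) v V (Ex_set X \<phi>)" using key[OF B(2)[symmetric]] B'(2) by auto
  qed
qed

text \<open>Independence of the assignment is \<open>sat_ty\<close> with both structures equal and
  no distinguished sets. Nonemptiness matters: without assignments into the universe
  \<open>models\<close> would hold vacuously.\<close>

lemma models_iff_sat:
  fixes S :: "'a struct"
  assumes "sentence \<phi>" "is_forest S"
  shows "S \<Turnstile> \<phi> \<longleftrightarrow> sat S v V \<phi>"
proof -
  obtain u where u: "u \<in> universe S" using assms(2) by (auto simp: is_forest_iff)
  have fin: "finite (universe S)" using assms(2) by (simp add: is_forest_iff forest0_def)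
  have "sat S v V \<phi> \<longleftrightarrow> sat S v' V' \<phi>" for v v' V V'
  proof -
    have "sat (universe S, less_rel S) v V \<phi> \<longleftrightarrow> sat (universe S, less_rel S) v' V' \<phi>"
      by (rule sat_ty[where q = "qdepth \<phi>" and k = 0 and P = "\<lambda>_. {}" and P' = "\<lambda>_. {}" and \<rho> = "\<lambda>_. 0" and \<sigma> = "\<lambda>_. 0", OF fin fin])
        (use assms(1) in \<open>simp_all add: env_ok_def sentence_def\<close>)
    then show ?thesis by simp
  qed
  moreover have "range (\<lambda>_ :: nat. u) \<subseteq> universe S" "\<forall>X :: nat. (\<lambda>_. {}) X \<subseteq> universe S" using u by auto
  ultimately show ?thesis unfolding models_def by blast
qed

text \<open>The interface between logic and counting: one typing and one threshold serve both the
  passage from children to parent and the decision of \<open>\<phi>\<close> on whole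
  forests.\<close>

theorem mso_profile:
  assumes "sentence \<phi>"
  shows "\<exists>tyof K. tree_typing tyof K \<and>
    (\<forall>(S :: nat struct) (S' :: nat struct). is_forest S \<longrightarrow> is_forest S' \<longrightarrow>
      (\<forall>a. min K (count (image_mset tyof (shape S)) a) = min K (count (image_mset tyof (shape S')) a)) \<longrightarrow>
      (S \<Turnstile> \<phi>) = (S' \<Turnstile> \<phi>))"
proof -
  let ?q = "qdepth \<phi>"
  let ?t = "tree_ty ?q"
  obtain K where K: "\<And>x. x \<in> types ?q 0 \<Longrightarrow> msum ?q (replicate_mset (Suc K) x) = msum ?q (replicate_mset K x)"
    using aperiodic[of ?q 0] by blast
  have cap: "msum ?q (image_mset ?t M) = msum ?q (image_mset ?t N)"
    if "\<And>a. min K (count (image_mset ?t M) a) = min K (count (image_mset ?t N) a)" for M N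
    by (rule msum_capped[OF K]) (use that tree_ty_types in auto)
  have tt: "tree_typing ?t K"
  proof
    have "range ?t \<subseteq> types ?q 0" using tree_ty_types by blast
    then show "finite (range ?t)" using finite_types by (rule finite_subset)
    show "?t (Node M) = ?t (Node N)"
      if "\<And>a. min K (count (image_mset ?t M) a) = min K (count (image_mset ?t N) a)" for M N
      using cap[OF that] by simp
  qed
  have md: "(S \<Turnstile> \<phi>) = (S' \<Turnstile> \<phi>)"
    if S: "is_forest S" "is_forest S'"
      and eq: "\<forall>a. min K (count (image_mset ?t (shape S)) a) = min K (count (image_mset ?t (shape S')) a)"
    for S S' :: "nat struct"
  proof -
    have F: "forest0 S" "forest0 S'" using S by (simp_all add: is_forest_iff)
    have fin: "finite (universe S)" "finite (universe S')" using F by (simp_all add: forest0_def)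
    have "ty ?q 0 (universe S) (less_rel S) (\<lambda>_. {}) = ty ?q 0 (universe S') (less_rel S') (\<lambda>_. {})"
      unfolding ty_shape[OF F(1)] ty_shape[OF F(2)] by (rule cap) (simp only: eq)
    then have "sat (universe S, less_rel S) v V \<phi> \<longleftrightarrow> sat (universe S', less_rel S') v V \<phi>" for v V
      by (rule sat_ty[where \<rho> = "\<lambda>_. 0" and \<sigma> = "\<lambda>_. 0", OF fin]) (use assms in \<open>simp_all add: env_ok_def sentence_def\<close>)
    then have "sat S v V \<phi> \<longleftrightarrow> sat S' v V \<phi>" for v V by simp
    then show ?thesis using models_iff_sat[OF assms S(1)] models_iff_sat[OF assms S(2)] by blast
  qed
  have all: "\<forall>(S :: nat struct) (S' :: nat struct). is_forest S \<longrightarrow> is_forest S' \<longrightarrow>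
      (\<forall>a. min K (count (image_mset ?t (shape S)) a) = min K (count (image_mset ?t (shape S')) a)) \<longrightarrow>
      (S \<Turnstile> \<phi>) = (S' \<Turnstile> \<phi>)"
  proof (rule allI, rule allI, rule impI, rule impI, rule impI)
    fix S S' :: "nat struct"
    assume "is_forest S" "is_forest S'"
      "\<forall>a. min K (count (image_mset ?t (shape S)) a) = min K (count (image_mset ?t (shape S')) a)"
    then show "(S \<Turnstile> \<phi>) = (S' \<Turnstile> \<phi>)" by (rule md)
  qed
  show ?thesis by (rule exI[of _ ?t], rule exI[of _ K], rule conjI[OF tt all])
qed

section \<open>Counting isomorphism types\<close>

lemma card_image_eq_kernels:
  assumes "\<And>x y. x \<in> A \<Longrightarrow> y \<in> A \<Longrightarrow> f x = f y \<longleftrightarrow> g x = g y"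
  shows "card (f ` A) = card (g ` A)"
proof (rule bij_betw_same_card)
  define h where "h = (\<lambda>z. g (SOME x. x \<in> A \<and> f x = z))"
  have h: "h (f x) = g x" if "x \<in> A" for x
  proof -
    have "(SOME y. y \<in> A \<and> f y = f x) \<in> A \<and> f (SOME y. y \<in> A \<and> f y = f x) = f x"
      by (rule someI[of "\<lambda>y. y \<in> A \<and> f y = f x" x]) (use that in simp)
    then show ?thesis unfolding h_def using assms that by blast
  qed
  show "bij_betw h (f ` A) (g ` A)"
    unfolding bij_betw_def
  proof
    show "inj_on h (f ` A)" using h assms by (auto simp: inj_on_def)
    show "h ` f ` A = g ` A" using h by (simp add: image_image cong: image_cong)
  qed
qed

lemma struct_iso_refl: "S \<simeq>\<^sub>s S"
  unfolding struct_iso_def by (intro exI[of _ id]) auto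

lemma struct_iso_trans:
  assumes "S \<simeq>\<^sub>s S'" "S' \<simeq>\<^sub>s S''" shows "S \<simeq>\<^sub>s S''"
proof -
  obtain h h' where h: "iso_via h S S'" "iso_via h' S' S''" using assms by (auto simp: struct_iso_via)
  have "iso_via (h' \<circ> h) S S''"
    unfolding iso_via_def
  proof (intro conjI ballI)
    show "bij_betw (h' \<circ> h) (universe S) (universe S'')"
      using h bij_betw_trans[of h "universe S" "universe S'" h' "universe S''"] by (simp add: iso_via_def)
    fix x y assume xy: "x \<in> universe S" "y \<in> universe S"
    then have "h x \<in> universe S'" "h y \<in> universe S'" using h(1) by (auto simp: iso_via_def bij_betw_def)
    then show "(x, y) \<in> less_rel S \<longleftrightarrow> ((h' \<circ> h) x, (h' \<circ> h) y) \<in> less_rel S''"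
      using h xy by (simp add: iso_via_def)
  qed
  then show ?thesis by (auto simp: struct_iso_via)
qed

lemma iso_iff_shape:
  assumes "is_forest S" "is_forest S'"
  shows "S \<simeq>\<^sub>s S' \<longleftrightarrow> shape S = shape S'"
proof -
  have F: "forest0 S" "forest0 S'" using assms by (simp_all add: is_forest_iff)
  show ?thesis using shape_iso_via[of _ S S'] iso_of_shape[OF F] F by (auto simp: struct_iso_via)
qed

lemma count_types_shape:
  assumes "\<And>S. S \<in> \<C> \<Longrightarrow> is_forest S"
  shows "count_types \<C> n = card {M \<in> shape ` \<C>. wt nodes M = n}"
proof -
  let ?A = "{S \<in> \<C>. size_of S = n}" and ?R = "{(S, S'). S \<simeq>\<^sub>s S'} :: (nat struct \<times> nat struct) set"
  have "?A // ?R = (\<lambda>S. ?R `` {S}) ` ?A" by (auto simp: quotient_def)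
  moreover have "card ((\<lambda>S. ?R `` {S}) ` ?A) = card (shape ` ?A)"
  proof (rule card_image_eq_kernels)
    fix S S' assume a: "S \<in> ?A" "S' \<in> ?A"
    have "?R `` {S} = ?R `` {S'} \<longleftrightarrow> S \<simeq>\<^sub>s S'"
    proof
      assume "?R `` {S} = ?R `` {S'}"
      moreover have "S' \<in> ?R `` {S'}" using struct_iso_refl by simp
      ultimately show "S \<simeq>\<^sub>s S'" by blast
    next
      assume "S \<simeq>\<^sub>s S'"
      then show "?R `` {S} = ?R `` {S'}" using struct_iso_sym struct_iso_trans by blast
    qed
    then show "?R `` {S} = ?R `` {S'} \<longleftrightarrow> shape S = shape S'"
      using iso_iff_shape[OF assms[of S] assms[of S']] a by simp
  qed
  moreover have "shape ` ?A = {M \<in> shape ` \<C>. wt nodes M = n}"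
  proof -
    have "wt nodes (shape S) = size_of S" if "S \<in> \<C>" for S
      using wt_shape[of S] assms[OF that] by (simp add: is_forest_iff size_of_def)
    then show ?thesis by auto
  qed
  ultimately show ?thesis by (simp add: count_types_def)
qed

section \<open>Adequate classes as multisets of tree shapes\<close>

definition tree_shapes :: "nat struct set \<Rightarrow> utree set" where
  "tree_shapes \<F> = {t. {#t#} \<in> shape ` \<F>}"

lemma forest_of_shape: "M \<noteq> {#} \<Longrightarrow> \<exists>S :: nat struct. is_forest S \<and> shape S = M"
  using shape_surj[of M] shape_empty_iff by (metis is_forest_iff)

lemma tree_shape: "is_tree S \<Longrightarrow> \<exists>t. shape S = {#t#}"
  using size_1_singleton_mset[of "shape S"] by (simp add: is_tree_iff)

lemma tree_decomposition_shape:
  fixes S :: "nat struct"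
  assumes "is_forest S"
  shows "\<exists>Ts :: nat struct list. Ts \<noteq> [] \<and> (\<forall>T\<in>set Ts. is_tree T) \<and> S \<simeq>\<^sub>s struct_sum Ts \<and>
    shape S = (\<Sum>T\<leftarrow>Ts. shape T)"
proof -
  obtain Ts :: "nat struct list" where Ts: "Ts \<noteq> []" "\<forall>T\<in>set Ts. is_tree T" "S \<simeq>\<^sub>s struct_sum Ts"
    using forest_tree_decomposition[OF assms] by blast
  have F: "T \<in> set Ts \<Longrightarrow> forest0 T" for T using Ts(2) by (simp add: is_tree_iff)
  obtain h where "iso_via h S (struct_sum Ts)" using Ts(3) by (auto simp: struct_iso_via)
  then have "shape S = shape (struct_sum Ts)"
    using assms forest0_struct_sum[of Ts, OF F] by (intro shape_iso_via[of h]) (auto simp: is_forest_iff)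
  then have "shape S = (\<Sum>T\<leftarrow>Ts. shape T)" using shape_struct_sum[of Ts, OF F] by simp
  then show ?thesis using Ts by (intro exI[of _ Ts] conjI)
qed

lemma in_sum_list_mset: "x \<in># sum_list Ms \<longleftrightarrow> (\<exists>M\<in>set Ms. x \<in># M)"
  by (induction Ms) auto

text \<open>Closure under components gives one inclusion, closure under sums the other; the empty
  multiset drops out because forests are nonempty.\<close>

lemma forest_shapes:
  assumes ad: "adequate \<F>"
  shows "shape ` \<F> = msets (tree_shapes \<F>) - {{#}}"
proof
  have fc: "forest_class \<F>" and cc: "closed_under_components \<F>" using ad by (simp_all add: adequate_def)
  have isF: "is_forest S" if "S \<in> \<F>" for S using fc that by (simp add: forest_class_def)
  show "shape ` \<F> \<subseteq> msets (tree_shapes \<F>) - {{#}}"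
  proof
    fix M assume "M \<in> shape ` \<F>"
    then obtain S where S: "S \<in> \<F>" "M = shape S" by blast
    obtain Ts :: "nat struct list" where Ts: "\<forall>T\<in>set Ts. is_tree T" "S \<simeq>\<^sub>s struct_sum Ts" "shape S = (\<Sum>T\<leftarrow>Ts. shape T)"
      using tree_decomposition_shape[OF isF[OF S(1)]] by blast
    have "t \<in> tree_shapes \<F>" if "t \<in># M" for t
    proof -
      obtain T where T: "T \<in> set Ts" "t \<in># shape T" using \<open>t \<in># M\<close> S(2) Ts(3) by (auto simp: in_sum_list_mset)
      obtain u where "shape T = {#u#}" using tree_shape Ts(1) T(1) by blast
      then have "shape T = {#t#}" using T(2) by simp
      moreover have "T \<in> \<F>" using cc S(1) Ts T(1) unfolding closed_under_components_def is_component_def by blast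
      ultimately show ?thesis by (force simp: tree_shapes_def)
    qed
    moreover have "M \<noteq> {#}" using shape_empty_iff[of S] isF[OF S(1)] S(2) by (simp add: is_forest_iff)
    ultimately show "M \<in> msets (tree_shapes \<F>) - {{#}}" by (auto simp: msets_def)
  qed
  show "msets (tree_shapes \<F>) - {{#}} \<subseteq> shape ` \<F>"
  proof
    fix M assume M: "M \<in> msets (tree_shapes \<F>) - {{#}}"
    then obtain S :: "nat struct" where S: "is_forest S" "shape S = M" using forest_of_shape[of M] by blast
    obtain Ts :: "nat struct list" where Ts: "Ts \<noteq> []" "\<forall>T\<in>set Ts. is_tree T" "S \<simeq>\<^sub>s struct_sum Ts" "shape S = (\<Sum>T\<leftarrow>Ts. shape T)"
      using tree_decomposition_shape[OF S(1)] by blast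
    have "T \<in> trees_of \<F>" if T: "T \<in> set Ts" for T
    proof -
      have tr: "is_tree T" using Ts(2) T by blast
      then obtain t where t: "shape T = {#t#}" using tree_shape by blast
      then have "t \<in># M" using T Ts(4) S(2) by (force simp: in_sum_list_mset)
      then have "{#t#} \<in> shape ` \<F>" using M by (auto simp: msets_def tree_shapes_def)
      then obtain T' where T': "T' \<in> \<F>" "shape T' = shape T" using t by auto
      have fT: "is_forest T" using tr by (simp add: is_tree_def)
      have "T' \<simeq>\<^sub>s T" using iso_iff_shape[OF isF[OF T'(1)] fT] T'(2) by simp
      moreover have "less_rel T \<subseteq> universe T \<times> universe T" using fT by (simp add: is_forest_iff forest0_def)
      ultimately have "T \<in> \<F>" using fc T'(1) unfolding forest_class_def by blast
      then show ?thesis using tr by (simp add: trees_of_def)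
    qed
    then have "S \<in> (\<ge>1)(trees_of \<F>)" using S(1) Ts unfolding sums_of_def by blast
    then show "M \<in> shape ` \<F>" using adequate_eq_sums_of_trees[OF ad] S(2) by blast
  qed
qed

lemma adequate_forests: "adequate \<F> \<Longrightarrow> S \<in> \<F> \<Longrightarrow> is_forest S"
  by (simp add: adequate_def forest_class_def)

text \<open>At positive \<open>n\<close> the empty multiset, which is the shape of no forest, is not
  counted on the right.\<close>

lemma count_types_forests:
  assumes ad: "adequate \<F>" and n: "n > 0"
  shows "real (count_types \<F> n) = cnt (wt nodes) (msets (tree_shapes \<F>)) n"
proof -
  have "{M \<in> shape ` \<F>. wt nodes M = n} = {M \<in> msets (tree_shapes \<F>). wt nodes M = n}"
    unfolding forest_shapes[OF ad] using n by auto
  then show ?thesis by (simp add: count_types_shape[OF adequate_forests[OF ad]] cnt_def)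
qed

lemma count_types_trees:
  assumes ad: "adequate \<F>"
  shows "real (count_types (trees_of \<F>) n) = cnt nodes (tree_shapes \<F>) n"
proof -
  have isF: "is_forest S" if "S \<in> trees_of \<F>" for S using that by (simp add: trees_of_def is_tree_def)
  have eq: "shape ` trees_of \<F> = (\<lambda>t. {#t#}) ` tree_shapes \<F>"
  proof
    show "shape ` trees_of \<F> \<subseteq> (\<lambda>t. {#t#}) ` tree_shapes \<F>"
    proof
      fix M assume "M \<in> shape ` trees_of \<F>"
      then obtain S where S: "S \<in> \<F>" "is_tree S" "M = shape S" by (auto simp: trees_of_def)
      then obtain t where t: "M = {#t#}" using tree_shape by blast
      then have "t \<in> tree_shapes \<F>" using imageI[OF S(1), of shape] S(3) by (simp add: tree_shapes_def)
      then show "M \<in> (\<lambda>t. {#t#}) ` tree_shapes \<F>" using t by blast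
    qed
    show "(\<lambda>t. {#t#}) ` tree_shapes \<F> \<subseteq> shape ` trees_of \<F>"
    proof
      fix M assume "M \<in> (\<lambda>t. {#t#}) ` tree_shapes \<F>"
      then obtain t where t: "t \<in> tree_shapes \<F>" "M = {#t#}" by blast
      then have "M \<in> shape ` \<F>" by (simp add: tree_shapes_def)
      then obtain S where S: "M = shape S" "S \<in> \<F>" by (rule imageE)
      have "size (shape S) = 1" using S(1)[symmetric] t(2) by simp
      then have "S \<in> trees_of \<F>" using adequate_forests[OF ad S(2)] S(2) by (simp add: is_tree_iff is_forest_iff trees_of_def)
      then show "M \<in> shape ` trees_of \<F>" using S(1) by (rule image_eqI[rotated])
    qed
  qed
  have "{M \<in> shape ` trees_of \<F>. wt nodes M = n} = (\<lambda>t. {#t#}) ` {t \<in> tree_shapes \<F>. nodes t = n}"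
    unfolding eq by auto
  then have "card {M \<in> shape ` trees_of \<F>. wt nodes M = n} = card {t \<in> tree_shapes \<F>. nodes t = n}"
    by (simp add: card_image inj_on_def)
  then show ?thesis by (simp add: count_types_shape[OF isF] cnt_def)
qed

lemma count_types_subclass:
  assumes ad: "adequate \<F>"
    and P: "\<And>S. S \<in> \<F> \<Longrightarrow> Q S \<longleftrightarrow> P (shape S)" and n: "n > 0"
  shows "count_types {S \<in> \<F>. Q S} n = card {M \<in> msets (tree_shapes \<F>). P M \<and> wt nodes M = n}"
proof -
  have "shape ` {S \<in> \<F>. Q S} = {M \<in> shape ` \<F>. P M}" using P by auto
  then have "{M \<in> shape ` {S \<in> \<F>. Q S}. wt nodes M = n} = {M \<in> msets (tree_shapes \<F>). P M \<and> wt nodes M = n}"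
    unfolding forest_shapes[OF ad] using n by auto
  then show ?thesis using count_types_shape[of "{S \<in> \<F>. Q S}" n] adequate_forests[OF ad] by simp
qed

text \<open>On one-tree forests the capped counts depend only on the type of the tree, so this type
  decides the defining sentence.\<close>

lemma tree_shapes_typing:
  assumes ad: "adequate \<F>" and mso: "mso_class \<F>"
  shows "\<exists>tyof K A. tree_typing tyof K \<and> tree_shapes \<F> = {t. tyof t \<in> A}"
proof -
  obtain \<phi> where \<phi>: "sentence \<phi>" "\<F> = {S. is_forest S \<and> S \<Turnstile> \<phi>}" using mso by (auto simp: mso_class_def)
  obtain tyof K where ty: "tree_typing tyof K"
    and pr: "\<forall>(S :: nat struct) (S' :: nat struct). is_forest S \<longrightarrow> is_forest S' \<longrightarrow>
      (\<forall>a. min K (count (image_mset tyof (shape S)) a) = min K (count (image_mset tyof (shape S')) a)) \<longrightarrow>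
      (S \<Turnstile> \<phi>) = (S' \<Turnstile> \<phi>)"
    using mso_profile[OF \<phi>(1)] by (elim exE conjE)
  have "tree_shapes \<F> = {t. tyof t \<in> tyof ` tree_shapes \<F>}"
  proof (intro equalityI subsetI)
    fix t assume "t \<in> {t. tyof t \<in> tyof ` tree_shapes \<F>}"
    then obtain u where u: "u \<in> tree_shapes \<F>" "tyof t = tyof u" by auto
    then obtain S where S: "S \<in> \<F>" "shape S = {#u#}" by (auto simp: tree_shapes_def)
    obtain S' :: "nat struct" where S': "is_forest S'" "shape S' = {#t#}" using forest_of_shape[of "{#t#}"] by auto
    have "(S \<Turnstile> \<phi>) = (S' \<Turnstile> \<phi>)"
    proof (rule pr[rule_format])
      show "is_forest S" using S(1) \<phi>(2) by blast
      show "min K (count (image_mset tyof (shape S)) a) = min K (count (image_mset tyof (shape S')) a)" for a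
        using S(2) S'(2) u(2) by simp
    qed (rule S'(1))
    then have "S' \<in> \<F>" using S(1) S'(1) \<phi>(2) by blast
    then show "t \<in> tree_shapes \<F>" using S'(2) by (force simp: tree_shapes_def)
  qed auto
  then show ?thesis using ty by blast
qed

section \<open>A sentence for having a given tree as a component\<close>

definition true_form :: mso where "true_form = Neg (Ex_elem 0 (Neg (Equal 0 0)))"

definition conj_list :: "mso list \<Rightarrow> mso" where "conj_list \<phi>s = foldr Conj \<phi>s true_form"

lemma sat_conj_list [simp]: "sat S v V (conj_list \<phi>s) \<longleftrightarrow> (\<forall>\<phi>\<in>set \<phi>s. sat S v V \<phi>)"
  by (induction \<phi>s) (auto simp: conj_list_def true_form_def)

lemma fv_conj_list [simp]: "fv_elem (conj_list \<phi>s) = (\<Union>\<phi>\<in>set \<phi>s. fv_elem \<phi>)" "fv_set (conj_list \<phi>s) = (\<Union>\<phi>\<in>set \<phi>s. fv_set \<phi>)"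
  by (induction \<phi>s) (auto simp: conj_list_def true_form_def)

lemma sat_Ex_list:
  "sat S v V (foldr Ex_elem xs \<phi>) \<longleftrightarrow> (\<exists>w. (\<forall>x\<in>set xs. w x \<in> universe S) \<and> (\<forall>x. x \<notin> set xs \<longrightarrow> w x = v x) \<and> sat S w V \<phi>)"
proof (induction xs arbitrary: v)
  case Nil
  have "w = v" if "\<forall>x. w x = v x" for w using that by blast
  then show ?case by auto
next
  case (Cons x xs)
  show ?case
  proof
    assume "sat S v V (foldr Ex_elem (x # xs) \<phi>)"
    then obtain a w where a: "a \<in> universe S" "\<forall>y\<in>set xs. w y \<in> universe S" "\<forall>y. y \<notin> set xs \<longrightarrow> w y = (v(x := a)) y" "sat S w V \<phi>"
      using Cons by auto
    then have "w x \<in> universe S" by (cases "x \<in> set xs") auto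
    then show "\<exists>w. (\<forall>y\<in>set (x # xs). w y \<in> universe S) \<and> (\<forall>y. y \<notin> set (x # xs) \<longrightarrow> w y = v y) \<and> sat S w V \<phi>"
      using a by (intro exI[of _ w]) auto
  next
    assume "\<exists>w. (\<forall>y\<in>set (x # xs). w y \<in> universe S) \<and> (\<forall>y. y \<notin> set (x # xs) \<longrightarrow> w y = v y) \<and> sat S w V \<phi>"
    then obtain w where w: "\<forall>y\<in>set (x # xs). w y \<in> universe S" "\<forall>y. y \<notin> set (x # xs) \<longrightarrow> w y = v y" "sat S w V \<phi>" by blast
    then have "\<forall>y. y \<notin> set xs \<longrightarrow> w y = (v(x := w x)) y" by auto
    then have sat1: "sat S (v(x := w x)) V (foldr Ex_elem xs \<phi>)" unfolding Cons[of "v(x := w x)"] using w by (intro exI[of _ w]) auto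
    have wx: "w x \<in> universe S" using w(1) by simp
    show "sat S v V (foldr Ex_elem (x # xs) \<phi>)"
      by (simp only: foldr.simps comp_apply sat.simps) (rule bexI[where x = "w x"], rule sat1, rule wx)
  qed
qed

lemma fv_Ex_list [simp]: "fv_elem (foldr Ex_elem xs \<phi>) = fv_elem \<phi> - set xs" "fv_set (foldr Ex_elem xs \<phi>) = fv_set \<phi>"
  by (induction xs) auto

text \<open>Says that the first \<open>m\<close> element variables induce a copy of \<open>r\<close> that is closed under comparability,
  that is, a union of components.\<close>

definition copy_form :: "nat \<Rightarrow> nat rel \<Rightarrow> mso" where
  "copy_form m r = conj_list [
     conj_list [if (i, j) \<in> r then Less i j else Neg (Less i j). i \<leftarrow> [0..<m], j \<leftarrow> [0..<m]],
     conj_list [Neg (Equal i j). i \<leftarrow> [0..<m], j \<leftarrow> [0..<i]],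
     Neg (Ex_elem m (Conj (conj_list [Neg (Equal m i). i \<leftarrow> [0..<m]])
       (Neg (conj_list [Conj (Neg (Less m i)) (Neg (Less i m)). i \<leftarrow> [0..<m]]))))]"

lemma ball_list_comprehension:
  "(\<forall>\<phi>\<in>set (concat (map (\<lambda>i. map (f i) (g i)) xs)). P \<phi>) \<longleftrightarrow> (\<forall>i\<in>set xs. \<forall>j\<in>set (g i). P (f i j))"
  by auto

lemma sat_copy_form:
  "sat S v V (copy_form m r) \<longleftrightarrow> (\<forall>i<m. \<forall>j<m. (v i, v j) \<in> less_rel S \<longleftrightarrow> (i, j) \<in> r) \<and> inj_on v {..<m} \<and>
    (\<forall>a\<in>universe S. (\<exists>i<m. (a, v i) \<in> less_rel S \<or> (v i, a) \<in> less_rel S) \<longrightarrow> a \<in> v ` {..<m})"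
proof -
  have 1: "(\<forall>\<phi>\<in>set [if (i, j) \<in> r then Less i j else Neg (Less i j). i \<leftarrow> [0..<m], j \<leftarrow> [0..<m]]. sat S v V \<phi>)
     \<longleftrightarrow> (\<forall>i<m. \<forall>j<m. (v i, v j) \<in> less_rel S \<longleftrightarrow> (i, j) \<in> r)"
    unfolding ball_list_comprehension by (auto simp: Ball_def)
  have 2: "(\<forall>\<phi>\<in>set [Neg (Equal i j). i \<leftarrow> [0..<m], j \<leftarrow> [0..<i]]. sat S v V \<phi>) \<longleftrightarrow> inj_on v {..<m}" (is "?L \<longleftrightarrow> ?R")
  proof -
    have "?L \<longleftrightarrow> (\<forall>i<m. \<forall>j<i. v i \<noteq> v j)"
      unfolding ball_list_comprehension by (auto simp: Ball_def)
    also have "\<dots> \<longleftrightarrow> ?R"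
    proof
      assume l: "\<forall>i<m. \<forall>j<i. v i \<noteq> v j"
      show ?R
      proof (rule inj_onI)
        fix i j assume "i \<in> {..<m}" "j \<in> {..<m}" "v i = v j"
        then show "i = j" using l by (cases i j rule: linorder_cases) fastforce+
      qed
    next
      assume ?R
      then have "v i \<noteq> v j" if "i < m" "j < i" for i j using inj_onD[of v "{..<m}" i j] that by auto
      then show "\<forall>i<m. \<forall>j<i. v i \<noteq> v j" by blast
    qed
    finally show ?thesis .
  qed
  have 3: "sat S v V (Neg (Ex_elem m (Conj (conj_list [Neg (Equal m i). i \<leftarrow> [0..<m]])
       (Neg (conj_list [Conj (Neg (Less m i)) (Neg (Less i m)). i \<leftarrow> [0..<m]])))))
     \<longleftrightarrow> (\<forall>a\<in>universe S. (\<exists>i<m. (a, v i) \<in> less_rel S \<or> (v i, a) \<in> less_rel S) \<longrightarrow> a \<in> v ` {..<m})"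
    by (auto simp: image_iff atLeast0LessThan)
  show ?thesis unfolding copy_form_def using 1 2 3 by simp
qed

lemma fv_copy_form: "fv_elem (copy_form m r) \<subseteq> {..<m}" "fv_set (copy_form m r) = {}"
  by (auto simp: copy_form_def split: if_splits)

text \<open>Closure under comparability makes the embedded copy a whole component. Relabelling on an
  initial segment of \<open>nat\<close> lets the elements of the tree serve as names of
  variables.\<close>

lemma component_sentence:
  "\<exists>\<psi>. sentence \<psi> \<and> (\<forall>S :: nat struct. is_forest S \<longrightarrow> (S \<Turnstile> \<psi> \<longleftrightarrow> t \<in># shape S))"
proof -
  obtain S0 :: "nat struct" where S0: "forest0 S0" "shape S0 = {#t#}" using shape_surj by blast
  define m where "m = card (universe S0)"
  have "finite (universe S0)" using S0 by (simp add: forest0_def)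
  then obtain g where g: "bij_betw g (universe S0) {0..<m}" using ex_bij_betw_finite_nat unfolding m_def by blast
  define T where "T = (g ` universe S0, (\<lambda>(x, y). (g x, g y)) ` less_rel S0)"
  have inj: "inj_on g (universe S0)" using g by (simp add: bij_betw_def)
  have T: "forest0 T" "shape T = {#t#}" "universe T = {..<m}"
    using forest0_transfer(1)[OF S0(1) inj] shape_transfer[OF S0(1) inj] S0(2) g
    by (auto simp: T_def bij_betw_def)
  define \<psi> where "\<psi> = foldr Ex_elem [0..<m] (copy_form m (less_rel T))"
  have sen: "sentence \<psi>" using fv_copy_form[of m "less_rel T"] by (auto simp: \<psi>_def sentence_def)
  obtain x0 where x0: "roots T = {x0}"
    using size_shape[OF T(1)] T(2) by (metis card_1_singletonE size_single)
  have tx0: "t = Node (shape (substruct T (below T x0)))" using shape_unfold[OF T(1)] T(2) x0 by simp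
  have cT: "dcone T x0 = {..<m}" using universe_cones[OF T(1)] x0 T(3) by simp
  have x0U: "x0 \<in> universe T" using x0 rootsD[of x0 T] by simp
  have "S \<Turnstile> \<psi> \<longleftrightarrow> t \<in># shape S" if S: "is_forest S" for S :: "nat struct"
  proof -
    have F: "forest0 S" using S by (simp add: is_forest_iff)
    have sub: "less_rel S \<subseteq> universe S \<times> universe S" using F by (simp add: forest0_def)
    have mem: "t \<in># shape S \<longleftrightarrow> (\<exists>x\<in>roots S. t = Node (shape (substruct S (below S x))))"
      unfolding shape_unfold[OF F] by (rule in_sum_singletons[OF finite_roots[OF F]])
    have "S \<Turnstile> \<psi> \<longleftrightarrow> sat S (\<lambda>_. 0) (\<lambda>_. {}) \<psi>" by (rule models_iff_sat[OF sen S])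
    also have "\<dots> \<longleftrightarrow> (\<exists>w. (\<forall>i<m. w i \<in> universe S) \<and> (\<forall>i. \<not> i < m \<longrightarrow> w i = 0) \<and> sat S w (\<lambda>_. {}) (copy_form m (less_rel T)))"
      unfolding \<psi>_def sat_Ex_list by (simp add: Ball_def)
    also have "\<dots> \<longleftrightarrow> t \<in># shape S"
    proof
      assume "\<exists>w. (\<forall>i<m. w i \<in> universe S) \<and> (\<forall>i. \<not> i < m \<longrightarrow> w i = 0) \<and> sat S w (\<lambda>_. {}) (copy_form m (less_rel T))"
      then obtain w where w: "\<And>i. i < m \<Longrightarrow> w i \<in> universe S" "\<And>i j. i < m \<Longrightarrow> j < m \<Longrightarrow> (w i, w j) \<in> less_rel S \<longleftrightarrow> (i, j) \<in> less_rel T"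
        "inj_on w {..<m}" "\<And>a i. a \<in> universe S \<Longrightarrow> i < m \<Longrightarrow> (a, w i) \<in> less_rel S \<or> (w i, a) \<in> less_rel S \<Longrightarrow> a \<in> w ` {..<m}"
        unfolding sat_copy_form by blast
      let ?x = "w x0"
      have x0m: "x0 < m" using x0U T(3) by simp
      \<comment> \<open>Anything above the image of the root is comparable to the copy, hence inside
        it, and would come from an element above the root of \<open>T\<close>.\<close>
      have xr: "?x \<in> roots S"
      proof -
        have "(?x, y) \<notin> less_rel S" for y
        proof
          assume xy: "(?x, y) \<in> less_rel S"
          then have "y \<in> w ` {..<m}" using w(4)[of y x0] sub x0m by blast
          then obtain j where "j < m" "y = w j" by blast
          then have "(x0, j) \<in> less_rel T" using w(2)[OF x0m] xy by blast
          then show False using x0 by (auto simp: roots_def)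
        qed
        then show ?thesis using w(1)[OF x0m] by (simp add: roots_def)
      qed
      have bel: "below S ?x = w ` below T x0"
      proof
        show "below S ?x \<subseteq> w ` below T x0"
        proof
          fix y assume "y \<in> below S ?x"
          then have y: "y \<in> universe S" "(y, ?x) \<in> less_rel S" by (auto simp: below_def)
          then have "y \<in> w ` {..<m}" using w(4)[of y x0] x0m by blast
          then obtain j where j: "j < m" "y = w j" by blast
          then have "(j, x0) \<in> less_rel T" using w(2)[OF _ x0m] y(2) by blast
          then show "y \<in> w ` below T x0" using j T(3) by (auto simp: below_def)
        qed
        show "w ` below T x0 \<subseteq> below S ?x"
          using w(1) w(2)[OF _ x0m] T(3) by (auto simp: below_def)
      qed
      have "shape (substruct T (below T x0)) = shape (substruct S (below S ?x))"
      proof (rule shape_iso_via)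
        have bm: "below T x0 \<subseteq> {..<m}" using below_subset[of T x0] T(3) by simp
        show "iso_via w (substruct T (below T x0)) (substruct S (below S ?x))"
          unfolding bel iso_via_def
          using w(2) bm inj_on_subset[OF w(3) bm] by (auto simp: bij_betw_def subset_iff)
      qed (rule forest0_substruct[OF T(1) below_subset] forest0_substruct[OF F below_subset])+
      then have "t = Node (shape (substruct S (below S ?x)))" using tx0 by simp
      then show "t \<in># shape S" using xr mem by blast
    next
      assume "t \<in># shape S"
      then obtain x where x: "x \<in> roots S" "t = Node (shape (substruct S (below S x)))" unfolding mem by blast
      let ?B = "dcone S x"
      have xB: "x \<notin> below S x" using x(1) by (auto simp: roots_def below_def)
      have BU: "?B \<subseteq> universe S" using rootsD[OF x(1)] below_subset[of S x] by (auto simp: dcone_def)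
      have FB: "forest0 (substruct S ?B)" by (rule forest0_substruct[OF F BU])
      have rB: "roots (substruct S ?B) = {x}"
      proof -
        have "(x, y) \<notin> less_rel S" for y using x(1) by (auto simp: roots_def)
        moreover have "(y, x) \<in> less_rel S" if "y \<in> below S x" for y using that by (auto simp: below_def)
        ultimately show ?thesis by (auto simp: roots_def dcone_def)
      qed
      have bB: "below (substruct S ?B) x = below S x" by (auto simp: below_def dcone_def rootsD[OF x(1)])
      have "substruct (substruct S ?B) (below S x) = substruct S (below S x)"
        by (auto simp: substruct_def dcone_def)
      then have "shape (substruct S ?B) = shape T" unfolding shape_unfold[OF FB] rB T(2) using x(2) bB by simp
      then obtain h where h: "iso_via h T (substruct S ?B)" using iso_of_shape[OF T(1) FB] by metis
      have hB: "h ` {..<m} = ?B" "inj_on h {..<m}" using h T(3) by (auto simp: iso_via_def bij_betw_def)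
      have hr: "(h i, h j) \<in> less_rel S \<longleftrightarrow> (i, j) \<in> less_rel T" if "i < m" "j < m" for i j
      proof -
        have "h i \<in> ?B" "h j \<in> ?B" using hB that by auto
        then show ?thesis using h T(3) that by (simp add: iso_via_def)
      qed
      \<comment> \<open>Outside the quantified variables \<open>sat_Ex_list\<close> demands the
        values of the initial assignment, here \<open>0\<close>.\<close>
      define w where "w = (\<lambda>i. if i < m then h i else 0)"
      have wi: "w ` {..<m} = ?B" "inj_on w {..<m}" using hB by (auto simp: w_def inj_on_def)
      have cl: "a \<in> ?B" if "i < m" "(a, w i) \<in> less_rel S \<or> (w i, a) \<in> less_rel S" for a i
      proof -
        have "w i \<in> ?B" using wi that by blast
        then show ?thesis using that(2) cone_down[OF F, of "w i" x a] cone_up[OF F x(1), of "w i" a]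
          by (auto simp: dcone_def)
      qed
      have "sat S w (\<lambda>_. {}) (copy_form m (less_rel T))"
        unfolding sat_copy_form using hr wi cl by (auto simp: w_def)
      moreover have "\<forall>i<m. w i \<in> universe S" using wi BU by blast
      ultimately show "\<exists>w. (\<forall>i<m. w i \<in> universe S) \<and> (\<forall>i. \<not> i < m \<longrightarrow> w i = 0) \<and> sat S w (\<lambda>_. {}) (copy_form m (less_rel T))"
        by (intro exI[of _ w]) (simp add: w_def)
    qed
    finally show ?thesis .
  qed
  then show ?thesis using sen by blast
qed

section \<open>Limit laws\<close>

lemma thin_iff_conv_radius:
  assumes "\<And>n. a n = cnt nodes X n"
  shows "thin X \<longleftrightarrow> 1 \<le> conv_radius a"
proof
  assume th: "thin X"
  show "1 \<le> conv_radius a"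
  proof (rule conv_radius_geI_ex)
    fix r :: real assume r: "0 < r" "ereal r < 1"
    then have "summable (\<lambda>n. cnt nodes X n * r ^ n)" using th by (simp add: thin_def)
    then show "\<exists>z. norm z = r \<and> summable (\<lambda>n. a n * z ^ n)"
      using r assms by (intro exI[of _ r]) simp
  qed
next
  assume c: "1 \<le> conv_radius a"
  show "thin X" unfolding thin_def
  proof (intro allI impI)
    fix x :: real assume x: "0 < x" "x < 1"
    then have "ereal (norm x) < 1" by simp
    then have "ereal (norm x) < conv_radius a" using c by (rule less_le_trans)
    then have "summable (\<lambda>n. a n * x ^ n)" by (rule summable_in_conv_radius)
    then show "summable (\<lambda>n. cnt nodes X n * x ^ n)" using assms by simp
  qed
qed

text \<open>\<open>f n / (1 + \<delta>) ^ n\<close> is bounded: beyond \<open>N\<close> it does not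
  increase along steps of \<open>b\<close>, and finitely many starting values have a
  maximum.\<close>

lemma conv_radius_ge_1_of_ratio:
  fixes f :: "nat \<Rightarrow> real"
  assumes nn: "\<And>n. 0 \<le> f n" and b: "b > 0"
    and ratio: "\<And>e. e > 0 \<Longrightarrow> \<exists>N. \<forall>n\<ge>N. f (n + b) \<le> (1 + e) * f n"
  shows "1 \<le> conv_radius f"
proof (rule conv_radius_geI_ex)
  fix r :: real assume r: "0 < r" "ereal r < 1"
  \<comment> \<open>Makes \<open>(1 + \<delta>) * r\<close> equal to
    \<open>(1 + r) / 2\<close>.\<close>
  define \<delta> where "\<delta> = (1 / r - 1) / 2"
  have d: "\<delta> > 0" "(1 + \<delta>) * r < 1" using r by (simp_all add: \<delta>_def field_simps)
  have "real b * \<delta> > 0" using b d by simp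
  from ratio[OF this] obtain N where N: "\<And>n. n \<ge> N \<Longrightarrow> f (n + b) \<le> (1 + real b * \<delta>) * f n" by blast
  have bern: "1 + real b * \<delta> \<le> (1 + \<delta>) ^ b" using d by (intro Bernoulli_inequality) simp
  have pos: "(1 + \<delta>) ^ n > 0" for n using d by simp
  define g where "g = (\<lambda>n. f n / (1 + \<delta>) ^ n)"
  define C where "C = Max (g ` {..N + b})"
  have bound: "g n \<le> C" for n
  proof (induction n rule: less_induct)
    case (less n)
    show ?case
    proof (cases "n \<le> N + b")
      case True
      then show ?thesis unfolding C_def by (intro Max_ge) auto
    next
      case False
      define k where "k = n - b"
      have k: "n = k + b" "k \<ge> N" "k < n" using False b by (auto simp: k_def)
      have "f n \<le> (1 + real b * \<delta>) * f k" unfolding k(1) by (rule N[OF k(2)])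
      also have "\<dots> \<le> (1 + \<delta>) ^ b * f k" using bern nn by (intro mult_right_mono)
      finally have "g n \<le> (1 + \<delta>) ^ b * f k / (1 + \<delta>) ^ n" unfolding g_def using pos[of n] by (intro divide_right_mono) auto
      also have "\<dots> = g k" using pos[of b] d(1) by (simp add: g_def k(1) power_add)
      also have "\<dots> \<le> C" by (rule less[OF k(3)])
      finally show ?thesis .
    qed
  qed
  have fb: "f n \<le> C * (1 + \<delta>) ^ n" for n using bound[of n] pos[of n] by (simp add: g_def field_simps)
  have "summable (\<lambda>n. C * ((1 + \<delta>) * r) ^ n)" using d r by (intro summable_mult summable_geometric) simp
  then have "summable (\<lambda>n. f n * r ^ n)"
  proof (rule summable_comparison_test'[of _ 0])
    fix n
    have "f n * r ^ n \<le> C * (1 + \<delta>) ^ n * r ^ n" using fb r by (intro mult_right_mono) auto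
    then show "norm (f n * r ^ n) \<le> C * ((1 + \<delta>) * r) ^ n" using nn[of n] r by (simp add: power_mult_distrib mult.assoc)
  qed
  then show "\<exists>z. norm z = r \<and> summable (\<lambda>n. f n * z ^ n)" using r by (intro exI[of _ r]) simp
qed

lemma conv_radius_le_1:
  fixes a :: "nat \<Rightarrow> real"
  assumes "\<And>k. \<exists>n\<ge>k. a n \<ge> 1"
  shows "conv_radius a \<le> 1"
proof (rule ccontr)
  assume "\<not> conv_radius a \<le> 1"
  then have "ereal (norm (1 :: real)) < conv_radius a" by (simp add: not_le flip: one_ereal_def)
  then have "summable (\<lambda>n. a n * 1 ^ n)" by (rule summable_in_conv_radius)
  then have "a \<longlonglongrightarrow> 0" by (simp add: summable_LIMSEQ_zero)
  then obtain N where "\<And>n. n \<ge> N \<Longrightarrow> norm (a n - 0) < 1" by (meson LIMSEQ_iff zero_less_one)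
  then show False using assms[of N] by fastforce
qed

text \<open>The least positive difference \<open>e\<close> of two members divides every member, as a
  remainder would be a smaller difference; so \<open>e\<close> is the gcd. With \<open>a\<close> and
  \<open>a + e\<close> in \<open>S\<close>, each \<open>n * e\<close> with
  \<open>n \<ge> (a / e)^2\<close> is a nonnegative combination of these two.\<close>

lemma numerical_semigroup:
  fixes S :: "nat set"
  assumes zero: "0 \<in> S" and plus: "\<And>x y. x \<in> S \<Longrightarrow> y \<in> S \<Longrightarrow> x + y \<in> S" and pos: "s0 \<in> S" "s0 > 0"
  shows "\<exists>N. \<forall>n\<ge>N. n * Gcd S \<in> S"
proof -
  have mult: "k * x \<in> S" if "x \<in> S" for k x
    using that by (induction k) (auto intro: zero plus)
  define D where "D = (\<lambda>x. x > 0 \<and> (\<exists>a\<in>S. a + x \<in> S))"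
  have "D s0" using zero pos by (auto simp: D_def intro!: bexI[of _ 0])
  define e where "e = (LEAST x. D x)"
  have De: "D e" unfolding e_def by (rule LeastI[of D, OF \<open>D s0\<close>])
  have least: "e \<le> x" if "D x" for x unfolding e_def using that by (rule Least_le)
  obtain a where a: "a \<in> S" "a + e \<in> S" "e > 0" using De by (auto simp: D_def)
  have dv: "e dvd s" if s: "s \<in> S" for s
  proof (rule ccontr)
    assume "\<not> e dvd s"
    then have r: "s mod e > 0" by (simp add: dvd_eq_mod_eq_0)
    let ?q = "s div e"
    have "?q * (a + e) \<in> S" by (rule mult[OF a(2)])
    moreover have "?q * (a + e) + s mod e = s + ?q * a"
      using div_mult_mod_eq[of s e] by (simp add: algebra_simps)
    moreover have "s + ?q * a \<in> S" by (rule plus[OF s mult[OF a(1)]])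
    ultimately have "D (s mod e)" unfolding D_def using r
      by (intro conjI bexI[of _ "?q * (a + e)"]) (simp_all only:)
    then have "e \<le> s mod e" by (rule least)
    then show False using mod_less_divisor[OF a(3), of s] by simp
  qed
  have "Gcd S dvd e"
  proof -
    have "Gcd S dvd a" "Gcd S dvd a + e" using a by (simp_all add: Gcd_dvd)
    then show ?thesis by (simp add: dvd_add_right_iff)
  qed
  moreover have "e dvd Gcd S" using dv by (intro Gcd_greatest) auto
  ultimately have d: "Gcd S = e" by (rule dvd_antisym)
  obtain a' where a': "a = e * a'" using dv[OF a(1)] by (auto elim: dvdE)
  have "n * e \<in> S" if n: "n \<ge> a' * a'" for n
  proof (cases "a' = 0")
    case True
    then show ?thesis using mult[OF a(2), of n] a' by simp
  next
    case False
    let ?q = "n div a'" and ?r = "n mod a'"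
    have "?r \<le> ?q"
    proof -
      have "a' * a' div a' \<le> ?q" using n by (rule div_le_mono)
      then have "a' \<le> ?q" using False by simp
      then show ?thesis using mod_less_divisor[of a' n] False by linarith
    qed
    then obtain k where k: "?q = ?r + k" using le_Suc_ex by blast
    have "n = ?q * a' + ?r" by simp
    then have "n * e = (?r + k) * (e * a') + ?r * e" using k by (metis add_mult_distrib mult.assoc mult.commute)
    then have "n * e = k * a + ?r * (a + e)" using a' by (simp add: algebra_simps)
    then show ?thesis using plus[OF mult[OF a(1)] mult[OF a(2)]] by simp
  qed
  then show ?thesis unfolding d by blast
qed

section \<open>Asymptotics of the forest count\<close>

locale forest_count =
  fixes X :: "utree set" and f :: "nat \<Rightarrow> real"
  defines "f \<equiv> cnt (wt nodes) (msets X)"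
begin

lemma f_nonneg: "0 \<le> f n" by (simp add: f_def)

lemma f_ge_1: "M \<in> msets X \<Longrightarrow> 1 \<le> f (wt nodes M)"
proof -
  assume "M \<in> msets X"
  then have "M \<in> {N \<in> msets X. wt nodes N = wt nodes M}" by simp
  then have "card {N \<in> msets X. wt nodes N = wt nodes M} > 0" by (subst card_gt_0_iff) auto
  then show ?thesis by (simp add: f_def cnt_def)
qed

lemma f_step: "t \<in> X \<Longrightarrow> f n \<le> f (n + nodes t)"
  unfolding f_def by (rule cnt_msets_step[OF graded_trees])

lemma f_le: "f n \<le> 4 ^ n"
proof -
  have "card {M \<in> msets X. wt nodes M = n} \<le> card {M. wt nodes M = n}"
    by (intro card_mono finite_forests) auto
  also have "\<dots> \<le> 4 ^ n" by (rule card_forests)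
  finally have "card {M \<in> msets X. wt nodes M = n} \<le> 4 ^ n" .
  then have "real (card {M \<in> msets X. wt nodes M = n}) \<le> real (4 ^ n)" by (simp only: of_nat_le_iff)
  then show ?thesis by (simp add: f_def cnt_def)
qed

lemma card_count_ge_f:
  assumes "t \<in> X" "n \<ge> k * nodes t"
  shows "real (card {M \<in> msets X. k \<le> count M t \<and> wt nodes M = n}) = f (n - k * nodes t)"
proof -
  have "{M \<in> msets X. k \<le> count M t \<and> wt nodes M = n} = {M \<in> {M \<in> msets X. True \<and> wt nodes M = n}. k \<le> count M t}" by auto
  then have "card {M \<in> msets X. k \<le> count M t \<and> wt nodes M = n} = card {M \<in> msets X. True \<and> wt nodes M = n - k * nodes t}"
    using card_count_ge[OF assms(1), of k nodes n "\<lambda>_. True"] assms(2) by simp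
  then show ?thesis by (simp add: f_def cnt_def)
qed

lemma card_count_less_f:
  assumes "t \<in> X" "n \<ge> k * nodes t"
  shows "real (card {M \<in> msets X. count M t < k \<and> wt nodes M = n}) = f n - f (n - k * nodes t)"
proof -
  have "{M \<in> msets X. wt nodes M = n} = {M \<in> msets X. count M t < k \<and> wt nodes M = n} \<union> {M \<in> msets X. k \<le> count M t \<and> wt nodes M = n}"
    by auto
  moreover have fin: "finite {M \<in> msets X. P M \<and> wt nodes M = n}" for P
    using finite_forests_in[of "msets X" n] by (rule rev_finite_subset) auto
  ultimately have "card {M \<in> msets X. wt nodes M = n} = card {M \<in> msets X. count M t < k \<and> wt nodes M = n} + card {M \<in> msets X. k \<le> count M t \<and> wt nodes M = n}"
    using card_Un_disjoint[OF fin[of "\<lambda>M. count M t < k"] fin[of "\<lambda>M. k \<le> count M t"]] by force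
  then have "f n = real (card {M \<in> msets X. count M t < k \<and> wt nodes M = n}) + f (n - k * nodes t)"
    using card_count_ge_f[OF assms] by (simp add: f_def cnt_def)
  then show ?thesis by simp
qed

text \<open>Stripping \<open>k\<close> copies shows that the exceptional share is
  \<open>1 - f (n - k * nodes t) / f n\<close> where \<open>f n > 0\<close>, and this tends to
  \<open>0\<close>.\<close>

lemma few_copies_negligible:
  assumes sm: "smooth (cnt nodes X)" and t: "t \<in> X" and e: "e > 0"
  shows "\<exists>N. \<forall>n\<ge>N. real (card {M \<in> msets X. count M t < k \<and> wt nodes M = n}) \<le> e * f n"
proof -
  have smf: "smooth f" unfolding f_def by (rule smooth_msets[OF graded_trees sm])
  obtain N where N: "\<forall>n\<ge>N. f (n + k * nodes t) \<le> (1 + e) * f n"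
    using smooth_step_ratio[OF smf f_step[OF t] e] by blast
  have "real (card {M \<in> msets X. count M t < k \<and> wt nodes M = n}) \<le> e * f n" if n: "n \<ge> N + k * nodes t" for n
  proof -
    define l where "l = n - k * nodes t"
    have l: "n = l + k * nodes t" "l \<ge> N" using n by (auto simp: l_def)
    have steps: "f l \<le> f (l + k * nodes t)" unfolding f_def by (rule cnt_msets_steps[OF graded_trees t])
    have "f n - f l \<le> e * f l" using N l by (simp add: algebra_simps)
    also have "\<dots> \<le> e * f n" using steps l(1) e by (intro mult_left_mono) auto
    finally show ?thesis using card_count_less_f[OF t, of k n] n by (simp add: l_def)
  qed
  then show ?thesis by blast
qed

lemma all_negligible:
  assumes sm: "smooth (cnt nodes X)" and A: "finite A" "A \<subseteq> X" and e: "e > 0"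
  shows "\<exists>N. \<forall>n\<ge>N. real (card {M \<in> msets X. (\<exists>t\<in>A. count M t < k) \<and> wt nodes M = n}) \<le> e * f n"
  using A e
proof (induction A arbitrary: e rule: finite_induct)
  case empty
  then show ?case using f_nonneg by simp
next
  case (insert t A)
  have e2: "e / 2 > 0" using insert.prems by simp
  obtain N1 where N1: "\<forall>n\<ge>N1. real (card {M \<in> msets X. (\<exists>t\<in>A. count M t < k) \<and> wt nodes M = n}) \<le> e / 2 * f n"
    using insert.IH[OF _ e2] insert.prems by auto
  obtain N2 where N2: "\<forall>n\<ge>N2. real (card {M \<in> msets X. count M t < k \<and> wt nodes M = n}) \<le> e / 2 * f n"
    using few_copies_negligible[OF sm _ e2] insert.prems by blast
  have "real (card {M \<in> msets X. (\<exists>t\<in>insert t A. count M t < k) \<and> wt nodes M = n}) \<le> e * f n" if n: "n \<ge> max N1 N2" for n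
  proof -
    have "{M \<in> msets X. (\<exists>t\<in>insert t A. count M t < k) \<and> wt nodes M = n} =
        {M \<in> msets X. (\<exists>t\<in>A. count M t < k) \<and> wt nodes M = n} \<union> {M \<in> msets X. count M t < k \<and> wt nodes M = n}" by auto
    then have "card {M \<in> msets X. (\<exists>t\<in>insert t A. count M t < k) \<and> wt nodes M = n} \<le>
        card {M \<in> msets X. (\<exists>t\<in>A. count M t < k) \<and> wt nodes M = n} + card {M \<in> msets X. count M t < k \<and> wt nodes M = n}"
      by (simp only: card_Un_le)
    then have "real (card {M \<in> msets X. (\<exists>t\<in>insert t A. count M t < k) \<and> wt nodes M = n}) \<le>
        real (card {M \<in> msets X. (\<exists>t\<in>A. count M t < k) \<and> wt nodes M = n}) + real (card {M \<in> msets X. count M t < k \<and> wt nodes M = n})"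
      by (simp only: of_nat_le_iff flip: of_nat_add)
    also have "\<dots> \<le> e / 2 * f n + e / 2 * f n" using N1 N2 n by (intro add_mono) auto
    finally show ?thesis by simp
  qed
  then show ?case by blast
qed

end

lemma count_image_mset_ge: "count M x \<le> count (image_mset g M) (g x)"
  by (induction M) auto

context forest_count
begin

text \<open>Keeps the denominators of the law nonzero from some point on.\<close>

lemma f_pos_progression:
  assumes "X \<noteq> {}"
  shows "\<exists>N. \<forall>n\<ge>N. 1 \<le> f (n * Gcd (wt nodes ` msets X))"
proof -
  obtain t where t: "t \<in> X" using assms by blast
  have "\<exists>N. \<forall>n\<ge>N. n * Gcd (wt nodes ` msets X) \<in> wt nodes ` msets X"
  proof (rule numerical_semigroup)
    show "0 \<in> wt nodes ` msets X" by (rule image_eqI[of _ _ "{#}"]) simp_all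
    show "x + y \<in> wt nodes ` msets X" if xy: "x \<in> wt nodes ` msets X" "y \<in> wt nodes ` msets X" for x y
    proof -
      obtain M N where "x = wt nodes M" "M \<in> msets X" "y = wt nodes N" "N \<in> msets X" using xy by blast
      then show ?thesis by (intro image_eqI[of _ _ "M + N"]) simp_all
    qed
    show "nodes t \<in> wt nodes ` msets X" by (rule image_eqI[of _ _ "{#t#}"]) (simp_all add: t)
  qed simp
  then obtain N where N: "\<And>n. n \<ge> N \<Longrightarrow> n * Gcd (wt nodes ` msets X) \<in> wt nodes ` msets X" by blast
  have "1 \<le> f (n * Gcd (wt nodes ` msets X))" if "n \<ge> N" for n
    using N[OF that] f_ge_1 by (metis imageE)
  then show ?thesis by blast
qed

lemma f_eq_0: "\<not> Gcd (wt nodes ` msets X) dvd n \<Longrightarrow> f n = 0"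
proof -
  assume "\<not> Gcd (wt nodes ` msets X) dvd n"
  then have "n \<notin> wt nodes ` msets X" using Gcd_dvd by metis
  then have "{M \<in> msets X. wt nodes M = n} = {}" by blast
  then show "f n = 0" by (simp only: f_def cnt_def card.empty of_nat_0)
qed

lemma conv_radius_f_le: "X \<noteq> {} \<Longrightarrow> conv_radius f \<le> 1"
proof (rule conv_radius_le_1)
  fix k
  assume "X \<noteq> {}"
  then obtain t where t: "t \<in> X" by blast
  have "replicate_mset k t \<in> msets X" using t by (auto simp: msets_def split: if_splits)
  then have "1 \<le> f (k * nodes t)" using f_ge_1[of "replicate_mset k t"] by simp
  moreover have "k \<le> k * nodes t" using nodes_pos[of t] by (cases "nodes t") auto
  ultimately show "\<exists>n\<ge>k. 1 \<le> f n" by blast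
qed

lemma conv_radius_f_ge:
  assumes "smooth (cnt nodes X)" "X \<noteq> {}" shows "1 \<le> conv_radius f"
proof -
  obtain t where t: "t \<in> X" using assms(2) by blast
  have smf: "smooth f" unfolding f_def by (rule smooth_msets[OF graded_trees assms(1)])
  show ?thesis
  proof (rule conv_radius_ge_1_of_ratio[OF f_nonneg nodes_pos])
    fix e :: real assume "e > 0"
    from smooth_step_ratio[OF smf f_step[OF t] this, of 1]
    show "\<exists>N. \<forall>n\<ge>N. f (n + nodes t) \<le> (1 + e) * f n" by simp
  qed
qed

lemma cnt_le_f: "cnt nodes X n \<le> f n"
proof -
  have "card {t \<in> X. nodes t = n} \<le> card {M \<in> msets X. wt nodes M = n}"
    by (rule card_inj_on_le[of "\<lambda>t. {#t#}"]) (auto simp: inj_on_def)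
  then show ?thesis by (simp add: f_def cnt_def)
qed

lemma thin_of_conv_radius_f:
  assumes "1 \<le> conv_radius f" shows "thin X"
  unfolding thin_def
proof (intro allI impI)
  fix x :: real assume x: "0 < x" "x < 1"
  then have "ereal (norm x) < 1" by simp
  then have "ereal (norm x) < conv_radius f" using assms by (rule less_le_trans)
  then have "summable (\<lambda>n. f n * x ^ n)" by (rule summable_in_conv_radius)
  then show "summable (\<lambda>n. cnt nodes X n * x ^ n)"
    by (rule summable_comparison_test'[of _ 0]) (use x cnt_le_f in \<open>simp add: mult_right_mono\<close>)
qed

text \<open>On multiples of \<open>d\<close> the limit is a ratio bound for the step
  \<open>nodes t\<close>; elsewhere \<open>f (n + nodes t)\<close> vanishes because \<open>d\<close>
  divides \<open>nodes t\<close>.\<close>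

lemma ratio_limit_1:
  assumes t: "t \<in> X"
    and lim: "(\<lambda>n. f (n * d - nodes t) / f (n * d)) \<longlonglongrightarrow> 1" and d: "d = Gcd (wt nodes ` msets X)"
  shows "1 \<le> conv_radius f"
proof (rule conv_radius_ge_1_of_ratio[OF f_nonneg nodes_pos])
  fix e :: real assume e: "e > 0"
  have "nodes t \<in> wt nodes ` msets X" by (rule image_eqI[of _ _ "{#t#}"]) (simp_all add: t)
  then have dm: "d dvd nodes t" unfolding d by (rule Gcd_dvd)
  then obtain m' where m': "nodes t = m' * d" by (metis dvd_def mult.commute)
  have d0: "d > 0" using dm nodes_pos[of t] by (metis dvd_0_left_iff gr0I less_irrefl)
  have "1 / (1 + e) < 1" using e by simp
  from order_tendstoD(1)[OF lim this] obtain N where N: "\<And>n. n \<ge> N \<Longrightarrow> 1 / (1 + e) < f (n * d - nodes t) / f (n * d)"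
    by (auto simp: eventually_sequentially)
  show "\<exists>N. \<forall>n\<ge>N. f (n + nodes t) \<le> (1 + e) * f n"
  proof (intro exI[of _ "N * d"] allI impI)
    fix n assume n: "N * d \<le> n"
    show "f (n + nodes t) \<le> (1 + e) * f n"
    proof (cases "d dvd n")
      case True
      then obtain q where q: "n = q * d" by (metis dvd_def mult.commute)
      have "N \<le> q + m'" using n d0 by (simp add: q)
      moreover have qm: "(q + m') * d = n + nodes t" by (simp add: q m' add_mult_distrib)
      ultimately have r: "1 / (1 + e) < f n / f (n + nodes t)" using N[of "q + m'"] by simp
      \<comment> \<open>Division by \<open>0\<close> yields \<open>0\<close>, which the positive
        lower bound excludes.\<close>
      have "f (n + nodes t) \<noteq> 0"
      proof
        assume "f (n + nodes t) = 0"
        then have "1 / (1 + e) < 0" using r by simp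
        then show False using e by simp
      qed
      then have "f (n + nodes t) > 0" using f_nonneg[of "n + nodes t"] by simp
      then show ?thesis using r e by (simp add: field_simps)
    next
      case False
      then have "\<not> d dvd n + nodes t" using dm by (simp add: dvd_add_left_iff)
      then have "f (n + nodes t) = 0" using f_eq_0 d by simp
      then show ?thesis using f_nonneg[of n] e by simp
    qed
  qed
qed

text \<open>Along multiples of \<open>nodes t\<close> the count would eventually grow at least by
  the factor \<open>2 * 4 ^ nodes t\<close> per step, against
  \<open>f n \<le> 4 ^ n\<close>.\<close>

lemma ratio_limit_0:
  assumes t: "t \<in> X"
    and lim: "(\<lambda>n. f (n * d - nodes t) / f (n * d)) \<longlonglongrightarrow> 0" and d: "d dvd nodes t"
  shows False
proof -
  let ?m = "nodes t"
  obtain m' where m': "?m = m' * d" using d by (metis dvd_def mult.commute)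
  have m'0: "m' > 0" using m' nodes_pos[of t] by (cases m') auto
  have pos: "0 < 1 / (2 * 4 ^ ?m :: real)" by simp
  from order_tendstoD(2)[OF lim pos] obtain N where N: "\<And>n. n \<ge> N \<Longrightarrow> f (n * d - ?m) / f (n * d) < 1 / (2 * 4 ^ ?m)"
    by (auto simp: eventually_sequentially)
  have f1: "1 \<le> f (k * ?m)" for k
  proof -
    have "replicate_mset k t \<in> msets X" using t by (auto simp: msets_def split: if_splits)
    then show ?thesis using f_ge_1[of "replicate_mset k t"] by simp
  qed
  have step: "2 * 4 ^ ?m * f (k * ?m) \<le> f (Suc k * ?m)" if k: "k \<ge> N" for k
  proof -
    have "k \<le> Suc k * m'" using m'0 by (cases m') auto
    then have "N \<le> Suc k * m'" using k by linarith
    moreover have eq: "Suc k * m' * d = Suc k * ?m" by (simp only: m' mult.assoc)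
    ultimately have "f (Suc k * ?m - ?m) / f (Suc k * ?m) < 1 / (2 * 4 ^ ?m)" using N[of "Suc k * m'"] by (simp only:)
    moreover have "Suc k * ?m - ?m = k * ?m" by simp
    ultimately have r: "f (k * ?m) / f (Suc k * ?m) < 1 / (2 * 4 ^ ?m)" by simp
    have "f (Suc k * ?m) > 0" using f1[of "Suc k"] by linarith
    then show ?thesis using r by (simp add: field_simps)
  qed
  have low: "(2 * 4 ^ ?m) ^ j \<le> f ((N + j) * ?m)" for j
  proof (induction j)
    case 0
    then show ?case using f1[of N] by simp
  next
    case (Suc j)
    have "(2 * 4 ^ ?m) ^ Suc j \<le> 2 * 4 ^ ?m * f ((N + j) * ?m)" using Suc by (simp add: mult_left_mono)
    also have "\<dots> \<le> f (Suc (N + j) * ?m)" by (rule step) simp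
    finally show ?case by (simp only: add_Suc_right)
  qed
  have "(2 :: real) ^ j \<le> 4 ^ (N * ?m)" for j
  proof -
    have "(2 :: real) ^ j * (4 ^ ?m) ^ j \<le> 4 ^ ((N + j) * ?m)"
      using low[of j] f_le[of "(N + j) * ?m"] by (simp add: power_mult_distrib)
    also have "\<dots> = 4 ^ (N * ?m) * (4 ^ ?m) ^ j"
    proof -
      have "(N + j) * ?m = N * ?m + ?m * j" by (simp add: algebra_simps)
      then show ?thesis by (simp only: power_add power_mult[of "4 :: real" ?m j])
    qed
    finally show ?thesis by simp
  qed
  moreover obtain j where "4 ^ (N * ?m) < (2 :: real) ^ j" using real_arch_pow[of 2 "4 ^ (N * ?m)"] by auto
  ultimately show False by (meson not_le)
qed

end

text \<open>Forests with at least \<open>K\<close> copies of a representative of every type have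
  equal capped counts and so agree on \<open>\<psi>\<close>; all others are negligible.\<close>

lemma mso_01_of_smooth:
  assumes ad: "adequate \<F>" and X: "X = tree_shapes \<F>" "X \<noteq> {}" and sm: "smooth (cnt nodes X)"
    and per: "period \<F> = Gcd (wt nodes ` msets X)" "period \<F> > 0"
  shows "mso_01_law \<F>"
  unfolding mso_01_law_def
proof (intro allI impI)
  fix \<psi> assume \<psi>: "sentence \<psi>"
  let ?f = "cnt (wt nodes) (msets X)" and ?d = "period \<F>"
  interpret forest_count X ?f by unfold_locales simp
  obtain tyof K where ty: "tree_typing tyof K"
    and pr: "\<forall>(S :: nat struct) (S' :: nat struct). is_forest S \<longrightarrow> is_forest S' \<longrightarrow>
      (\<forall>a. min K (count (image_mset tyof (shape S)) a) = min K (count (image_mset tyof (shape S')) a)) \<longrightarrow>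
      (S \<Turnstile> \<psi>) = (S' \<Turnstile> \<psi>)"
    using mso_profile[OF \<psi>] by (elim exE conjE)
  have isF: "is_forest S" if "S \<in> \<F>" for S using adequate_forests[OF ad that] .
  have sh: "shape S \<in> msets X" if "S \<in> \<F>" for S using forest_shapes[OF ad] that X(1) by blast
  define \<tau> where "\<tau> = (\<lambda>a. SOME t. t \<in> X \<and> tyof t = a)"
  have \<tau>: "\<tau> a \<in> X \<and> tyof (\<tau> a) = a" if "a \<in> tyof ` X" for a
    unfolding \<tau>_def by (rule someI_ex) (use that in blast)
  define A where "A = \<tau> ` (tyof ` X)"
  have "finite (tyof ` X)" using tree_typing.finite_tyof[OF ty] by (rule rev_finite_subset) blast
  then have A: "finite A" "A \<subseteq> X" using \<tau> by (auto simp: A_def)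
  define bad where "bad = (\<lambda>M. \<exists>t\<in>A. count M t < K)"
  have agree: "(S \<Turnstile> \<psi>) = (S' \<Turnstile> \<psi>)"
    if S: "S \<in> \<F>" "S' \<in> \<F>" and good: "\<not> bad (shape S)" "\<not> bad (shape S')" for S S'
  proof (rule pr[rule_format, OF isF[OF S(1)] isF[OF S(2)]])
    fix a
    have full: "min K (count (image_mset tyof M) a) = (if a \<in> tyof ` X then K else 0)"
      if M: "M \<in> msets X" "\<not> bad M" for M
    proof (cases "a \<in> tyof ` X")
      case True
      then have "\<tau> a \<in> A" by (simp add: A_def)
      then have "K \<le> count M (\<tau> a)" using M(2) by (auto simp: bad_def not_less)
      also have "\<dots> \<le> count (image_mset tyof M) a" using count_image_mset_ge[of M "\<tau> a" tyof] \<tau>[OF True] by simp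
      finally show ?thesis using True by simp
    next
      case False
      then have "a \<notin># image_mset tyof M" using M(1) by (auto simp: msets_def)
      then have "count (image_mset tyof M) a = 0" by (simp only: not_in_iff)
      then show ?thesis using False by simp
    qed
    show "min K (count (image_mset tyof (shape S)) a) = min K (count (image_mset tyof (shape S')) a)"
      using full[OF sh[OF S(1)] good(1)] full[OF sh[OF S(2)] good(2)] by simp
  qed
  \<comment> \<open>\<open>\<psi>\<close> as a predicate on shapes: forests of equal shape have
    equal type counts and agree on it.\<close>
  define P where "P = (\<lambda>M. \<exists>S\<in>\<F>. shape S = M \<and> S \<Turnstile> \<psi>)"
  have P: "S \<Turnstile> \<psi> \<longleftrightarrow> P (shape S)" if S: "S \<in> \<F>" for S
  proof -
    have "(S \<Turnstile> \<psi>) = (S' \<Turnstile> \<psi>)" if "S' \<in> \<F>" "shape S' = shape S" for S'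
      by (rule pr[rule_format, OF isF[OF S] isF[OF that(1)]]) (simp add: that(2))
    then show ?thesis using S unfolding P_def by blast
  qed
  let ?c = "\<lambda>n. card {M \<in> msets X. P M \<and> wt nodes M = n}"
  let ?g = "\<lambda>n. card {M \<in> msets X. bad M \<and> wt nodes M = n}"
  have ct: "count_types {S \<in> \<F>. S \<Turnstile> \<psi>} n = ?c n" if "n > 0" for n
    unfolding X(1) by (rule count_types_subclass[where P = P and Q = "\<lambda>S. S \<Turnstile> \<psi>", OF ad _ that]) (rule P)
  have fin: "finite {M \<in> msets X. Q M \<and> wt nodes M = n}" for Q n
    using finite_forests_in[of "msets X" n] by (rule rev_finite_subset) auto
  have gsmall: "\<exists>N. \<forall>n\<ge>N. real (?g n) \<le> e * ?f n" if "e > 0" for e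
    using all_negligible[OF sm A that, of K] unfolding bad_def .
  obtain N0 where N0: "\<And>n. n \<ge> N0 \<Longrightarrow> 1 \<le> ?f (n * ?d)"
    using f_pos_progression[OF X(2)] unfolding per(1) by blast
  define L :: real where "L = (if \<exists>S\<in>\<F>. \<not> bad (shape S) \<and> S \<Turnstile> \<psi> then 1 else 0)"
  have close: "\<bar>real (?c n) / ?f n - L\<bar> \<le> e" if n: "n > 0" and f1: "1 \<le> ?f n" and g: "real (?g n) \<le> e * ?f n" for n e
  proof (cases "\<exists>S\<in>\<F>. \<not> bad (shape S) \<and> S \<Turnstile> \<psi>")
    case True
    have "P M" if M: "M \<in> msets X" "wt nodes M = n" "\<not> bad M" for M
    proof -
      have "M \<noteq> {#}" using M(2) n by auto
      then have "M \<in> shape ` \<F>" using M(1) forest_shapes[OF ad] X(1) by blast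
      then obtain S where S: "M = shape S" "S \<in> \<F>" by (rule imageE)
      obtain S' where "S' \<in> \<F>" "\<not> bad (shape S')" "S' \<Turnstile> \<psi>" using True by blast
      then have "S \<Turnstile> \<psi>" using agree[OF S(2), of S'] M(3) S(1) by blast
      then show "P M" using S by (auto simp: P_def)
    qed
    then have "{M \<in> msets X. wt nodes M = n} \<subseteq> {M \<in> msets X. P M \<and> wt nodes M = n} \<union> {M \<in> msets X. bad M \<and> wt nodes M = n}" by blast
    then have "card {M \<in> msets X. wt nodes M = n} \<le> card ({M \<in> msets X. P M \<and> wt nodes M = n} \<union> {M \<in> msets X. bad M \<and> wt nodes M = n})"
      using fin by (intro card_mono) auto
    also have "\<dots> \<le> ?c n + ?g n" by (rule card_Un_le)
    finally have "real (card {M \<in> msets X. wt nodes M = n}) \<le> real (?c n + ?g n)" by (simp only: of_nat_le_iff)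
    then have 1: "?f n \<le> real (?c n) + real (?g n)" by (simp add: cnt_def)
    have "?c n \<le> card {M \<in> msets X. wt nodes M = n}" by (rule card_mono) auto
    then have 2: "real (?c n) \<le> ?f n" by (simp add: cnt_def)
    have "real (?c n) / ?f n \<le> 1" using 2 f1 by (simp add: field_simps)
    moreover have "1 - e \<le> real (?c n) / ?f n"
    proof -
      have "(1 - e) * ?f n \<le> real (?c n)" using 1 g by (simp add: algebra_simps)
      then show ?thesis using f1 by (simp add: pos_le_divide_eq)
    qed
    moreover have "L = 1" unfolding L_def using True by (rule if_P)
    ultimately show ?thesis by (simp add: abs_if)
  next
    case False
    have "bad M" if M: "M \<in> msets X" "P M" for M
      using M(2) False by (auto simp: P_def)
    then have "?c n \<le> ?g n" using fin by (intro card_mono) auto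
    then have "real (?c n) \<le> e * ?f n" using g by linarith
    then have "real (?c n) / ?f n \<le> e" using f1 by (simp add: pos_divide_le_eq)
    moreover have "0 \<le> real (?c n) / ?f n" using f1 by simp
    moreover have "L = 0" unfolding L_def using False by (rule if_not_P)
    ultimately show ?thesis by simp
  qed
  have "(\<lambda>n. real (count_types {S \<in> \<F>. S \<Turnstile> \<psi>} (n * ?d)) / real (count_types \<F> (n * ?d))) \<longlonglongrightarrow> L"
  proof (rule LIMSEQ_I)
    fix r :: real assume r: "r > 0"
    then obtain N where N: "\<And>n. n \<ge> N \<Longrightarrow> real (?g n) \<le> r / 2 * ?f n" using gsmall[of "r / 2"] by auto
    show "\<exists>no. \<forall>n\<ge>no. norm (real (count_types {S \<in> \<F>. S \<Turnstile> \<psi>} (n * ?d)) / real (count_types \<F> (n * ?d)) - L) < r"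
    proof (intro exI[of _ "max 1 (max N N0)"] allI impI)
      fix n assume n: "max 1 (max N N0) \<le> n"
      have nd: "n \<le> n * ?d" using per(2) by (cases ?d) auto
      then have pos: "n * ?d > 0" using n by linarith
      have "\<bar>real (?c (n * ?d)) / ?f (n * ?d) - L\<bar> \<le> r / 2"
        by (rule close[OF pos N0 N]) (use n nd in linarith)+
      moreover have "real (count_types \<F> (n * ?d)) = ?f (n * ?d)"
        unfolding X(1) by (rule count_types_forests[OF ad pos])
      ultimately show "norm (real (count_types {S \<in> \<F>. S \<Turnstile> \<psi>} (n * ?d)) / real (count_types \<F> (n * ?d)) - L) < r"
        using r ct[OF pos] by simp
    qed
  qed
  moreover have "L \<in> {0, 1}" by (simp add: L_def)
  ultimately show "\<exists>L\<in>{0, 1}. (\<lambda>n. real (count_types {S \<in> \<F>. S \<Turnstile> \<psi>} (n * ?d)) / real (count_types \<F> (n * ?d))) \<longlonglongrightarrow> L"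
    by blast
qed

theorem theorem5p1:
  fixes \<F> \<T> :: "nat struct set"
  assumes "\<F> \<noteq> {}"
    and "adequate \<F>"
    and "mso_class \<F>"
    and "\<T> = trees_of \<F>"
  shows "(mso_01_law \<F> \<longleftrightarrow> radius \<F> = 1) \<and> (radius \<F> = 1 \<longleftrightarrow> radius \<T> \<ge> 1)"
proof -
  note ad = assms(2)
  define X where "X = tree_shapes \<F>"
  let ?f = "cnt (wt nodes) (msets X)"
  interpret forest_count X ?f by unfold_locales simp
  have shapes: "shape ` \<F> = msets X - {{#}}" unfolding X_def by (rule forest_shapes[OF ad])
  obtain M0 where M0: "M0 \<in> msets X" "M0 \<noteq> {#}" using shapes assms(1) by blast
  obtain t where "t \<in># M0" using M0(2) by (rule multiset_nonemptyE)
  then have t: "t \<in> X" using M0(1) by (auto simp: msets_def)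
  then have Xne: "X \<noteq> {}" by blast
  have "size_of S = wt nodes (shape S)" if "S \<in> \<F>" for S
    using wt_shape[of S] adequate_forests[OF ad that] by (simp add: size_of_def is_forest_iff)
  then have "size_of ` \<F> = wt nodes ` shape ` \<F>" unfolding image_image by (rule image_cong[OF refl])
  \<comment> \<open>The empty multiset has weight \<open>0\<close>, which a gcd ignores; so the
    period of the class is the gcd over all multisets.\<close>
  moreover have "msets X = insert {#} (msets X - {{#}})" by (simp add: insert_absorb)
  from arg_cong[OF this, of "image (wt nodes)"]
  have "wt nodes ` msets X = insert 0 (wt nodes ` (msets X - {{#}}))" by (simp only: image_insert wt_simps)
  ultimately have "insert 0 (size_of ` \<F>) = wt nodes ` msets X" by (simp only: shapes)
  then have per: "period \<F> = Gcd (wt nodes ` msets X)" unfolding period_def by (metis Gcd_insert gcd_0_left_nat)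
  have "nodes t \<in> wt nodes ` msets X" by (rule image_eqI[of _ _ "{#t#}"]) (simp_all add: t)
  then have dm: "period \<F> dvd nodes t" unfolding per by (rule Gcd_dvd)
  then have d0: "period \<F> > 0" using nodes_pos[of t] by (metis dvd_0_left_iff gr0I less_irrefl)
  have rT: "radius \<T> \<ge> 1 \<longleftrightarrow> thin X"
    using thin_iff_conv_radius[of "\<lambda>n. real (count_types \<T> n)" X] count_types_trees[OF ad]
    by (simp add: radius_def gen_fun_def fps_conv_radius_def assms(4) X_def)
  have "conv_radius (\<lambda>n. real (count_types \<F> n)) = conv_radius ?f"
  proof (rule conv_radius_cong')
    \<comment> \<open>The sequences may differ at \<open>0\<close>, where only the multisets include
      the empty one.\<close>
    show "eventually (\<lambda>n. real (count_types \<F> n) = ?f n) sequentially"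
      unfolding eventually_sequentially X_def by (intro exI[of _ 1] allI impI) (simp add: count_types_forests[OF ad])
  qed
  then have rF: "radius \<F> = conv_radius ?f" by (simp add: radius_def gen_fun_def fps_conv_radius_def)
  have le1: "radius \<F> \<le> 1" unfolding rF by (rule conv_radius_f_le[OF Xne])
  have sm: "smooth (cnt nodes X)" if "thin X"
  proof -
    obtain tyof K A where ty: "tree_typing tyof K" "X = {t. tyof t \<in> A}"
      using tree_shapes_typing[OF ad assms(3)] unfolding X_def by blast
    show ?thesis using tree_typing.thin_smooth_union[OF ty(1), of A] that unfolding ty(2) .
  qed
  have TF: "radius \<F> = 1" if "thin X"
    using conv_radius_f_ge[OF sm[OF that] Xne] le1 unfolding rF by (rule antisym[rotated])
  have FT: "thin X" if "radius \<F> = 1" using that unfolding rF by (intro thin_of_conv_radius_f) simp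
  have law: "mso_01_law \<F>" if "thin X"
    by (rule mso_01_of_smooth[OF ad X_def Xne sm[OF that] per d0])
  have "radius \<F> = 1" if law: "mso_01_law \<F>"
  proof -
    obtain \<psi> where \<psi>: "sentence \<psi>" "\<And>S :: nat struct. is_forest S \<Longrightarrow> S \<Turnstile> \<psi> \<longleftrightarrow> t \<in># shape S"
      using component_sentence[of t] by blast
    let ?d = "period \<F>"
    obtain L where L: "L \<in> {0, 1}"
      "(\<lambda>n. real (count_types {S \<in> \<F>. S \<Turnstile> \<psi>} (n * ?d)) / real (count_types \<F> (n * ?d))) \<longlonglongrightarrow> L"
      using law \<psi>(1) unfolding mso_01_law_def by blast
    have "eventually (\<lambda>n. real (count_types {S \<in> \<F>. S \<Turnstile> \<psi>} (n * ?d)) / real (count_types \<F> (n * ?d))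
        = ?f (n * ?d - nodes t) / ?f (n * ?d)) sequentially"
      unfolding eventually_sequentially
    proof (intro exI[of _ "nodes t"] allI impI)
      fix n assume n: "nodes t \<le> n"
      have "n \<le> n * ?d" using d0 by (cases ?d) auto
      then have nd: "nodes t \<le> n * ?d" "n * ?d > 0" using n nodes_pos[of t] by linarith+
      have "count_types {S \<in> \<F>. S \<Turnstile> \<psi>} (n * ?d) = card {M \<in> msets X. 1 \<le> count M t \<and> wt nodes M = n * ?d}"
        unfolding X_def
      proof (rule count_types_subclass[where P = "\<lambda>M. 1 \<le> count M t" and Q = "\<lambda>S. S \<Turnstile> \<psi>", OF ad _ nd(2)])
        fix S assume "S \<in> \<F>"
        then show "S \<Turnstile> \<psi> \<longleftrightarrow> 1 \<le> count (shape S) t"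
          using \<psi>(2)[OF adequate_forests[OF ad]] by (simp add: Suc_le_eq)
      qed
      then have "real (count_types {S \<in> \<F>. S \<Turnstile> \<psi>} (n * ?d)) = ?f (n * ?d - nodes t)"
        using card_count_ge_f[OF t, of 1 "n * ?d"] nd(1) by simp
      then show "real (count_types {S \<in> \<F>. S \<Turnstile> \<psi>} (n * ?d)) / real (count_types \<F> (n * ?d))
        = ?f (n * ?d - nodes t) / ?f (n * ?d)"
        using count_types_forests[OF ad nd(2)] by (simp add: X_def)
    qed
    then have lim: "(\<lambda>n. ?f (n * ?d - nodes t) / ?f (n * ?d)) \<longlonglongrightarrow> L"
      using L(2) by (rule Lim_transform_eventually[rotated])
    have "L = 1" using L(1) ratio_limit_0[OF t _ dm] lim by auto
    then have "1 \<le> conv_radius ?f" using ratio_limit_1[OF t _ per] lim by simp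
    then show ?thesis using le1 unfolding rF by simp
  qed
  then show ?thesis using rT TF FT law by blast
qed

end
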